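(* Let $M$ be an oriented space-like surface in $\mathbb{E}^3_1$. Then $M$ is endowed with a canonical principal direction relative to a space-like constant direction if and only if it is congruent to the surface given by one of the following. (1) A surface given by $$x(s,t)=\int^s\cosh\theta(\tau)\,d\tau\,(1,0,0)+\int^s\sinh\theta(\tau)\,d\tau\,(0,\sinh t,\cosh t)+\gamma(t),$$ where $\gamma$ is the $\mathbb{E}^3_1$-valued function given by $\gamma(t)=\left(0,\int^t\Psi(\tau)\cosh\tau\,d\tau,\int^t\Psi(\tau)\sinh\tau\,d\tau\right)$ for a smooth function $\Psi$ of $t$. (2) A flat surface given by $$x(s,t)=\int^s\cosh\theta(\tau)\,d\tau\,(1,0,0)+\int^s\sinh\theta(\tau)\,d\tau\,(0,\sinh t_0,\cosh t_0)+(0,t\cosh t_0,t\sinh t_0)$$ for a constant $t_0$. Here $\theta=\theta(s)$ is a smooth function with non-vanishing derivative.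
   Context: $\mathbb{E}^3_1$ is $\mathbb{R}^3$ with metric $dx_1^2+dx_2^2-dx_3^2$ and Levi-Civita connection $\widetilde\nabla$. A surface is space-like if its induced metric is Riemannian, and flat if its Gaussian curvature vanishes identically. $N$ is the unit normal vector field and the shape operator is $S(X)=-\widetilde\nabla_XN$. A constant direction is a fixed vector $k$ of $\mathbb{E}^3_1$; it is space-like if $\langle k,k\rangle>0$. Write $U$ for the tangential component of $k$ along $M$. $M$ is endowed with a canonical principal direction (CPD) relative to $k$ if $U$ is a principal direction, i.e. $S(U)=k_1U$ for a smooth function $k_1$. Standing assumption: locally, the principal curvature $k_1$ is a non-vanishing function (constant angle surfaces, for which $k_1=0$, are excluded). Congruent means equal up to an isometry of $\mathbb{E}^3_1$. $\int^s$ and $\int^t$ denote antiderivatives.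
   Formalization: The "only if" direction is false where Gaussian curvature vanishes at a point but not near it; the formal version assumes each point is non-flat or has a flat neighbourhood (implied by forms (1), (2)), and also proves the equivalence on a dense set of points without this assumption. *)

theory Defs
  imports "HOL-Analysis.Analysis"
begin

text \<open>\<open>C\<^sup>\<infinity>\<close> maps on an open set: all iterated directional derivatives exist and are continuous.\<close>

primrec times_differentiable_on ::
  "'a::real_normed_vector set \<Rightarrow> ('a \<Rightarrow> 'b::real_normed_vector) \<Rightarrow> nat \<Rightarrow> bool" where
  "times_differentiable_on S f 0 \<longleftrightarrow> continuous_on S f"
| "times_differentiable_on S f (Suc n) \<longleftrightarrow>
     (\<forall>x\<in>S. f differentiable (at x)) \<and>
     (\<forall>v. times_differentiable_on S (\<lambda>x. frechet_derivative f (at x) v) n)"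

definition smooth_on :: "'a::real_normed_vector set \<Rightarrow> ('a \<Rightarrow> 'b::real_normed_vector) \<Rightarrow> bool" where
  "smooth_on S f \<longleftrightarrow> (\<forall>n. times_differentiable_on S f n)"

definition mink :: "real^3 \<Rightarrow> real^3 \<Rightarrow> real" where
  "mink v w = v$1 * w$1 + v$2 * w$2 - v$3 * w$3"

definition spacelike :: "real^3 \<Rightarrow> bool" where
  "spacelike v \<longleftrightarrow> mink v v > 0"

definition mink_isometry :: "(real^3 \<Rightarrow> real^3) \<Rightarrow> bool" where
  "mink_isometry F \<longleftrightarrow> bij F \<and> smooth_on UNIV F \<and> smooth_on UNIV (inv F) \<and>
     (\<forall>p v w. mink (frechet_derivative F (at p) v) (frechet_derivative F (at p) w) = mink v w)"

text \<open>
  A surface is a two-dimensional manifold \<open>M\<close> with an immersion \<open>x\<close> into \<open>\<real>\<^sup>3\<close> (embedded surfaces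
  are the case where \<open>M\<close> is a subspace of \<open>\<real>\<^sup>3\<close> and \<open>x\<close> the identity). No atlas has to be supplied:
  the only smooth structure on \<open>M\<close> for which \<open>x\<close> is an immersion consists of the topological
  charts, written here as local parametrizations \<open>\<phi>\<close>, for which \<open>x \<circ> \<phi>\<close> is a smooth immersion.
\<close>

definition surface_chart ::
  "'a topology \<Rightarrow> ('a \<Rightarrow> real^3) \<Rightarrow> (real \<times> real) set \<Rightarrow> (real \<times> real \<Rightarrow> 'a) \<Rightarrow> bool" where
  "surface_chart M x D \<phi> \<longleftrightarrow>
     open D \<and> openin M (\<phi> ` D) \<and> embedding_map (top_of_set D) M \<phi> \<and>
     smooth_on D (x \<circ> \<phi>) \<and> (\<forall>u\<in>D. inj (frechet_derivative (x \<circ> \<phi>) (at u)))"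

definition immersed_surface :: "'a topology \<Rightarrow> ('a \<Rightarrow> real^3) \<Rightarrow> bool" where
  "immersed_surface M x \<longleftrightarrow>
     Hausdorff_space M \<and> second_countable M \<and>
     (\<forall>p\<in>topspace M. \<exists>D \<phi>. surface_chart M x D \<phi> \<and> p \<in> \<phi> ` D)"

definition smooth_map_on_surface ::
  "'a topology \<Rightarrow> ('a \<Rightarrow> real^3) \<Rightarrow> ('a \<Rightarrow> 'b::real_normed_vector) \<Rightarrow> bool" where
  "smooth_map_on_surface M x f \<longleftrightarrow> (\<forall>D \<phi>. surface_chart M x D \<phi> \<longrightarrow> smooth_on D (f \<circ> \<phi>))"

definition tangent_plane :: "'a topology \<Rightarrow> ('a \<Rightarrow> real^3) \<Rightarrow> 'a \<Rightarrow> (real^3) set" where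
  "tangent_plane M x p =
     {frechet_derivative (x \<circ> \<phi>) (at u) v | D \<phi> u v.
        surface_chart M x D \<phi> \<and> u \<in> D \<and> \<phi> u = p}"

definition spacelike_surface :: "'a topology \<Rightarrow> ('a \<Rightarrow> real^3) \<Rightarrow> bool" where
  "spacelike_surface M x \<longleftrightarrow> immersed_surface M x \<and>
     (\<forall>p\<in>topspace M. \<forall>X\<in>tangent_plane M x p. X \<noteq> 0 \<longrightarrow> mink X X > 0)"

text \<open>An orientation is given by the unit normal \<open>N\<close>, which is time-like for a space-like surface.\<close>

definition unit_normal_field ::
  "'a topology \<Rightarrow> ('a \<Rightarrow> real^3) \<Rightarrow> ('a \<Rightarrow> real^3) \<Rightarrow> bool" where
  "unit_normal_field M x N \<longleftrightarrow> smooth_map_on_surface M x N \<and>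
     (\<forall>p\<in>topspace M. mink (N p) (N p) = -1 \<and> (\<forall>X\<in>tangent_plane M x p. mink (N p) X = 0))"

text \<open>
  The Levi-Civita connection of the flat ambient space is the directional derivative, so for the
  tangent vector \<open>X = d(x \<circ> \<phi>)(v)\<close> the shape operator is \<open>S(X) = - d(N \<circ> \<phi>)(v)\<close>.
\<close>

definition shape_operator ::
  "'a topology \<Rightarrow> ('a \<Rightarrow> real^3) \<Rightarrow> ('a \<Rightarrow> real^3) \<Rightarrow> 'a \<Rightarrow> real^3 \<Rightarrow> real^3" where
  "shape_operator M x N p X =
     (THE Y. \<exists>D \<phi> u v. surface_chart M x D \<phi> \<and> u \<in> D \<and> \<phi> u = p \<and>
        X = frechet_derivative (x \<circ> \<phi>) (at u) v \<and>
        Y = - frechet_derivative (N \<circ> \<phi>) (at u) v)"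

text \<open>
  By the Gauss equation with a time-like unit normal, the Gaussian curvature of the induced metric
  is \<open>K = - det S\<close>; the determinant is expressed by Gram determinants.
\<close>

definition gaussian_curvature ::
  "'a topology \<Rightarrow> ('a \<Rightarrow> real^3) \<Rightarrow> ('a \<Rightarrow> real^3) \<Rightarrow> 'a \<Rightarrow> real" where
  "gaussian_curvature M x N p =
     (THE K. \<forall>X\<in>tangent_plane M x p. \<forall>Y\<in>tangent_plane M x p.
        mink (shape_operator M x N p X) X * mink (shape_operator M x N p Y) Y
          - (mink (shape_operator M x N p X) Y)\<^sup>2
        = - K * (mink X X * mink Y Y - (mink X Y)\<^sup>2))"

definition flat_on ::
  "'a topology \<Rightarrow> ('a \<Rightarrow> real^3) \<Rightarrow> ('a \<Rightarrow> real^3) \<Rightarrow> 'a set \<Rightarrow> bool" where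
  "flat_on M x N W \<longleftrightarrow> (\<forall>q\<in>W. gaussian_curvature M x N q = 0)"

text \<open>The sign below is due to \<open>\<langle>N, N\<rangle> = -1\<close>.\<close>

definition tangential_part :: "('a \<Rightarrow> real^3) \<Rightarrow> real^3 \<Rightarrow> 'a \<Rightarrow> real^3" where
  "tangential_part N k p = k + mink k (N p) *\<^sub>R N p"

definition canonical_principal_direction ::
  "'a topology \<Rightarrow> ('a \<Rightarrow> real^3) \<Rightarrow> ('a \<Rightarrow> real^3) \<Rightarrow> real^3 \<Rightarrow> ('a \<Rightarrow> real) \<Rightarrow> bool" where
  "canonical_principal_direction M x N k k1 \<longleftrightarrow> smooth_map_on_surface M x k1 \<and>
     (\<forall>p\<in>topspace M.
        shape_operator M x N p (tangential_part N k p) = k1 p *\<^sub>R tangential_part N k p)"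

definition open_interval :: "real set \<Rightarrow> bool" where
  "open_interval I \<longleftrightarrow> open I \<and> is_interval I"

definition antiderivative_on :: "real set \<Rightarrow> (real \<Rightarrow> real) \<Rightarrow> (real \<Rightarrow> real) \<Rightarrow> bool" where
  "antiderivative_on I f G \<longleftrightarrow> (\<forall>r\<in>I. (G has_real_derivative f r) (at r))"

text \<open>
  The isometry \<open>F\<close> carries a neighbourhood of \<open>p\<close> in \<open>M\<close> to a piece of the surface of type (1),
  respectively (2). Requiring \<open>\<phi>\<close> to be a chart makes \<open>(s, t) \<mapsto> x(s, t)\<close> a regular parametrization.
\<close>

definition congruent_type1_at ::
  "'a topology \<Rightarrow> ('a \<Rightarrow> real^3) \<Rightarrow> (real^3 \<Rightarrow> real^3) \<Rightarrow> 'a \<Rightarrow> bool" where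
  "congruent_type1_at M x F p \<longleftrightarrow>
     (\<exists>I J \<phi> \<theta> \<Psi> C A \<gamma>2 \<gamma>3.
        open_interval I \<and> open_interval J \<and>
        surface_chart M (F \<circ> x) (I \<times> J) \<phi> \<and> p \<in> \<phi> ` (I \<times> J) \<and>
        smooth_on I \<theta> \<and> (\<forall>s\<in>I. deriv \<theta> s \<noteq> 0) \<and> smooth_on J \<Psi> \<and>
        antiderivative_on I (\<lambda>\<tau>. cosh (\<theta> \<tau>)) C \<and>
        antiderivative_on I (\<lambda>\<tau>. sinh (\<theta> \<tau>)) A \<and>
        antiderivative_on J (\<lambda>\<tau>. \<Psi> \<tau> * cosh \<tau>) \<gamma>2 \<and>
        antiderivative_on J (\<lambda>\<tau>. \<Psi> \<tau> * sinh \<tau>) \<gamma>3 \<and>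
        (\<forall>s\<in>I. \<forall>t\<in>J. F (x (\<phi> (s, t))) =
           C s *\<^sub>R vector [1, 0, 0] + A s *\<^sub>R vector [0, sinh t, cosh t]
           + vector [0, \<gamma>2 t, \<gamma>3 t]))"

definition congruent_type2_at ::
  "'a topology \<Rightarrow> ('a \<Rightarrow> real^3) \<Rightarrow> ('a \<Rightarrow> real^3) \<Rightarrow> (real^3 \<Rightarrow> real^3) \<Rightarrow> 'a \<Rightarrow> bool" where
  "congruent_type2_at M x N F p \<longleftrightarrow>
     (\<exists>I J \<phi> \<theta> t0 C A.
        open_interval I \<and> open_interval J \<and>
        surface_chart M (F \<circ> x) (I \<times> J) \<phi> \<and> p \<in> \<phi> ` (I \<times> J) \<and>
        flat_on M x N (\<phi> ` (I \<times> J)) \<and>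
        smooth_on I \<theta> \<and> (\<forall>s\<in>I. deriv \<theta> s \<noteq> 0) \<and>
        antiderivative_on I (\<lambda>\<tau>. cosh (\<theta> \<tau>)) C \<and>
        antiderivative_on I (\<lambda>\<tau>. sinh (\<theta> \<tau>)) A \<and>
        (\<forall>s\<in>I. \<forall>t\<in>J. F (x (\<phi> (s, t))) =
           C s *\<^sub>R vector [1, 0, 0] + A s *\<^sub>R vector [0, sinh t0, cosh t0]
           + vector [0, t * cosh t0, t * sinh t0]))"

text \<open>
  The alternative between (1) and (2) presupposes that near each point the surface is either flat or
  nowhere flat; points violating this are nowhere dense but do occur. For instance
  \<open>(s, t) \<mapsto> C(s) (1, 0, 0) + A(s) (0, sinh (t\<^sup>3), cosh (t\<^sup>3)) + (0, B(t), D(t))\<close>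
  with \<open>C' = cosh \<theta>\<close>, \<open>A' = sinh \<theta>\<close>, \<open>\<theta>' \<noteq> 0\<close>, \<open>B' = cosh (t\<^sup>3)\<close>, \<open>D' = sinh (t\<^sup>3)\<close> is regular near
  \<open>t = 0\<close> and has a canonical principal direction relative to \<open>(1, 0, 0)\<close> with \<open>k\<^sub>1 \<noteq> 0\<close>. Its
  curvature vanishes exactly on \<open>t = 0\<close>, so near these points it is neither of type (1), where
  \<open>K \<noteq> 0\<close> everywhere, nor flat.
\<close>

definition flat_or_nonflat_at ::
  "'a topology \<Rightarrow> ('a \<Rightarrow> real^3) \<Rightarrow> ('a \<Rightarrow> real^3) \<Rightarrow> 'a \<Rightarrow> bool" where
  "flat_or_nonflat_at M x N p \<longleftrightarrow>
     gaussian_curvature M x N p \<noteq> 0 \<or> (\<exists>W. openin M W \<and> p \<in> W \<and> flat_on M x N W)"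

definition dense_in_surface :: "'a topology \<Rightarrow> ('a \<Rightarrow> bool) \<Rightarrow> bool" where
  "dense_in_surface M P \<longleftrightarrow> M closure_of {p \<in> topspace M. P p} = topspace M"

end

theory Submission
  imports Defs
begin

text \<open>
  Move \<open>k\<close> to a positive multiple of \<open>(1, 0, 0)\<close> by a reflection, and write the (future-directed)
  unit normal as \<open>(sinh \<theta>, cosh \<theta> sinh t, cosh \<theta> cosh t)\<close>. It is completed to an orthonormal frame by
  \<open>e\<^sub>1 = (cosh \<theta>, sinh \<theta> sinh t, sinh \<theta> cosh t)\<close>, which is parallel to \<open>U\<close>, and \<open>e\<^sub>2 = (0, cosh t, sinh t)\<close>.
  With \<open>\<alpha> = \<langle>dx, e\<^sub>1\<rangle>\<close> and \<open>\<beta> = \<langle>dx, e\<^sub>2\<rangle>\<close>, self-adjointness of the shape operator turns \<open>S U = k\<^sub>1 U\<close> into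
  \<open>d\<theta> = - k\<^sub>1 \<alpha>\<close> and \<open>dt = \<mu> \<beta>\<close>, where \<open>\<mu> = 0\<close> exactly where the surface is flat. Since
  \<open>dx\<^sub>1 = cosh \<theta> \<alpha>\<close>, the coordinate \<open>x\<^sub>1\<close> is locally a function of \<open>\<theta>\<close>, whence \<open>\<alpha> = ds\<close> is exact.
  Away from flat points \<open>(s, t)\<close> are coordinates, and \<open>\<partial>\<^sub>s x = e\<^sub>1\<close>, \<open>\<partial>\<^sub>t x \<parallel> e\<^sub>2\<close> integrate to form (1). On a flat
  piece \<open>t\<close> is constant, and \<open>(s, \<langle>x, e\<^sub>2\<rangle>)\<close> are coordinates giving form (2). Conversely, an isometry is
  affine, so it carries \<open>(1, 0, 0)\<close> back to a fixed direction \<open>k\<close>; the frame equations give \<open>S U = k\<^sub>1 U\<close>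
  on the dense set of points of either form, and \<open>k\<^sub>1 = \<langle>S U, U\<rangle> / \<langle>U, U\<rangle>\<close> is smooth everywhere
  because \<open>\<langle>U, U\<rangle> = \<langle>k, k\<rangle> + \<langle>k, N\<rangle>\<^sup>2 > 0\<close>.
\<close>

text \<open>The alternative between (1) and (2) can fail at a flat point that is a limit of non-flat
  ones. Hence there are two equivalences: one for surfaces that are locally flat or non-flat at
  every point, and one on a dense set of points. The second one works because the points with K
  \<noteq> 0 together with the interior of the set K = 0 are always dense. The function \<mu> is
  known only point by point and is never shown to be continuous. Only its vanishing matters, and
  this is read off from the injectivity of dN, which also decides whether K = 0. Exactness of
  \<alpha> is obtained without differential forms: \<alpha> is pulled back along \<theta> from a
  one-variable differential. This needs d\<theta> \<noteq> 0, which holds because k_1 \<noteq> 0. In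
  the converse, N agrees with the frame normal only up to a sign chosen at each point, so the
  orthogonality relations are differentiated instead of a formula for N. A single isometry can serve
  all points, since it depends only on k.\<close>

abbreviation Dv :: "('a::real_normed_vector \<Rightarrow> 'b::real_normed_vector) \<Rightarrow> 'a \<Rightarrow> 'a \<Rightarrow> 'b" where
  "Dv f u \<equiv> frechet_derivative f (at u)"

subsection \<open>Smooth maps\<close>

lemma Dv_cong:
  assumes "open S" "x \<in> S" "\<And>y. y \<in> S \<Longrightarrow> f y = g y" "f differentiable (at x)"
  shows "Dv g x = Dv f x" "g differentiable (at x)"
proof -
  have "(f has_derivative Dv f x) (at x)"
    using assms(4) frechet_derivative_works by blast
  then have *: "(g has_derivative Dv f x) (at x)"
    using assms(1-3) by (rule has_derivative_transform_within_open)
  show "Dv g x = Dv f x"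
    using frechet_derivative_at[OF *] by simp
  show "g differentiable (at x)"
    using * unfolding differentiable_def by blast
qed

lemma times_differentiable_on_cong:
  assumes "open S" "\<And>y. y \<in> S \<Longrightarrow> f y = g y" "times_differentiable_on S f n"
  shows "times_differentiable_on S g n"
  using assms(2,3)
proof (induction n arbitrary: f g)
  case 0
  then show ?case by (simp add: continuous_on_cong[of S S f g])
next
  case (Suc n)
  have d: "f differentiable (at x)" if "x \<in> S" for x
    using Suc.prems(2) that by simp
  have "times_differentiable_on S (\<lambda>x. Dv g x v) n" for v
  proof (rule Suc.IH)
    show "Dv f y v = Dv g y v" if "y \<in> S" for y
      using Dv_cong(1)[OF assms(1) that Suc.prems(1) d[OF that]] by simp
    show "times_differentiable_on S (\<lambda>x. Dv f x v) n"
      using Suc.prems(2) by simp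
  qed
  moreover have "g differentiable (at x)" if "x \<in> S" for x
    using Dv_cong(2)[OF assms(1) that Suc.prems(1) d[OF that]] .
  ultimately show ?case by simp
qed

lemma times_differentiable_on_subset:
  "times_differentiable_on S f n \<Longrightarrow> T \<subseteq> S \<Longrightarrow> times_differentiable_on T f n"
  by (induction n arbitrary: f) (auto intro: continuous_on_subset)

lemma times_differentiable_on_Suc_imp:
  "times_differentiable_on S f (Suc n) \<Longrightarrow> times_differentiable_on S f n"
proof (induction n arbitrary: f)
  case 0
  then show ?case
    by (auto intro!: continuous_at_imp_continuous_on differentiable_imp_continuous_within)
next
  case (Suc n)
  have "times_differentiable_on S (\<lambda>x. Dv f x v) n" for v
    using Suc.IH[of "\<lambda>x. Dv f x v"] Suc.prems unfolding times_differentiable_on.simps(2)[of S f] by blast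
  then show ?case using Suc.prems unfolding times_differentiable_on.simps(2)[of S f] by blast
qed

text \<open>Uniqueness of the derivative identifies \<open>f'\<close> with \<open>Dv f\<close>, so
  that closed formulas such as the product rule can drive an induction on the order.\<close>

lemma times_differentiable_on_SucI:
  assumes "open S" "\<And>x. x \<in> S \<Longrightarrow> (f has_derivative f' x) (at x)"
    "\<And>v. times_differentiable_on S (\<lambda>x. f' x v) n"
  shows "times_differentiable_on S f (Suc n)"
proof -
  have "Dv f x = f' x" if "x \<in> S" for x
    using frechet_derivative_at[OF assms(2)[OF that]] by simp
  then have "times_differentiable_on S (\<lambda>x. Dv f x v) n" for v
    using times_differentiable_on_cong[OF assms(1) _ assms(3)[of v]] by simp
  then show ?thesis
    using assms(2) by (auto simp: differentiable_def)
qed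

lemma times_differentiable_on_has_derivative:
  "times_differentiable_on S f (Suc n) \<Longrightarrow> x \<in> S \<Longrightarrow> (f has_derivative Dv f x) (at x)"
  by (simp add: frechet_derivative_works)

lemma times_differentiable_on_const: "times_differentiable_on S (\<lambda>x. c) n"
  by (induction n arbitrary: c) (auto simp: frechet_derivative_const)

lemma times_differentiable_on_bounded_linear:
  assumes "open S" "bounded_linear f"
  shows "times_differentiable_on S f n"
proof (cases n)
  case 0
  then show ?thesis using assms(2) by (simp add: linear_continuous_on)
next
  case (Suc m)
  have "(f has_derivative f) (at x)" for x
    using assms(2) by (rule bounded_linear_imp_has_derivative)
  then show ?thesis unfolding Suc
    using times_differentiable_on_SucI[OF assms(1), of f "\<lambda>_. f" m] times_differentiable_on_const by blast
qed

lemma times_differentiable_on_add: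
  assumes "open S" "times_differentiable_on S f n" "times_differentiable_on S g n"
  shows "times_differentiable_on S (\<lambda>x. f x + g x) n"
  using assms(2,3)
proof (induction n arbitrary: f g)
  case 0
  then show ?case by (simp add: continuous_on_add)
next
  case (Suc n)
  show ?case
  proof (rule times_differentiable_on_SucI[OF assms(1)])
    show "((\<lambda>x. f x + g x) has_derivative (\<lambda>v. Dv f x v + Dv g x v)) (at x)" if "x \<in> S" for x
      using that Suc.prems by (intro has_derivative_add) (auto intro: times_differentiable_on_has_derivative)
    show "times_differentiable_on S (\<lambda>x. Dv f x v + Dv g x v) n" for v
      using Suc.prems by (intro Suc.IH) auto
  qed
qed

lemma times_differentiable_on_bilinear:
  assumes "open S" "bounded_bilinear p"
    "times_differentiable_on S f n" "times_differentiable_on S g n"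
  shows "times_differentiable_on S (\<lambda>x. p (f x) (g x)) n"
  using assms(3,4)
proof (induction n arbitrary: f g)
  case 0
  then show ?case using bounded_bilinear.continuous_on[OF assms(2)] by simp
next
  case (Suc n)
  show ?case
  proof (rule times_differentiable_on_SucI[OF assms(1)])
    show "((\<lambda>x. p (f x) (g x)) has_derivative (\<lambda>v. p (f x) (Dv g x v) + p (Dv f x v) (g x))) (at x)"
      if "x \<in> S" for x
      using that Suc.prems
      by (intro bounded_bilinear.FDERIV[OF assms(2)]) (auto intro: times_differentiable_on_has_derivative)
    show "times_differentiable_on S (\<lambda>x. p (f x) (Dv g x v) + p (Dv f x v) (g x)) n" for v
    \<comment> \<open>The product rule keeps undifferentiated factors; these are lowered from order
      \<open>Suc n\<close> to \<open>n\<close> before the induction hypothesis applies.\<close>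
    proof (intro times_differentiable_on_add[OF assms(1)] Suc.IH)
      show "times_differentiable_on S f n" "times_differentiable_on S g n"
        using Suc.prems times_differentiable_on_Suc_imp by blast+
    qed (use Suc.prems in auto)
  qed
qed

lemma times_differentiable_on_sum:
  assumes "open S" "\<And>i. i \<in> I \<Longrightarrow> times_differentiable_on S (f i) n"
  shows "times_differentiable_on S (\<lambda>x. \<Sum>i\<in>I. f i x) n"
proof (cases "finite I")
  case True
  then show ?thesis using assms(2)
    by (induction I rule: finite_induct)
      (auto intro: times_differentiable_on_const times_differentiable_on_add[OF assms(1)])
qed (simp add: times_differentiable_on_const)

text \<open>The derivative of the outer map is expanded in a basis, since the induction needs the outer
  direction to be fixed.\<close>

lemma times_differentiable_on_compose:
  fixes g :: "'b::euclidean_space \<Rightarrow> 'c::real_normed_vector"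
  assumes "open S" "open T" "f ` S \<subseteq> T" "times_differentiable_on T g n" "times_differentiable_on S f n"
  shows "times_differentiable_on S (\<lambda>x. g (f x)) n"
  using assms(3-5)
proof (induction n arbitrary: g)
  case 0
  then show ?case using continuous_on_compose2[of T g S f] by simp
next
  case (Suc n)
  show ?case
  proof (rule times_differentiable_on_SucI[OF assms(1)])
    fix x assume x: "x \<in> S"
    have g: "(g has_derivative Dv g (f x)) (at (f x))"
      using Suc.prems x by (intro times_differentiable_on_has_derivative[of T]) auto
    have f: "(f has_derivative Dv f x) (at x)"
      using Suc.prems x by (intro times_differentiable_on_has_derivative[of S]) auto
    have lin: "linear (Dv g (f x))"
      using g has_derivative_linear by blast
    have "Dv g (f x) (Dv f x v) = (\<Sum>b\<in>Basis. (Dv f x v \<bullet> b) *\<^sub>R Dv g (f x) b)" for v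
      by (subst euclidean_representation[of "Dv f x v", symmetric])
        (simp add: linear_sum[OF lin] linear_scale[OF lin] del: euclidean_representation)
    then show "((\<lambda>x. g (f x)) has_derivative
        (\<lambda>v. \<Sum>b\<in>Basis. (Dv f x v \<bullet> b) *\<^sub>R Dv g (f x) b)) (at x)"
      using has_derivative_compose[OF f g] by simp
  next
    fix v
    have "times_differentiable_on S (\<lambda>x. Dv f x v \<bullet> b) n" for b
      using Suc.prems
      by (intro times_differentiable_on_bilinear[OF assms(1) bounded_bilinear_inner]
          times_differentiable_on_const) simp
    moreover have "times_differentiable_on S (\<lambda>x. Dv g (f x) b) n" for b
    proof (rule Suc.IH)
      show "times_differentiable_on S f n"
        using Suc.prems times_differentiable_on_Suc_imp by blast
    qed (use Suc.prems in auto)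
    ultimately show "times_differentiable_on S
        (\<lambda>x. \<Sum>b\<in>Basis. (Dv f x v \<bullet> b) *\<^sub>R Dv g (f x) b) n"
      by (intro times_differentiable_on_sum[OF assms(1)]
          times_differentiable_on_bilinear[OF assms(1) bounded_bilinear_scaleR])
  qed
qed

lemma smooth_on_cong:
  "open S \<Longrightarrow> (\<And>y. y \<in> S \<Longrightarrow> f y = g y) \<Longrightarrow> smooth_on S f \<Longrightarrow> smooth_on S g"
  unfolding smooth_on_def using times_differentiable_on_cong by metis

lemma smooth_on_subset: "smooth_on S f \<Longrightarrow> T \<subseteq> S \<Longrightarrow> smooth_on T f"
  unfolding smooth_on_def using times_differentiable_on_subset by blast

lemma smooth_on_differentiable: "smooth_on S f \<Longrightarrow> x \<in> S \<Longrightarrow> f differentiable (at x)"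
  unfolding smooth_on_def using times_differentiable_on.simps(2) by blast

lemma smooth_on_has_derivative: "smooth_on S f \<Longrightarrow> x \<in> S \<Longrightarrow> (f has_derivative Dv f x) (at x)"
  using smooth_on_differentiable frechet_derivative_works by blast

lemma smooth_on_continuous: "smooth_on S f \<Longrightarrow> continuous_on S f"
  unfolding smooth_on_def using times_differentiable_on.simps(1) by blast

lemma smooth_on_Dv: "smooth_on S f \<Longrightarrow> smooth_on S (\<lambda>x. Dv f x v)"
  unfolding smooth_on_def using times_differentiable_on.simps(2) by blast

lemma smooth_onI:
  assumes "open S" "\<And>x. x \<in> S \<Longrightarrow> (f has_derivative f' x) (at x)"
    "\<And>v. smooth_on S (\<lambda>x. f' x v)"
  shows "smooth_on S f"
  unfolding smooth_on_def
proof
  fix n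
  have "times_differentiable_on S f (Suc n)"
    using assms by (intro times_differentiable_on_SucI) (auto simp: smooth_on_def)
  then show "times_differentiable_on S f n"
    by (rule times_differentiable_on_Suc_imp)
qed

lemma smooth_on_const: "smooth_on S (\<lambda>x. c)"
  by (simp add: smooth_on_def times_differentiable_on_const)

lemma smooth_on_bounded_linear: "open S \<Longrightarrow> bounded_linear f \<Longrightarrow> smooth_on S f"
  by (simp add: smooth_on_def times_differentiable_on_bounded_linear)

lemma smooth_on_id: "open S \<Longrightarrow> smooth_on S (\<lambda>x. x)"
  by (rule smooth_on_bounded_linear[OF _ bounded_linear_ident])

lemma smooth_on_add:
  "open S \<Longrightarrow> smooth_on S f \<Longrightarrow> smooth_on S g \<Longrightarrow> smooth_on S (\<lambda>x. f x + g x)"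
  by (simp add: smooth_on_def times_differentiable_on_add)

lemma smooth_on_bilinear:
  "open S \<Longrightarrow> bounded_bilinear p \<Longrightarrow> smooth_on S f \<Longrightarrow> smooth_on S g
    \<Longrightarrow> smooth_on S (\<lambda>x. p (f x) (g x))"
  by (simp add: smooth_on_def times_differentiable_on_bilinear)

lemmas smooth_on_scaleR = smooth_on_bilinear[OF _ bounded_bilinear_scaleR]

lemma smooth_on_mult:
  fixes f g :: "'a::real_normed_vector \<Rightarrow> real"
  shows "open S \<Longrightarrow> smooth_on S f \<Longrightarrow> smooth_on S g \<Longrightarrow> smooth_on S (\<lambda>x. f x * g x)"
  by (rule smooth_on_bilinear[OF _ bounded_bilinear_mult])

lemma smooth_on_compose:
  fixes g :: "'b::euclidean_space \<Rightarrow> 'c::real_normed_vector"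
  assumes "open S" "open T" "f ` S \<subseteq> T" "smooth_on T g" "smooth_on S f"
  shows "smooth_on S (\<lambda>x. g (f x))"
  using assms unfolding smooth_on_def by (auto intro: times_differentiable_on_compose)

lemma smooth_on_linear_compose:
  fixes g :: "'b::euclidean_space \<Rightarrow> 'c::real_normed_vector"
  assumes "open S" "bounded_linear g" "smooth_on S f"
  shows "smooth_on S (\<lambda>x. g (f x))"
  by (rule smooth_on_compose[OF assms(1) open_UNIV _ smooth_on_bounded_linear[OF open_UNIV assms(2)] assms(3)])
    simp

lemma smooth_on_uminus:
  fixes f :: "'b::real_normed_vector \<Rightarrow> 'c::euclidean_space"
  shows "open S \<Longrightarrow> smooth_on S f \<Longrightarrow> smooth_on S (\<lambda>x. - f x)"
  by (rule smooth_on_linear_compose[OF _ bounded_linear_minus[OF bounded_linear_ident]])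

lemma smooth_on_diff:
  fixes f :: "'b::real_normed_vector \<Rightarrow> 'c::euclidean_space"
  shows "open S \<Longrightarrow> smooth_on S f \<Longrightarrow> smooth_on S g \<Longrightarrow> smooth_on S (\<lambda>x. f x - g x)"
  using smooth_on_add[OF _ _ smooth_on_uminus, of S f g] by simp

lemma smooth_on_Pair:
  fixes f :: "'b::real_normed_vector \<Rightarrow> 'c::euclidean_space" and g :: "'b \<Rightarrow> 'd::euclidean_space"
  assumes "open S" "smooth_on S f" "smooth_on S g"
  shows "smooth_on S (\<lambda>x. (f x, g x))"
proof -
  have 1: "smooth_on S (\<lambda>x. (f x, 0::'d))"
    by (rule smooth_on_linear_compose[OF assms(1) _ assms(2)])
      (intro bounded_linear_Pair bounded_linear_ident bounded_linear_zero)
  have 2: "smooth_on S (\<lambda>x. (0::'c, g x))"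
    by (rule smooth_on_linear_compose[OF assms(1) _ assms(3)])
      (intro bounded_linear_Pair bounded_linear_ident bounded_linear_zero)
  show ?thesis using smooth_on_add[OF assms(1) 1 2] by simp
qed

text \<open>A solution of a smooth autonomous total differential equation is smooth; this covers
  reciprocals, \<open>arsinh\<close> and local inverses.\<close>

lemma smooth_on_autonomous:
  fixes f :: "'a::real_normed_vector \<Rightarrow> 'b::euclidean_space"
  assumes "open S" "open T" "f ` S \<subseteq> T"
    "\<And>x. x \<in> S \<Longrightarrow> (f has_derivative (\<lambda>v. G v (f x))) (at x)" "\<And>v. smooth_on T (G v)"
  shows "smooth_on S f"
proof -
  have "times_differentiable_on S f n" for n
  proof (induction n)
    case 0
    then show ?case using assms(4)
      by (auto intro!: continuous_at_imp_continuous_on has_derivative_continuous)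
  next
    case (Suc n)
    show ?case
    proof (rule times_differentiable_on_SucI[OF assms(1,4)])
      show "times_differentiable_on S (\<lambda>x. G v (f x)) n" for v
        using assms(5)[of v] times_differentiable_on_compose[OF assms(1,2,3) _ Suc, of "G v"]
        by (simp add: smooth_on_def)
    qed
  qed
  then show ?thesis by (simp add: smooth_on_def)
qed

lemma smooth_on_inverse:
  fixes f :: "'a::real_normed_vector \<Rightarrow> real"
  assumes "open S" "smooth_on S f" "\<And>x. x \<in> S \<Longrightarrow> f x \<noteq> 0"
  shows "smooth_on S (\<lambda>x. inverse (f x))"
proof -
  have "smooth_on (- {0}) (inverse :: real \<Rightarrow> real)"
  \<comment> \<open>Away from 0 the reciprocal f solves df(v) = - f v f, whose right-hand side is
    polynomial in f.\<close>
  proof (rule smooth_on_autonomous[where T = UNIV and G = "\<lambda>v z. - (z * v * z)"])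
    show "(inverse has_derivative (\<lambda>v. - (inverse x * v * inverse x))) (at x)" if "x \<in> - {0}" for x :: real
      using that by (intro has_derivative_inverse') auto
    show "smooth_on UNIV (\<lambda>z. - (z * v * z))" for v :: real
      by (intro smooth_on_uminus smooth_on_mult smooth_on_const smooth_on_id) auto
  qed auto
  then show ?thesis
    by (intro smooth_on_compose[OF assms(1) _ _ _ assms(2), of "- {0}" inverse]) (use assms(3) in auto)
qed

text \<open>Each function is the derivative of the other, so the induction on the order treats both
  together.\<close>

lemma smooth_on_sinh_cosh: "smooth_on UNIV (sinh :: real \<Rightarrow> real)" "smooth_on UNIV (cosh :: real \<Rightarrow> real)"
proof -
  have "times_differentiable_on UNIV (sinh :: real \<Rightarrow> real) n \<and>
        times_differentiable_on UNIV (cosh :: real \<Rightarrow> real) n" for n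
  proof (induction n)
    case 0
    then show ?case by (simp add: continuous_on_sinh continuous_on_cosh continuous_on_id)
  next
    case (Suc n)
    have s: "(sinh has_derivative (\<lambda>v. cosh x * v)) (at x)"
      and c: "(cosh has_derivative (\<lambda>v. sinh x * v)) (at x)" for x :: real
      using has_field_derivative_sinh[OF DERIV_ident, of x UNIV] has_field_derivative_cosh[OF DERIV_ident, of x UNIV]
      by (simp_all add: has_field_derivative_def)
    show ?case
      using Suc
      by (auto simp del: times_differentiable_on.simps intro!: times_differentiable_on_SucI[OF _ s]
          times_differentiable_on_SucI[OF _ c] times_differentiable_on_const
          times_differentiable_on_bilinear[OF _ bounded_bilinear_mult])
  qed
  then show "smooth_on UNIV (sinh :: real \<Rightarrow> real)" "smooth_on UNIV (cosh :: real \<Rightarrow> real)"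
    by (auto simp: smooth_on_def)
qed

lemma smooth_on_sinh:
  "open S \<Longrightarrow> smooth_on S f \<Longrightarrow> smooth_on S (\<lambda>x. sinh (f x :: real))"
  by (rule smooth_on_compose[OF _ open_UNIV _ smooth_on_sinh_cosh(1)]) auto

lemma smooth_on_cosh:
  "open S \<Longrightarrow> smooth_on S f \<Longrightarrow> smooth_on S (\<lambda>x. cosh (f x :: real))"
  by (rule smooth_on_compose[OF _ open_UNIV _ smooth_on_sinh_cosh(2)]) auto

lemma smooth_on_arsinh:
  assumes "open S" "smooth_on S f"
  shows "smooth_on S (\<lambda>x. arsinh (f x :: real))"
proof -
  have "smooth_on UNIV (arsinh :: real \<Rightarrow> real)"
  \<comment> \<open>The derivative of arsinh is 1 / cosh evaluated at arsinh itself.\<close>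
  proof (rule smooth_on_autonomous[where T = UNIV and G = "\<lambda>v z. inverse (cosh z) * v"])
    show "(arsinh has_derivative (\<lambda>v. inverse (cosh (arsinh x)) * v)) (at x)" for x :: real
      using arsinh_real_has_field_derivative[of x UNIV]
      by (simp add: has_field_derivative_def cosh_arsinh_real divide_inverse)
    show "smooth_on UNIV (\<lambda>z. inverse (cosh z) * v)" for v :: real
      by (intro smooth_on_mult smooth_on_inverse smooth_on_cosh smooth_on_const smooth_on_id) auto
  qed auto
  then show ?thesis
    by (intro smooth_on_compose[OF assms(1) open_UNIV _ _ assms(2)]) auto
qed

section \<open>Symmetry of second derivatives\<close>

lemma second_difference_mean_value:
  fixes f :: "'a::real_normed_vector \<Rightarrow> real"
  assumes "times_differentiable_on S f 2" "0 < h"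
    and S: "\<And>a b. 0 \<le> a \<Longrightarrow> a \<le> h \<Longrightarrow> 0 \<le> b \<Longrightarrow> b \<le> h \<Longrightarrow> x + a *\<^sub>R v + b *\<^sub>R w \<in> S"
  obtains a b where "0 < a" "a < h" "0 < b" "b < h"
    "f (x + h *\<^sub>R v + h *\<^sub>R w) - f (x + h *\<^sub>R v) - f (x + h *\<^sub>R w) + f x
       = h * h * Dv (\<lambda>y. Dv f y v) (x + a *\<^sub>R v + b *\<^sub>R w) w"
proof -
  have f1: "(f has_derivative Dv f y) (at y)" if "y \<in> S" for y
    using assms(1) that by (intro times_differentiable_on_has_derivative[of S f 1])
      (auto simp: numeral_2_eq_2)
  have f2: "((\<lambda>y. Dv f y v) has_derivative Dv (\<lambda>y. Dv f y v) y) (at y)" if "y \<in> S" for y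
    using assms(1) that by (intro times_differentiable_on_has_derivative[of S _ 0])
      (auto simp: numeral_2_eq_2)
  have lin1: "Dv f y (c *\<^sub>R z) = c * Dv f y z" if "y \<in> S" for y c z
    using linear_scale[OF has_derivative_linear[OF f1[OF that]]] by simp
  have lin2: "Dv (\<lambda>y. Dv f y v) y (c *\<^sub>R z) = c * Dv (\<lambda>y. Dv f y v) y z" if "y \<in> S" for y c z
    using linear_scale[OF has_derivative_linear[OF f2[OF that]]] by simp
  \<comment> \<open>The increment of \<open>f\<close> in direction \<open>w\<close>, as a function
    of the displacement along \<open>v\<close>. Its own increment over [0, h] is the second
    difference, so the mean value theorem is used once for \<open>?p\<close> and once for
    \<open>?q\<close>.\<close>
  let ?p = "\<lambda>a. f (x + a *\<^sub>R v + h *\<^sub>R w) - f (x + a *\<^sub>R v)"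
  have "\<exists>a>0. a < h \<and> ?p h - ?p 0 = (h - 0) * (Dv f (x + a *\<^sub>R v + h *\<^sub>R w) v - Dv f (x + a *\<^sub>R v) v)"
  proof (rule MVT2[OF assms(2)])
    fix a assume a: "0 \<le> a" "a \<le> h"
    have i: "x + a *\<^sub>R v + h *\<^sub>R w \<in> S" "x + a *\<^sub>R v \<in> S"
      using S[OF a, of h] S[OF a, of 0] assms(2) by auto
    have "((\<lambda>a. x + a *\<^sub>R v + h *\<^sub>R w) has_derivative (\<lambda>t. t *\<^sub>R v)) (at a)"
      and "((\<lambda>a. x + a *\<^sub>R v) has_derivative (\<lambda>t. t *\<^sub>R v)) (at a)"
      by (auto intro!: derivative_eq_intros)
    from has_derivative_compose[OF this(1) f1[OF i(1)]] has_derivative_compose[OF this(2) f1[OF i(2)]]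
    have "(?p has_derivative (\<lambda>t. Dv f (x + a *\<^sub>R v + h *\<^sub>R w) (t *\<^sub>R v) - Dv f (x + a *\<^sub>R v) (t *\<^sub>R v))) (at a)"
      by (rule has_derivative_diff)
    then show "(?p has_real_derivative Dv f (x + a *\<^sub>R v + h *\<^sub>R w) v - Dv f (x + a *\<^sub>R v) v) (at a)"
      by (rule has_derivative_imp_has_field_derivative) (simp only: lin1[OF i(1)] lin1[OF i(2)] right_diff_distrib)
  qed
  then obtain a where a: "0 < a" "a < h"
    and pa: "?p h - ?p 0 = h * (Dv f (x + a *\<^sub>R v + h *\<^sub>R w) v - Dv f (x + a *\<^sub>R v) v)"
    by auto
  let ?q = "\<lambda>b. Dv f (x + a *\<^sub>R v + b *\<^sub>R w) v"
  have "\<exists>b>0. b < h \<and> ?q h - ?q 0 = (h - 0) * Dv (\<lambda>y. Dv f y v) (x + a *\<^sub>R v + b *\<^sub>R w) w"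
  proof (rule MVT2[OF assms(2)])
    fix b assume b: "0 \<le> b" "b \<le> h"
    have i: "x + a *\<^sub>R v + b *\<^sub>R w \<in> S"
      using S[of a b] a b by auto
    have "((\<lambda>b. x + a *\<^sub>R v + b *\<^sub>R w) has_derivative (\<lambda>t. t *\<^sub>R w)) (at b)"
      by (auto intro!: derivative_eq_intros)
    from has_derivative_compose[OF this f2[OF i]]
    show "(?q has_real_derivative Dv (\<lambda>y. Dv f y v) (x + a *\<^sub>R v + b *\<^sub>R w) w) (at b)"
      by (rule has_derivative_imp_has_field_derivative) (simp add: lin2 i)
  qed
  then obtain b where b: "0 < b" "b < h"
    and qb: "?q h - ?q 0 = h * Dv (\<lambda>y. Dv f y v) (x + a *\<^sub>R v + b *\<^sub>R w) w"
    by auto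
  from pa have "f (x + h *\<^sub>R v + h *\<^sub>R w) - f (x + h *\<^sub>R v) - f (x + h *\<^sub>R w) + f x
      = h * (?q h - ?q 0)" by simp
  then show thesis using that[OF a b] qb by simp
qed

text \<open>The second difference does not change when \<open>v\<close> and \<open>w\<close> are
  exchanged. So the two mixed derivatives share a value, taken at two points arbitrarily close to
  \<open>x\<close>, and continuity excludes a gap at \<open>x\<close>.\<close>

lemma symmetric_second_derivative_real:
  fixes f :: "'a::real_normed_vector \<Rightarrow> real"
  assumes "open S" "times_differentiable_on S f 2" "x \<in> S"
  shows "Dv (\<lambda>y. Dv f y v) x w = Dv (\<lambda>y. Dv f y w) x v"
proof (rule ccontr)
  let ?A = "\<lambda>y. Dv (\<lambda>y. Dv f y v) y w" and ?B = "\<lambda>y. Dv (\<lambda>y. Dv f y w) y v"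
  define e where "e = dist (?A x) (?B x) / 2"
  assume "?A x \<noteq> ?B x"
  then have e: "e > 0" by (simp add: e_def)
  have c: "continuous_on S (\<lambda>y. Dv (\<lambda>y. Dv f y v) y w)" for v w
    using assms(2) by (simp add: numeral_2_eq_2)
  obtain d1 where d1: "d1 > 0" "\<And>y. y \<in> S \<Longrightarrow> dist y x < d1 \<Longrightarrow> dist (?A y) (?A x) < e"
    using c[of v w] e assms(3) unfolding continuous_on_iff by blast
  obtain d2 where d2: "d2 > 0" "\<And>y. y \<in> S \<Longrightarrow> dist y x < d2 \<Longrightarrow> dist (?B y) (?B x) < e"
    using c[of w v] e assms(3) unfolding continuous_on_iff by blast
  obtain d3 where d3: "d3 > 0" "ball x d3 \<subseteq> S"
    using assms(1,3) open_contains_ball by blast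
  define d where "d = min d1 (min d2 d3)"
  have d: "d > 0" using d1 d2 d3 by (simp add: d_def)
  \<comment> \<open>All points of the parallelogram then lie within d / 2 of \<open>x\<close>; the
    summand 1 keeps the denominator positive even for v = w = 0.\<close>
  define h where "h = d / (2 * (norm v + norm w + 1))"
  have h: "h > 0" unfolding h_def using d by (simp add: add_nonneg_pos)
  have near: "dist (x + a *\<^sub>R v + b *\<^sub>R w) x < d" if "0 \<le> a" "a \<le> h" "0 \<le> b" "b \<le> h" for a b
  proof -
    have "dist (x + a *\<^sub>R v + b *\<^sub>R w) x = norm (a *\<^sub>R v + b *\<^sub>R w)"
      by (simp add: dist_norm)
    also have "\<dots> \<le> a * norm v + b * norm w"
      using that norm_triangle_ineq[of "a *\<^sub>R v" "b *\<^sub>R w"] by simp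
    also have "\<dots> \<le> h * norm v + h * norm w"
      using that by (intro add_mono mult_right_mono) auto
    also have "\<dots> \<le> h * (norm v + norm w + 1)" using h by (simp add: algebra_simps)
    also have "\<dots> = d / 2"
    proof -
      have "norm v + norm w + 1 > 0" by (simp add: add_nonneg_pos)
      then show ?thesis unfolding h_def by (simp add: field_simps)
    qed
    finally show ?thesis using d by simp
  qed
  have S: "x + a *\<^sub>R v + b *\<^sub>R w \<in> S" if "0 \<le> a" "a \<le> h" "0 \<le> b" "b \<le> h" for a b
    using near[OF that] d3 by (auto simp: d_def dist_commute)
  have S': "x + a *\<^sub>R w + b *\<^sub>R v \<in> S" if "0 \<le> a" "a \<le> h" "0 \<le> b" "b \<le> h" for a b
    using S[of b a] that by (simp add: add.commute add.left_commute)
  obtain a b where ab: "0 < a" "a < h" "0 < b" "b < h" and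
    A: "f (x + h *\<^sub>R v + h *\<^sub>R w) - f (x + h *\<^sub>R v) - f (x + h *\<^sub>R w) + f x
       = h * h * ?A (x + a *\<^sub>R v + b *\<^sub>R w)"
    by (rule second_difference_mean_value[OF assms(2) h, of x v w]) (use S in blast)+
  obtain a' b' where ab': "0 < a'" "a' < h" "0 < b'" "b' < h" and
    B: "f (x + h *\<^sub>R w + h *\<^sub>R v) - f (x + h *\<^sub>R w) - f (x + h *\<^sub>R v) + f x
       = h * h * ?B (x + a' *\<^sub>R w + b' *\<^sub>R v)"
    by (rule second_difference_mean_value[OF assms(2) h, of x w v]) (use S' in blast)+
  let ?y = "x + a *\<^sub>R v + b *\<^sub>R w" and ?z = "x + a' *\<^sub>R w + b' *\<^sub>R v"
  have "h * h * ?A ?y = h * h * ?B ?z"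
    using A B by (simp add: algebra_simps)
  then have AB: "?A ?y = ?B ?z" using h by simp
  have "dist (?A ?y) (?A x) < e"
    using ab near[of a b] S[of a b] by (intro d1(2)) (auto simp: d_def)
  moreover have "dist (?B ?z) (?B x) < e"
  proof (rule d2(2))
    show "?z \<in> S" using S'[of a' b'] ab' by simp
    show "dist ?z x < d2" using near[of b' a'] ab' by (simp add: d_def add.commute add.left_commute)
  qed
  ultimately show False using AB dist_triangle2[of "?A x" "?B x" "?A ?y"]
    unfolding e_def by (simp add: dist_commute)
qed

lemma Dv_linear_compose:
  assumes "bounded_linear l" "f differentiable (at x)"
  shows "Dv (\<lambda>y. l (f y)) x v = l (Dv f x v)"
proof -
  have "((\<lambda>y. l (f y)) has_derivative (\<lambda>v. l (Dv f x v))) (at x)"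
    using bounded_linear.has_derivative[OF assms(1)] assms(2) frechet_derivative_works by blast
  then show ?thesis using frechet_derivative_at by metis
qed

text \<open>Reduced to coordinates, because the mean value theorem concerns real functions.\<close>

lemma symmetric_second_derivative:
  fixes f :: "'a::real_normed_vector \<Rightarrow> 'b::euclidean_space"
  assumes "open S" "smooth_on S f" "x \<in> S"
  shows "Dv (\<lambda>y. Dv f y v) x w = Dv (\<lambda>y. Dv f y w) x v"
proof (rule euclidean_eqI)
  fix b :: 'b
  have *: "Dv (\<lambda>y. Dv (\<lambda>y. f y \<bullet> b) y v) x w = Dv (\<lambda>y. Dv f y v) x w \<bullet> b" for v w
  proof -
    have d: "(\<lambda>y. Dv f y v) differentiable (at x)"
      using assms smooth_on_Dv smooth_on_differentiable by blast
    have "Dv (\<lambda>y. Dv (\<lambda>y. f y \<bullet> b) y v) x = Dv (\<lambda>y. Dv f y v \<bullet> b) x"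
    proof (rule Dv_cong(1)[OF assms(1,3)])
      show "Dv f y v \<bullet> b = Dv (\<lambda>y. f y \<bullet> b) y v" if "y \<in> S" for y
        using Dv_linear_compose[OF bounded_linear_inner_left smooth_on_differentiable[OF assms(2) that]] by simp
      show "(\<lambda>y. Dv f y v \<bullet> b) differentiable (at x)"
        using d by (intro differentiable_inner) auto
    qed
    then show ?thesis
      using Dv_linear_compose[OF bounded_linear_inner_left d] by simp
  qed
  have "smooth_on S (\<lambda>y. f y \<bullet> b)"
    by (rule smooth_on_linear_compose[OF assms(1) bounded_linear_inner_left assms(2)])
  then have "times_differentiable_on S (\<lambda>y. f y \<bullet> b) 2"
    by (simp add: smooth_on_def)
  from symmetric_second_derivative_real[OF assms(1) this assms(3)]
  show "Dv (\<lambda>y. Dv f y v) x w \<bullet> b = Dv (\<lambda>y. Dv f y w) x v \<bullet> b"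
    by (simp add: *)
qed

subsection \<open>Local inverses in the plane\<close>

text \<open>Cramer's rule: the inverse is a rational expression in the matrix entries, so the
  inverse of a derivative depends smoothly on the base point.\<close>

lemma cramer_plane:
  fixes L :: "real \<times> real \<Rightarrow> real \<times> real"
  assumes "linear L" "inj L"
  defines "a \<equiv> fst (L (1, 0))" and "c \<equiv> snd (L (1, 0))" and "b \<equiv> fst (L (0, 1))" and "d \<equiv> snd (L (0, 1))"
  shows "a * d - b * c \<noteq> 0"
    "inv L v = inverse (a * d - b * c) *\<^sub>R (d * fst v - b * snd v, a * snd v - c * fst v)"
proof -
  have L: "L (p, q) = (a * p + b * q, c * p + d * q)" for p q
  proof -
    have "L (p, q) = L (p *\<^sub>R (1, 0) + q *\<^sub>R (0, 1))" by simp
    also have "\<dots> = p *\<^sub>R L (1, 0) + q *\<^sub>R L (0, 1)"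
      using assms(1) by (simp only: linear_add linear_scale)
    finally show ?thesis by (simp add: a_def b_def c_def d_def prod_eq_iff mult.commute)
  qed
  have zero: "(p, q) = 0" if "L (p, q) = 0" for p q
    using that assms(1,2) linear_injective_0 by blast
  show nz: "a * d - b * c \<noteq> 0"
  proof
    assume 0: "a * d - b * c = 0"
    \<comment> \<open>In general \<open>(d, - c)\<close> and \<open>(b, - a)\<close> go to (det, 0)
      and (0, - det). If det = 0, injectivity therefore kills all four entries.\<close>
    have "L (d, - c) = 0" "L (b, - a) = 0" using 0 by (auto simp: L zero_prod_def algebra_simps)
    then have "a = 0" "c = 0" using zero[of d "- c"] zero[of b "- a"] by (auto simp: zero_prod_def)
    then have "L (1, 0) = 0" by (simp add: L zero_prod_def)
    then show False using zero[of 1 0] by (simp add: zero_prod_def)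
  qed
  let ?r = "inverse (a * d - b * c)"
  have "L (?r *\<^sub>R (d * fst v - b * snd v, a * snd v - c * fst v))
      = ?r *\<^sub>R ((a * d - b * c) * fst v, (a * d - b * c) * snd v)"
    unfolding linear_scale[OF assms(1)] L by (simp add: algebra_simps)
  also have "\<dots> = v" using nz by (simp add: prod_eq_iff del: right_minus_eq flip: mult.assoc)
  finally show "inv L v = ?r *\<^sub>R (d * fst v - b * snd v, a * snd v - c * fst v)"
    using assms(2) inv_f_eq by metis
qed

lemma smooth_on_fst: "open S \<Longrightarrow> smooth_on S f \<Longrightarrow> smooth_on S (\<lambda>x. fst (f x))"
  for f :: "'a::real_normed_vector \<Rightarrow> 'b::euclidean_space \<times> 'c::euclidean_space"
  by (rule smooth_on_linear_compose[OF _ bounded_linear_fst])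

lemma smooth_on_snd: "open S \<Longrightarrow> smooth_on S f \<Longrightarrow> smooth_on S (\<lambda>x. snd (f x))"
  for f :: "'a::real_normed_vector \<Rightarrow> 'b::euclidean_space \<times> 'c::euclidean_space"
  by (rule smooth_on_linear_compose[OF _ bounded_linear_snd])

lemma open_rectangle:
  fixes V :: "(real \<times> real) set"
  assumes "open V" "z \<in> V"
  obtains I J where "open_interval I" "open_interval J" "z \<in> I \<times> J" "I \<times> J \<subseteq> V"
proof -
  obtain A B where AB: "open A" "open B" "z \<in> A \<times> B" "A \<times> B \<subseteq> V"
    using assms open_prod_elim by metis
  obtain e where e: "e > 0" "ball (fst z) e \<subseteq> A" using AB open_contains_ball by (metis mem_Times_iff)
  obtain d where d: "d > 0" "ball (snd z) d \<subseteq> B" using AB open_contains_ball by (metis mem_Times_iff)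
  show thesis
  proof
    show "open_interval (ball (fst z) e)" "open_interval (ball (snd z) d)"
      by (auto simp: open_interval_def is_interval_convex_1)
    show "z \<in> ball (fst z) e \<times> ball (snd z) d" using e d by (simp add: mem_Times_iff)
    show "ball (fst z) e \<times> ball (snd z) d \<subseteq> V" using AB(4) e d by blast
  qed
qed

text \<open>The inverse function theorem gives an inverse \<open>g\<close> that is only known to be
  differentiable. By Cramer's rule its derivative at \<open>y\<close> is a smooth function of
  \<open>g y\<close>, so \<open>g\<close> solves an autonomous equation and is smooth. The domain is
  cut down to a rectangle because the normal forms are parametrized by I \<times> J.\<close>

lemma local_inverse:
  fixes \<Phi> :: "real \<times> real \<Rightarrow> real \<times> real"
  assumes "open D" "smooth_on D \<Phi>" "u0 \<in> D" "inj (Dv \<Phi> u0)"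
  obtains I J \<psi> where "open_interval I" "open_interval J" "\<Phi> u0 \<in> I \<times> J"
    "smooth_on (I \<times> J) \<psi>" "\<psi> ` (I \<times> J) \<subseteq> D" "open (\<psi> ` (I \<times> J))"
    "\<And>z. z \<in> I \<times> J \<Longrightarrow> \<Phi> (\<psi> z) = z" "\<psi> (\<Phi> u0) = u0"
proof -
  let ?f' = "\<lambda>x. Blinfun (Dv \<Phi> x)"
  have der: "(\<Phi> has_derivative Dv \<Phi> x) (at x)" if "x \<in> D" for x
    using smooth_on_has_derivative[OF assms(2) that] .
  have bl: "bounded_linear (Dv \<Phi> x)" if "x \<in> D" for x
    using der[OF that] has_derivative_bounded_linear by blast
  have ap: "blinfun_apply (?f' x) = Dv \<Phi> x" if "x \<in> D" for x
    using bounded_linear_Blinfun_apply[OF bl[OF that]] .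
  have "continuous_on D (\<lambda>x. blinfun_apply (?f' x) i)" for i
  proof -
    have "continuous_on D (\<lambda>x. Dv \<Phi> x i)"
      using smooth_on_continuous[OF smooth_on_Dv[OF assms(2)]] .
    then show ?thesis using ap by (simp cong: continuous_on_cong)
  qed
  then have cont: "continuous_on D ?f'"
    by (intro continuous_on_blinfun_componentwise)
  obtain P where P: "linear P" "P \<circ> Dv \<Phi> u0 = id"
    using linear_injective_left_inverse[OF _ assms(4)] bl[OF assms(3)] bounded_linear.linear by blast
  have "Blinfun P o\<^sub>L ?f' u0 = id_blinfun"
  proof (rule blinfun_eqI)
    fix i
    have "blinfun_apply (Blinfun P) = P"
      using P(1) linear_conv_bounded_linear bounded_linear_Blinfun_apply by blast
    then show "blinfun_apply (Blinfun P o\<^sub>L ?f' u0) i = blinfun_apply id_blinfun i"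
      using fun_cong[OF P(2), of i] by (simp add: ap[OF assms(3)])
  qed
  from inverse_function_theorem[OF assms(1) _ cont assms(3) this] der ap
  obtain U V g g' where U: "open U" "U \<subseteq> D" "u0 \<in> U" and V: "open V" "\<Phi> u0 \<in> V"
    and h: "homeomorphism U V \<Phi> g"
    and g: "\<And>y. y \<in> V \<Longrightarrow> (g has_derivative g' y) (at y)"
    and g': "\<And>y. y \<in> V \<Longrightarrow> g' y = inv (blinfun_apply (?f' (g y)))"
    and bij: "\<And>y. y \<in> V \<Longrightarrow> bij (blinfun_apply (?f' (g y)))"
    by metis
  have gU: "g ` V = U" "\<Phi> ` U = V" and gf: "\<And>u. u \<in> U \<Longrightarrow> g (\<Phi> u) = u" "\<And>y. y \<in> V \<Longrightarrow> \<Phi> (g y) = y"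
    using h by (auto simp: homeomorphism_def)
  let ?a = "\<lambda>u. fst (Dv \<Phi> u (1, 0))" and ?c = "\<lambda>u. snd (Dv \<Phi> u (1, 0))"
  let ?b = "\<lambda>u. fst (Dv \<Phi> u (0, 1))" and ?d = "\<lambda>u. snd (Dv \<Phi> u (0, 1))"
  let ?G = "\<lambda>v u. inverse (?a u * ?d u - ?b u * ?c u) *\<^sub>R
      (?d u * fst v - ?b u * snd v, ?a u * snd v - ?c u * fst v)"
  have inj: "inj (Dv \<Phi> u)" if "u \<in> U" for u
  proof -
    have "\<Phi> u \<in> V" using that gU by blast
    then have "inj (blinfun_apply (?f' u))" using bij[of "\<Phi> u"] gf(1)[OF that] by (simp add: bij_def)
    then show ?thesis using ap[of u] that U(2) by auto
  qed
  have lin: "linear (Dv \<Phi> u)" if "u \<in> U" for u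
    using bl U(2) that bounded_linear.linear by blast
  have "smooth_on V g"
  proof (rule smooth_on_autonomous[OF V(1) U(1), where G = ?G])
    show "g ` V \<subseteq> U" using gU by simp
    show "(g has_derivative (\<lambda>v. ?G v (g y))) (at y)" if "y \<in> V" for y
    proof -
      have gy: "g y \<in> U" using that gU by blast
      have "g' y = (\<lambda>v. ?G v (g y))"
      proof
        fix v
        have "g' y v = inv (Dv \<Phi> (g y)) v"
          using g'[OF that] ap[of "g y"] gy U(2) by (metis subsetD)
        also have "\<dots> = ?G v (g y)"
          by (rule cramer_plane(2)[OF lin[OF gy] inj[OF gy]])
        finally show "g' y v = ?G v (g y)" .
      qed
      then show ?thesis using g[OF that] by simp
    qed
    have s: "smooth_on U (\<lambda>u. Dv \<Phi> u v)" for v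
      using smooth_on_Dv[OF smooth_on_subset[OF assms(2) U(2)]] .
    show "smooth_on U (?G v)" for v
      by (intro smooth_on_scaleR smooth_on_inverse smooth_on_Pair smooth_on_diff smooth_on_mult
          smooth_on_fst smooth_on_snd smooth_on_const s U(1) cramer_plane(1)[OF lin inj])
  qed
  moreover obtain I J where IJ: "open_interval I" "open_interval J" "\<Phi> u0 \<in> I \<times> J" "I \<times> J \<subseteq> V"
    using open_rectangle[OF V] by metis
  ultimately have "smooth_on (I \<times> J) g" by (blast intro: smooth_on_subset)
  moreover have "open (g ` (I \<times> J))"
  proof -
    have "open (I \<times> J)" using IJ by (simp add: open_interval_def open_Times)
    then have "open (\<Phi> -` (I \<times> J) \<inter> U)"
      using continuous_open_vimage homeomorphism_cont1[OF h] U(1) continuous_on_open_vimage by blast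
    \<comment> \<open>Openness of the image under the inverse comes from continuity of
      \<open>\<Phi>\<close>, as this image is a preimage under \<open>\<Phi>\<close>.\<close>
    moreover have "g ` (I \<times> J) = \<Phi> -` (I \<times> J) \<inter> U"
    proof
      show "g ` (I \<times> J) \<subseteq> \<Phi> -` (I \<times> J) \<inter> U"
        using gf(2) gU IJ(4) by (auto 0 3 simp: subset_iff)
      show "\<Phi> -` (I \<times> J) \<inter> U \<subseteq> g ` (I \<times> J)"
        using gf(1) by (metis IntE imageI subsetI vimageE)
    qed
    ultimately show ?thesis by simp
  qed
  moreover have "g ` (I \<times> J) \<subseteq> D" using IJ(4) gU U(2) by blast
  ultimately show thesis
    using that[of I J g] IJ gf U(3) by blast
qed

subsection \<open>The Minkowski product and its isometries\<close>

lemma bounded_bilinear_mink: "bounded_bilinear mink"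
proof -
  have "bilinear mink"
    by (auto simp: bilinear_def mink_def algebra_simps intro!: linearI)
  then show ?thesis using bilinear_conv_bounded_bilinear by blast
qed

lemmas mink_simps =
  bounded_bilinear.add_left[OF bounded_bilinear_mink] bounded_bilinear.add_right[OF bounded_bilinear_mink]
  bounded_bilinear.diff_left[OF bounded_bilinear_mink] bounded_bilinear.diff_right[OF bounded_bilinear_mink]
  bounded_bilinear.minus_left[OF bounded_bilinear_mink] bounded_bilinear.minus_right[OF bounded_bilinear_mink]
  bounded_bilinear.scaleR_left[OF bounded_bilinear_mink] bounded_bilinear.scaleR_right[OF bounded_bilinear_mink]
  bounded_bilinear.zero_left[OF bounded_bilinear_mink] bounded_bilinear.zero_right[OF bounded_bilinear_mink]

lemmas smooth_on_mink = smooth_on_bilinear[OF _ bounded_bilinear_mink]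

lemma mink_commute: "mink v w = mink w v"
  by (simp add: mink_def mult.commute)

lemma mink_nondegenerate:
  assumes "\<And>w. mink v w = 0"
  shows "v = 0"
  using assms[of "vector [1, 0, 0]"] assms[of "vector [0, 1, 0]"] assms[of "vector [0, 0, 1]"]
  by (simp add: mink_def vec_eq_iff forall_3)

text \<open>Nondegeneracy gives injectivity, and equality of dimensions gives surjectivity.\<close>

lemma mink_preserving_bij:
  assumes "linear L" "\<And>v w. mink (L v) (L w) = mink v w"
  shows "bij L"
proof -
  have "inj L"
  proof (subst linear_injective_0[OF assms(1)], intro allI impI)
    fix v assume "L v = 0"
    then have "mink v w = 0" for w using assms(2)[of v w] by (simp add: mink_simps)
    then show "v = 0" by (rule mink_nondegenerate)
  qed
  then show ?thesis using linear_injective_imp_surjective[OF assms(1)] by (simp add: bij_def)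
qed

lemma has_derivative_mink:
  assumes "(f has_derivative f') (at x)" "(g has_derivative g') (at x)"
  shows "((\<lambda>y. mink (f y) (g y)) has_derivative (\<lambda>v. mink (f x) (g' v) + mink (f' v) (g x))) (at x)"
  using bounded_bilinear.FDERIV[OF bounded_bilinear_mink assms] .

text \<open>As for the uniqueness of the Levi-Civita connection, the expression
  \<open>\<langle>D\<^sup>2F(u, v), DF w\<rangle>\<close> is symmetric in \<open>u, v\<close> and skew in \<open>u, w\<close>, so it vanishes.\<close>

lemma mink_isometry_affine:
  assumes "mink_isometry F"
  obtains L where "linear L" "\<And>v w. mink (L v) (L w) = mink v w" "\<And>p. F p = F 0 + L p"
proof -
  have s: "smooth_on UNIV F" and iso: "\<And>p v w. mink (Dv F p v) (Dv F p w) = mink v w"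
    using assms by (auto simp: mink_isometry_def)
  have d1: "(F has_derivative Dv F p) (at p)" for p
    using smooth_on_has_derivative[OF s] by simp
  have d2: "((\<lambda>q. Dv F q v) has_derivative Dv (\<lambda>q. Dv F q v) p) (at p)" for p v
    using smooth_on_has_derivative[OF smooth_on_Dv[OF s]] by simp
  have lin: "linear (Dv F p)" for p using d1 has_derivative_linear by blast
  have zero: "Dv (\<lambda>q. Dv F q v) p w = 0" for p v w
  proof -
    define T where "T u v w = mink (Dv (\<lambda>q. Dv F q u) p v) (Dv F p w)" for u v w
    have sym: "T u v w = T v u w" for u v w
      unfolding T_def using symmetric_second_derivative[OF open_UNIV s] by simp
    have skew: "T u v w = - T w v u" for u v w
    proof -
      have "((\<lambda>q. mink (Dv F q u) (Dv F q w)) has_derivative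
          (\<lambda>v. mink (Dv F p u) (Dv (\<lambda>q. Dv F q w) p v) + mink (Dv (\<lambda>q. Dv F q u) p v) (Dv F p w))) (at p)"
        by (rule has_derivative_mink[OF d2 d2])
      moreover have "((\<lambda>q. mink (Dv F q u) (Dv F q w)) has_derivative (\<lambda>v. 0)) (at p)"
        unfolding iso by (rule has_derivative_const)
      ultimately have "(\<lambda>v. mink (Dv F p u) (Dv (\<lambda>q. Dv F q w) p v) + mink (Dv (\<lambda>q. Dv F q u) p v) (Dv F p w)) = (\<lambda>v. 0)"
        by (rule has_derivative_unique)
      from fun_cong[OF this, of v]
      show ?thesis unfolding T_def by (simp add: mink_commute[of _ "Dv F p u"])
    qed
    \<comment> \<open>Alternating the two rules comes back with the opposite sign: T u v w = T v u w
      = - T w u v = - T u w v = T v w u = T w v u = - T u v w.\<close>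
    have T0: "T u v w = 0" for u v w
      using sym[of u v w] skew[of u v w] sym[of w v u] skew[of v w u] sym[of u w v] skew[of w u v] by linarith
    have surj: "surj (Dv F p)"
      using mink_preserving_bij[OF lin iso] by (simp add: bij_def)
    have "mink (Dv (\<lambda>q. Dv F q v) p w) z = 0" for z
    proof -
      obtain y where "z = Dv F p y" using surj by (rule surjE)
      then show ?thesis using T0[of v w y] by (simp add: T_def)
    qed
    then show ?thesis by (rule mink_nondegenerate)
  qed
  have const: "Dv F p v = Dv F 0 v" for p v
  proof -
    have "((\<lambda>q. Dv F q v) has_derivative (\<lambda>h. 0)) (at q within UNIV)" for q
    proof -
      have "Dv (\<lambda>q. Dv F q v) q = (\<lambda>h. 0)" using zero by (intro ext)
      then show ?thesis using d2[of v q] by simp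
    qed
    then obtain c where "\<And>q. Dv F q v = c"
      using has_derivative_zero_constant[of UNIV "\<lambda>q. Dv F q v"] by auto
    then show ?thesis by simp
  qed
  have "((\<lambda>q. F q - Dv F 0 q) has_derivative (\<lambda>h. 0)) (at p within UNIV)" for p
  proof -
    have "bounded_linear (Dv F 0)" using d1 has_derivative_bounded_linear by blast
    from has_derivative_diff[OF d1[of p] bounded_linear_imp_has_derivative[OF this]]
    show ?thesis by (simp add: const[of p])
  qed
  then obtain c where c: "\<And>q. F q - Dv F 0 q = c"
    using has_derivative_zero_constant[of UNIV "\<lambda>q. F q - Dv F 0 q"] by auto
  have "F p = F 0 + Dv F 0 p" for p
    using c[of 0] c[of p] linear_0[OF lin[of 0]] by (simp add: algebra_simps)
  then show thesis using that[of "Dv F 0"] lin iso by blast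
qed

text \<open>The map is \<sigma> times the reflection along w = k - \<sigma> e. This reflection sends
  k to \<sigma> e because k and e have the same square. It requires <w, w> \<noteq> 0, and in an
  indefinite metric k - e can be null although k \<noteq> e; the sign \<sigma> avoids this.\<close>

lemma spacelike_to_axis:
  assumes "spacelike k"
  obtains F where "mink_isometry F" "linear F" "\<And>v w. mink (F v) (F w) = mink v w"
    "F k = sqrt (mink k k) *\<^sub>R vector [1, 0, 0]"
proof -
  define e :: "real^3" where "e = sqrt (mink k k) *\<^sub>R vector [1, 0, 0]"
  have k: "mink k k > 0" using assms by (simp add: spacelike_def)
  have ee: "mink e e = mink k k"
    unfolding e_def mink_simps using k by (simp add: mink_def[of "vector _"] power2_eq_square[symmetric])
  \<comment> \<open>Chosen so that \<sigma> <k, e> \<le> 0, hence <w, w> = 2 (<k, k> - \<sigma> <k,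
    e>) > 0.\<close>
  define \<sigma> :: real where "\<sigma> = (if mink k e \<ge> 0 then -1 else 1)"
  define w where "w = k - \<sigma> *\<^sub>R e"
  define r where "r = inverse (mink w w)"
  define F where "F v = \<sigma> *\<^sub>R (v - (2 * r * mink v w) *\<^sub>R w)" for v
  have \<sigma>: "\<sigma> * \<sigma> = 1" by (simp add: \<sigma>_def)
  have kw: "mink w w = 2 * mink k w"
  proof -
    have "mink w w = mink k k - 2 * \<sigma> * mink k e + (\<sigma> * \<sigma>) * mink e e"
      unfolding w_def mink_simps mink_commute[of e k] by (simp add: algebra_simps)
    moreover have "mink k w = mink k k - \<sigma> * mink k e"
      unfolding w_def mink_simps by simp
    ultimately show ?thesis using \<sigma> ee by simp
  qed
  have "\<sigma> * mink k e \<le> 0" by (simp add: \<sigma>_def)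
  then have "mink k w > 0" unfolding w_def mink_simps using k by simp
  then have r: "r * mink w w = 1" "r * mink k w = 1 / 2" using kw by (simp_all add: r_def)
  have lin: "linear F"
    unfolding F_def mink_simps by (rule linearI) (simp_all only: mink_simps, simp_all add: algebra_simps)
  have pres: "mink (F u) (F v) = mink u v" for u v
  proof -
    have "mink (F u) (F v) = (\<sigma> * \<sigma>) * (mink u v - 2 * r * mink u w * mink v w * (2 - 2 * (r * mink w w)))"
      unfolding F_def mink_simps mink_commute[of w v] by (simp add: algebra_simps)
    then show ?thesis using r \<sigma> by simp
  qed
  have FF: "F (F v) = v" for v
  proof -
    have "mink (F v) w = \<sigma> * mink v w * (1 - 2 * (r * mink w w))"
      unfolding F_def mink_simps by (simp add: algebra_simps)
    then have "F (F v) = \<sigma> *\<^sub>R (F v + (\<sigma> * (2 * r * mink v w)) *\<^sub>R w)"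
      unfolding F_def[of "F v"] r by (simp add: algebra_simps)
    also have "\<dots> = (\<sigma> * \<sigma>) *\<^sub>R v" unfolding F_def by (simp add: algebra_simps)
    finally show ?thesis using \<sigma> by simp
  qed
  have bij: "bij F" using FF by (rule involuntory_imp_bij)
  have inv: "inv F = F" using FF by (intro inv_equality) auto
  have bl: "bounded_linear F" using lin linear_conv_bounded_linear by blast
  have D: "Dv F p = F" for p
    using frechet_derivative_at[OF bounded_linear_imp_has_derivative[OF bl, of "at p"]] by simp
  have Fk: "F k = e"
  proof -
    have "2 * r * mink k w = 1" using r(2) by simp
    then have "F k = (\<sigma> * \<sigma>) *\<^sub>R e" by (simp add: F_def w_def)
    then show ?thesis using \<sigma> by simp
  qed
  have "mink_isometry F"
    unfolding mink_isometry_def inv D using bij smooth_on_bounded_linear[OF open_UNIV bl] pres by simp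
  then show thesis using that lin pres Fk unfolding e_def by blast
qed

subsection \<open>Charts\<close>

lemma surface_chartD:
  assumes "surface_chart M x D \<phi>"
  shows "open D" "smooth_on D (x \<circ> \<phi>)" "\<And>u. u \<in> D \<Longrightarrow> inj (Dv (x \<circ> \<phi>) u)"
    "\<And>u. u \<in> D \<Longrightarrow> \<phi> u \<in> topspace M"
    "inj_on \<phi> D" "continuous_map (top_of_set D) M \<phi>"
    "\<And>u. u \<in> D \<Longrightarrow> linear (Dv (x \<circ> \<phi>) u)"
proof -
  show "open D" and s: "smooth_on D (x \<circ> \<phi>)" and "\<And>u. u \<in> D \<Longrightarrow> inj (Dv (x \<circ> \<phi>) u)"
    using assms by (auto simp: surface_chart_def)
  show "\<phi> u \<in> topspace M" if "u \<in> D" for u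
    using assms that openin_subset by (fastforce simp: surface_chart_def)
  have e: "homeomorphic_map (top_of_set D) (subtopology M (\<phi> ` D)) \<phi>"
    using assms by (simp add: surface_chart_def embedding_map_def)
  show "inj_on \<phi> D"
    using e by (simp add: homeomorphic_eq_everything_map)
  show "continuous_map (top_of_set D) M \<phi>"
    using e by (simp add: homeomorphic_eq_everything_map continuous_map_in_subtopology)
  show "linear (Dv (x \<circ> \<phi>) u)" if "u \<in> D" for u
    using smooth_on_has_derivative[OF s that] has_derivative_linear by blast
qed

lemma surface_chart_open_image:
  assumes "surface_chart M x D \<phi>" "open U" "U \<subseteq> D"
  shows "openin M (\<phi> ` U)"
proof -
  have "open_map (top_of_set D) (subtopology M (\<phi> ` D)) \<phi>"
    using assms(1) by (simp add: surface_chart_def embedding_map_def homeomorphic_eq_everything_map)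
  moreover have "openin (top_of_set D) U" using assms(2,3) by (simp add: open_subset)
  ultimately have "openin (subtopology M (\<phi> ` D)) (\<phi> ` U)" by (simp add: open_map_def)
  then show ?thesis
    using assms(1) openin_open_subtopology by (auto simp: surface_chart_def)
qed

lemma surface_chart_open_preimage:
  assumes "surface_chart M x D \<phi>" "openin M W"
  shows "open {u \<in> D. \<phi> u \<in> W}"
proof -
  have "openin (top_of_set D) {u \<in> topspace (top_of_set D). \<phi> u \<in> W}"
    using surface_chartD(6)[OF assms(1)] assms(2) openin_continuous_map_preimage by blast
  then show ?thesis
    using openin_open_trans surface_chartD(1)[OF assms(1)] by fastforce
qed

lemma Dv_compose:
  assumes "f differentiable (at x)" "g differentiable (at (f x))"
  shows "Dv (g \<circ> f) x v = Dv g (f x) (Dv f x v)" "(g \<circ> f) differentiable (at x)"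
proof -
  have "(g \<circ> f has_derivative Dv g (f x) \<circ> Dv f x) (at x)"
    using assms by (intro diff_chain_at) (auto simp: frechet_derivative_works)
  then show "Dv (g \<circ> f) x v = Dv g (f x) (Dv f x v)" "(g \<circ> f) differentiable (at x)"
    using frechet_derivative_at[of "g \<circ> f"] unfolding differentiable_def by (force, blast)
qed

lemma Dv_left_inverse:
  assumes "open E" "z \<in> E" "\<And>y. y \<in> E \<Longrightarrow> \<Phi> (\<psi> y) = y"
    "\<psi> differentiable (at z)" "\<Phi> differentiable (at (\<psi> z))"
  shows "Dv \<Phi> (\<psi> z) (Dv \<psi> z v) = v"
proof -
  have "Dv (\<lambda>y. y) z = Dv (\<Phi> \<circ> \<psi>) z"
    by (rule Dv_cong(1)[OF assms(1,2)]) (use assms(3) Dv_compose(2)[OF assms(4,5)] in auto)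
  then have "Dv (\<Phi> \<circ> \<psi>) z v = v" using frechet_derivative_at[OF has_derivative_ident[of "at z"]] by (simp add: fun_eq_iff)
  then show ?thesis using Dv_compose(1)[OF assms(4,5)] by simp
qed

text \<open>A change of coordinates. The smooth left inverse \<open>\<Phi>\<close> makes
  \<open>\<psi>\<close> a homeomorphism onto its image and its derivative injective.
  \<open>\<Phi>\<close> lives on a subset \<open>D'\<close> of the chart domain because the
  coordinates found later exist only near a point.\<close>

lemma surface_chart_compose:
  fixes \<psi> \<Phi> :: "real \<times> real \<Rightarrow> real \<times> real"
  assumes \<phi>: "surface_chart M x D \<phi>" and E: "open E" and \<psi>: "smooth_on E \<psi>" "\<psi> ` E \<subseteq> D'" "open (\<psi> ` E)"
    and D': "D' \<subseteq> D" and \<Phi>: "smooth_on D' \<Phi>" "\<And>z. z \<in> E \<Longrightarrow> \<Phi> (\<psi> z) = z"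
  shows "surface_chart M x E (\<phi> \<circ> \<psi>)"
proof -
  note c = surface_chartD[OF \<phi>]
  have D: "\<psi> z \<in> D" if "z \<in> E" for z using that \<psi>(2) D' by blast
  have s: "smooth_on E (x \<circ> (\<phi> \<circ> \<psi>))"
    using smooth_on_compose[OF E c(1) _ c(2) \<psi>(1)] \<psi>(2) D' by (auto simp: comp_def)
  have "homeomorphism E (\<psi> ` E) \<psi> \<Phi>"
    unfolding homeomorphism_def
    using \<Phi>(2) smooth_on_continuous[OF \<psi>(1)] continuous_on_subset[OF smooth_on_continuous[OF \<Phi>(1)] \<psi>(2)]
    by (auto simp: image_image)
  then have "homeomorphic_maps (top_of_set E) (top_of_set (\<psi> ` E)) \<psi> \<Phi>"
    unfolding homeomorphism_def homeomorphic_maps_def by auto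
  then have "homeomorphic_map (top_of_set E) (top_of_set (\<psi> ` E)) \<psi>"
    using homeomorphic_map_maps by blast
  moreover have "subtopology (top_of_set D) (\<psi> ` E) = top_of_set (\<psi> ` E)"
    using D by (simp add: subtopology_subtopology inf.absorb2 image_subset_iff)
  ultimately have "embedding_map (top_of_set E) (top_of_set D) \<psi>"
    by (simp add: embedding_map_def)
  then have em: "embedding_map (top_of_set E) M (\<phi> \<circ> \<psi>)"
    using \<phi> embedding_map_compose by (auto simp: surface_chart_def)
  have op: "openin M ((\<phi> \<circ> \<psi>) ` E)"
    using surface_chart_open_image[OF \<phi> \<psi>(3)] D by (simp add: image_image image_subset_iff)
  have "inj (Dv (x \<circ> (\<phi> \<circ> \<psi>)) z)" if z: "z \<in> E" for z
  proof -
    have d1: "\<psi> differentiable (at z)" using smooth_on_differentiable[OF \<psi>(1) z] .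
    have d2: "(x \<circ> \<phi>) differentiable (at (\<psi> z))" using smooth_on_differentiable[OF c(2) D[OF z]] .
    have d3: "\<Phi> differentiable (at (\<psi> z))" using smooth_on_differentiable[OF \<Phi>(1)] \<psi>(2) z by blast
    have "inj (Dv \<psi> z)"
      using Dv_left_inverse[OF E z \<Phi>(2) d1 d3] by (metis injI)
    moreover have "Dv (x \<circ> (\<phi> \<circ> \<psi>)) z = Dv (x \<circ> \<phi>) (\<psi> z) \<circ> Dv \<psi> z"
      by (rule ext, subst comp_assoc[symmetric], subst Dv_compose(1)[OF d1 d2], rule o_apply[symmetric])
    ultimately show ?thesis using c(3)[OF D[OF z]] by (simp add: inj_compose)
  qed
  with E op em s show ?thesis by (simp add: surface_chart_def)
qed

lemma Dv_affine_compose: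
  fixes L :: "'b::euclidean_space \<Rightarrow> 'c::real_normed_vector"
  assumes "linear L" "\<And>p. F p = a + L p" "f differentiable (at u)"
  shows "Dv (F \<circ> f) u v = L (Dv f u v)"
proof -
  have "(f has_derivative Dv f u) (at u)" using assms(3) frechet_derivative_works by blast
  then have "((\<lambda>y. a + L (f y)) has_derivative (\<lambda>v. 0 + L (Dv f u v))) (at u)"
    using assms(1) linear_conv_bounded_linear bounded_linear.has_derivative
    by (intro has_derivative_add has_derivative_const) blast
  then have "(F \<circ> f has_derivative (\<lambda>v. L (Dv f u v))) (at u)"
    using assms(2) by (simp add: comp_def)
  from frechet_derivative_at[OF this] show ?thesis by metis
qed

lemma surface_chart_affine:
  fixes L :: "real^3 \<Rightarrow> real^3"
  assumes "linear L" "inj L" "\<And>p. F p = a + L p" "surface_chart M x D \<phi>"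
  shows "surface_chart M (F \<circ> x) D \<phi>"
proof -
  note c = surface_chartD[OF assms(4)]
  have "smooth_on D (\<lambda>u. a + L ((x \<circ> \<phi>) u))"
    using assms(1) linear_conv_bounded_linear
    by (intro smooth_on_add[OF c(1)] smooth_on_const smooth_on_linear_compose[OF c(1) _ c(2)]) blast
  then have "smooth_on D (F \<circ> x \<circ> \<phi>)" using assms(3) by (simp add: comp_def)
  moreover have "inj (Dv (F \<circ> x \<circ> \<phi>) u)" if "u \<in> D" for u
  proof -
    have "Dv (F \<circ> (x \<circ> \<phi>)) u = L \<circ> Dv (x \<circ> \<phi>) u"
      using Dv_affine_compose[OF assms(1,3) smooth_on_differentiable[OF c(2) that]] by auto
    then show ?thesis using c(3)[OF that] assms(2) by (simp add: comp_assoc inj_compose)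
  qed
  ultimately show ?thesis using assms(4) by (simp add: surface_chart_def)
qed

text \<open>The normal forms speak of charts of \<open>F \<circ> x\<close>. An affine isometry and
  its inverse preserve smooth immersions, so these are exactly the charts of
  \<open>x\<close>.\<close>

lemma surface_chart_affine_iff:
  fixes L :: "real^3 \<Rightarrow> real^3"
  assumes "linear L" "\<And>v w. mink (L v) (L w) = mink v w" "\<And>p. F p = a + L p"
  shows "surface_chart M (F \<circ> x) D \<phi> \<longleftrightarrow> surface_chart M x D \<phi>"
proof
  have bij: "bij L" by (rule mink_preserving_bij[OF assms(1,2)])
  then show "surface_chart M x D \<phi> \<Longrightarrow> surface_chart M (F \<circ> x) D \<phi>"
    using surface_chart_affine[OF assms(1) _ assms(3)] by (simp add: bij_def)
  assume *: "surface_chart M (F \<circ> x) D \<phi>"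
  have lin: "linear (inv L)" using assms(1) bij inj_linear_imp_inv_linear by (auto simp: bij_def)
  let ?G = "\<lambda>q. - inv L a + inv L q"
  have "inj (inv L)" using bij by (simp add: bij_imp_bij_inv bij_is_inj)
  from surface_chart_affine[OF lin this _ *, of ?G "- inv L a"]
  have "surface_chart M (?G \<circ> (F \<circ> x)) D \<phi>" by simp
  moreover have "?G \<circ> (F \<circ> x) = x"
    using bij by (simp add: fun_eq_iff assms(3) linear_add[OF lin] bij_is_inj)
  ultimately show "surface_chart M x D \<phi>" by simp
qed

text \<open>There is no atlas, so differentiability of the transition map must come from
  \<open>x\<close>. A linear left inverse \<open>P\<close> of the derivative at \<open>u\<close>
  turns \<open>P \<circ> x \<circ> \<phi>\<close> into a local diffeomorphism of the plane;
  composing its inverse with \<open>P \<circ> x \<circ> \<eta>\<close> gives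
  \<open>\<tau>\<close>.\<close>

lemma chart_transition:
  fixes x :: "'a \<Rightarrow> real^3"
  assumes \<phi>: "surface_chart M x D \<phi>" and \<eta>: "surface_chart M x E \<eta>"
    and u: "u \<in> D" and w: "w \<in> E" and uw: "\<phi> u = \<eta> w"
  obtains \<tau> V where "open V" "w \<in> V" "\<And>y. y \<in> V \<Longrightarrow> \<eta> y = \<phi> (\<tau> y)" "\<tau> w = u"
    "\<tau> differentiable (at w)"
proof -
  note c = surface_chartD[OF \<phi>] and e = surface_chartD[OF \<eta>]
  obtain P where P: "linear P" "P \<circ> Dv (x \<circ> \<phi>) u = id"
    using linear_injective_left_inverse[OF c(7)[OF u] c(3)[OF u]] by blast
  have bP: "bounded_linear P" using P(1) linear_conv_bounded_linear by blast
  let ?\<Phi> = "\<lambda>y. P ((x \<circ> \<phi>) y)"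
  have s: "smooth_on D ?\<Phi>" by (rule smooth_on_linear_compose[OF c(1) bP c(2)])
  have "Dv ?\<Phi> u = id"
    using Dv_linear_compose[OF bP smooth_on_differentiable[OF c(2) u]] P(2) by (auto simp: fun_eq_iff)
  then have "inj (Dv ?\<Phi> u)" by simp
  from local_inverse[OF c(1) s u this]
  obtain I J \<psi> where IJ: "open_interval I" "open_interval J" "?\<Phi> u \<in> I \<times> J"
    and \<psi>: "smooth_on (I \<times> J) \<psi>" "\<psi> ` (I \<times> J) \<subseteq> D" "open (\<psi> ` (I \<times> J))"
      "\<And>z. z \<in> I \<times> J \<Longrightarrow> ?\<Phi> (\<psi> z) = z" "\<psi> (?\<Phi> u) = u"
    by blast
  define V where "V = {y \<in> E. \<eta> y \<in> \<phi> ` (\<psi> ` (I \<times> J))}"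
  define \<tau> where "\<tau> y = \<psi> (P ((x \<circ> \<eta>) y))" for y
  show thesis
  proof
    show "open V" unfolding V_def
      by (rule surface_chart_open_preimage[OF \<eta> surface_chart_open_image[OF \<phi> \<psi>(3,2)]])
    have "u \<in> \<psi> ` (I \<times> J)" using IJ(3) \<psi>(5) by (intro image_eqI[of _ _ "?\<Phi> u"]) auto
    then have "\<eta> w \<in> \<phi> ` \<psi> ` (I \<times> J)" unfolding uw[symmetric] by (rule imageI)
    then show "w \<in> V" using w by (simp add: V_def)
    show "\<eta> y = \<phi> (\<tau> y)" if "y \<in> V" for y
    proof -
      have "\<eta> y \<in> \<phi> ` \<psi> ` (I \<times> J)" using that by (simp add: V_def)
      then obtain z' where "\<eta> y = \<phi> z'" "z' \<in> \<psi> ` (I \<times> J)" by (rule imageE)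
      moreover from this(2) obtain z where "z' = \<psi> z" "z \<in> I \<times> J" by (rule imageE)
      ultimately have "z \<in> I \<times> J" "\<eta> y = \<phi> (\<psi> z)" by simp_all
      then show ?thesis using \<psi>(4)[of z] by (simp add: \<tau>_def)
    qed
    show "\<tau> w = u" using \<psi>(5) uw by (simp add: \<tau>_def)
    have "P ((x \<circ> \<eta>) w) = ?\<Phi> u" using uw by simp
    then have "\<psi> differentiable (at (P ((x \<circ> \<eta>) w)))"
      using smooth_on_differentiable[OF \<psi>(1)] IJ(3) by metis
    moreover have "(\<lambda>y. P ((x \<circ> \<eta>) y)) differentiable (at w)"
      by (rule smooth_on_differentiable[OF smooth_on_linear_compose[OF e(1) bP e(2)] w])
    ultimately show "\<tau> differentiable (at w)"
      using Dv_compose(2)[of "\<lambda>y. P ((x \<circ> \<eta>) y)" w \<psi>] by (simp add: comp_def \<tau>_def[abs_def])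
  qed
qed

text \<open>The point is that one \<open>T\<close> works for every \<open>f\<close>, so that the
  derivatives of \<open>x\<close> and of \<open>N\<close> are changed by the same map.\<close>

lemma chart_change_derivative:
  fixes x :: "'a \<Rightarrow> real^3"
  assumes "surface_chart M x D \<phi>" "surface_chart M x E \<eta>" "u \<in> D" "w \<in> E" "\<phi> u = \<eta> w"
  obtains T where "\<And>f v. (f \<circ> \<phi>) differentiable (at u) \<Longrightarrow>
    Dv (f \<circ> \<eta>) w v = (Dv (f \<circ> \<phi>) u (T v) :: real^3)"
proof -
  obtain \<tau> V where \<tau>: "open V" "w \<in> V" "\<And>y. y \<in> V \<Longrightarrow> \<eta> y = \<phi> (\<tau> y)" "\<tau> w = u"
    "\<tau> differentiable (at w)"
    using chart_transition[OF assms] by blast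
  have "Dv (f \<circ> \<eta>) w v = Dv (f \<circ> \<phi>) u (Dv \<tau> w v)"
    if "(f \<circ> \<phi>) differentiable (at u)" for f :: "'a \<Rightarrow> real^3" and v
  proof -
    have d: "(f \<circ> \<phi>) differentiable (at (\<tau> w))" using that \<tau>(4) by simp
    have "Dv (f \<circ> \<eta>) w = Dv (f \<circ> \<phi> \<circ> \<tau>) w"
      by (rule Dv_cong(1)[OF \<tau>(1,2) _ Dv_compose(2)[OF \<tau>(5) d]]) (simp add: \<tau>(3))
    then show ?thesis using Dv_compose(1)[OF \<tau>(5) d, of v] unfolding \<tau>(4) by (simp only:)
  qed
  then show thesis using that by blast
qed

lemma tangent_plane_chart:
  assumes "surface_chart M x D \<phi>" "u \<in> D"
  shows "tangent_plane M x (\<phi> u) = range (Dv (x \<circ> \<phi>) u)"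
proof
  show "range (Dv (x \<circ> \<phi>) u) \<subseteq> tangent_plane M x (\<phi> u)"
    using assms unfolding tangent_plane_def by blast
  show "tangent_plane M x (\<phi> u) \<subseteq> range (Dv (x \<circ> \<phi>) u)"
  proof
    fix X assume "X \<in> tangent_plane M x (\<phi> u)"
    then obtain E \<eta> w v where \<eta>: "surface_chart M x E \<eta>" "w \<in> E" "\<eta> w = \<phi> u" "X = Dv (x \<circ> \<eta>) w v"
      by (auto simp: tangent_plane_def)
    obtain T where "\<And>f v. (f \<circ> \<phi>) differentiable (at u) \<Longrightarrow>
        Dv (f \<circ> \<eta>) w v = (Dv (f \<circ> \<phi>) u (T v) :: real^3)"
      using chart_change_derivative[OF assms(1) \<eta>(1) assms(2) \<eta>(2) \<eta>(3)[symmetric]] by blast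
    then show "X \<in> range (Dv (x \<circ> \<phi>) u)"
      using \<eta>(4) smooth_on_differentiable[OF surface_chartD(2)[OF assms(1)] assms(2)] by simp
  qed
qed

text \<open>The description in \<open>shape_operator\<close> is single-valued: if another chart
  represents the same tangent vector, then \<open>T v' = v\<close> by injectivity of the derivative
  of \<open>x \<circ> \<phi>\<close>, and the same \<open>T\<close> transforms the derivative of
  \<open>N\<close>.\<close>

lemma shape_operator_chart:
  assumes N: "smooth_map_on_surface M x N" and \<phi>: "surface_chart M x D \<phi>" "u \<in> D"
  shows "shape_operator M x N (\<phi> u) (Dv (x \<circ> \<phi>) u v) = - Dv (N \<circ> \<phi>) u v"
  unfolding shape_operator_def
proof (rule the_equality)
  show "\<exists>E \<eta> w v'. surface_chart M x E \<eta> \<and> w \<in> E \<and> \<eta> w = \<phi> u \<and>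
      Dv (x \<circ> \<phi>) u v = Dv (x \<circ> \<eta>) w v' \<and> - Dv (N \<circ> \<phi>) u v = - Dv (N \<circ> \<eta>) w v'"
    using \<phi> by blast
  fix Y assume "\<exists>E \<eta> w v'. surface_chart M x E \<eta> \<and> w \<in> E \<and> \<eta> w = \<phi> u \<and>
      Dv (x \<circ> \<phi>) u v = Dv (x \<circ> \<eta>) w v' \<and> Y = - Dv (N \<circ> \<eta>) w v'"
  then obtain E \<eta> w v' where \<eta>: "surface_chart M x E \<eta>" "w \<in> E" "\<eta> w = \<phi> u"
    "Dv (x \<circ> \<phi>) u v = Dv (x \<circ> \<eta>) w v'" "Y = - Dv (N \<circ> \<eta>) w v'"
    by blast
  obtain T where T: "\<And>f v. (f \<circ> \<phi>) differentiable (at u) \<Longrightarrow>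
      Dv (f \<circ> \<eta>) w v = (Dv (f \<circ> \<phi>) u (T v) :: real^3)"
    using chart_change_derivative[OF \<phi>(1) \<eta>(1) \<phi>(2) \<eta>(2) \<eta>(3)[symmetric]] by blast
  have "smooth_on D (N \<circ> \<phi>)" using N \<phi>(1) by (simp add: smooth_map_on_surface_def)
  then have "Dv (N \<circ> \<eta>) w v' = Dv (N \<circ> \<phi>) u (T v')"
    using T smooth_on_differentiable \<phi>(2) by blast
  moreover have "Dv (x \<circ> \<phi>) u v = Dv (x \<circ> \<phi>) u (T v')"
    using T smooth_on_differentiable[OF surface_chartD(2)[OF \<phi>(1)] \<phi>(2)] \<eta>(4) by metis
  then have "T v' = v" using surface_chartD(3)[OF \<phi>] by (simp add: inj_eq)
  ultimately show "Y = - Dv (N \<circ> \<phi>) u v" using \<eta>(5) by simp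
qed

subsection \<open>Orthonormal frames\<close>

definition frame_normal :: "real \<Rightarrow> real \<Rightarrow> real^3" where
  "frame_normal a b = vector [sinh a, cosh a * sinh b, cosh a * cosh b]"

definition frame_first :: "real \<Rightarrow> real \<Rightarrow> real^3" where
  "frame_first a b = vector [cosh a, sinh a * sinh b, sinh a * cosh b]"

definition frame_second :: "real \<Rightarrow> real^3" where
  "frame_second b = vector [0, cosh b, sinh b]"

text \<open>The time-like unit vector orthogonal to \<open>axis1\<close> and
  \<open>frame_second b\<close>; as functions of \<open>b\<close>, it and
  \<open>frame_second\<close> are derivatives of each other. In both normal forms it carries the
  integral of sinh \<theta>.\<close>

definition frame_axial :: "real \<Rightarrow> real^3" where
  "frame_axial b = vector [0, sinh b, cosh b]"

abbreviation axis1 :: "real^3" where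
  "axis1 \<equiv> vector [1, 0, 0]"

lemma cosh_square_real: "cosh a * cosh a = 1 + sinh a * sinh a" for a :: real
  using cosh_square_eq[of a] by (simp add: power2_eq_square)

lemma mink_frame:
  "mink (frame_normal a b) (frame_normal a b) = -1"
  "mink (frame_first a b) (frame_first a b) = 1"
  "mink (frame_second b) (frame_second b) = 1"
  "mink (frame_axial b) (frame_axial b) = -1"
  "mink (frame_normal a b) (frame_first a b) = 0"
  "mink (frame_normal a b) (frame_second b) = 0"
  "mink (frame_normal a b) (frame_axial b) = - cosh a"
  "mink (frame_first a b) (frame_second b) = 0"
  "mink (frame_first a b) (frame_axial b) = - sinh a"
  "mink (frame_axial b) (frame_second b) = 0"
  "mink axis1 (frame_normal a b) = sinh a"
  "mink axis1 (frame_first a b) = cosh a"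
  "mink axis1 (frame_second b) = 0"
  "mink axis1 (frame_axial b) = 0"
proof -
  note d = frame_normal_def frame_first_def frame_second_def frame_axial_def
  have c: "cosh b * (cosh b * y) = y + sinh b * (sinh b * y)" for b y :: real
    using cosh_square_real[of b] by (simp add: mult.assoc[symmetric] distrib_right)
  note simps = mink_def d c cosh_square_real algebra_simps
  show "mink (frame_normal a b) (frame_normal a b) = -1"
    "mink (frame_first a b) (frame_first a b) = 1"
    "mink (frame_second b) (frame_second b) = 1"
    "mink (frame_axial b) (frame_axial b) = -1"
    "mink (frame_normal a b) (frame_first a b) = 0"
    "mink (frame_normal a b) (frame_second b) = 0"
    "mink (frame_normal a b) (frame_axial b) = - cosh a"
    "mink (frame_first a b) (frame_second b) = 0"
    "mink (frame_first a b) (frame_axial b) = - sinh a"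
    "mink (frame_axial b) (frame_second b) = 0"
    "mink axis1 (frame_normal a b) = sinh a"
    "mink axis1 (frame_first a b) = cosh a"
    "mink axis1 (frame_second b) = 0"
    "mink axis1 (frame_axial b) = 0"
    by (simp_all add: simps)
qed

text \<open>Since <axis1, frame_normal a b> = sinh a, the left-hand side is the tangential part of
  \<open>axis1\<close>. It has length cosh a, so it never vanishes.\<close>

lemma axis1_frame: "axis1 + sinh a *\<^sub>R frame_normal a b = cosh a *\<^sub>R frame_first a b"
  by (simp add: vec_eq_iff forall_3 frame_normal_def frame_first_def cosh_square_real algebra_simps)

text \<open>Splits off the fixed axis; for fixed \<open>b\<close>, integrating the two coefficients
  yields the functions \<open>C\<close> and \<open>A\<close> of the normal forms.\<close>

lemma frame_first_axial: "frame_first a b = cosh a *\<^sub>R axis1 + sinh a *\<^sub>R frame_axial b"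
  by (simp add: vec_eq_iff forall_3 frame_first_def frame_axial_def)

text \<open>Orthonormal expansion; the minus sign belongs to the time-like vector.\<close>

lemma frame_expansion:
  "z = mink z (frame_first a b) *\<^sub>R frame_first a b + mink z (frame_second b) *\<^sub>R frame_second b
     - mink z (frame_normal a b) *\<^sub>R frame_normal a b"
proof -
  have c: "cosh b * (cosh b * y) = y + sinh b * (sinh b * y)" for b y :: real
    using cosh_square_real[of b] by (simp add: mult.assoc[symmetric] distrib_right)
  show ?thesis
    by (simp add: vec_eq_iff forall_3 frame_normal_def frame_first_def frame_second_def mink_def
        c cosh_square_real algebra_simps)
qed

lemma axial_expansion:
  "z = z $ 1 *\<^sub>R axis1 - mink z (frame_axial b) *\<^sub>R frame_axial b + mink z (frame_second b) *\<^sub>R frame_second b"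
proof -
  have c: "cosh b * (cosh b * y) = y + sinh b * (sinh b * y)" for b y :: real
    using cosh_square_real[of b] by (simp add: mult.assoc[symmetric] distrib_right)
  show ?thesis
    by (simp add: vec_eq_iff forall_3 frame_axial_def frame_second_def mink_def
        c cosh_square_real algebra_simps)
qed

lemma vector_3_expansion:
  "vector [p, q, r] = p *\<^sub>R axis 1 1 + q *\<^sub>R axis 2 1 + r *\<^sub>R (axis 3 1 :: real^3)"
  by (simp add: vec_eq_iff forall_3 axis_def)

lemma has_derivative_vector_3:
  fixes f g h :: "'a::real_normed_vector \<Rightarrow> real"
  assumes "(f has_derivative f') F" "(g has_derivative g') F" "(h has_derivative h') F"
  shows "((\<lambda>y. vector [f y, g y, h y] :: real^3) has_derivative (\<lambda>v. vector [f' v, g' v, h' v])) F"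
  unfolding vector_3_expansion by (intro has_derivative_add has_derivative_scaleR_left assms)

lemma smooth_on_vector_3:
  fixes f g h :: "'a::real_normed_vector \<Rightarrow> real"
  assumes "open S" "smooth_on S f" "smooth_on S g" "smooth_on S h"
  shows "smooth_on S (\<lambda>y. vector [f y, g y, h y] :: real^3)"
  unfolding vector_3_expansion
  by (intro smooth_on_add smooth_on_scaleR smooth_on_const assms)

lemma has_derivative_sinh_cosh:
  fixes f :: "'a::real_normed_vector \<Rightarrow> real"
  assumes "(f has_derivative f') (at x)"
  shows "((\<lambda>y. sinh (f y)) has_derivative (\<lambda>v. cosh (f x) * f' v)) (at x)"
    and "((\<lambda>y. cosh (f y)) has_derivative (\<lambda>v. sinh (f x) * f' v)) (at x)"
proof -
  have "(sinh has_derivative (*) (cosh (f x))) (at (f x))" "(cosh has_derivative (*) (sinh (f x))) (at (f x))"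
    using has_field_derivative_sinh[OF DERIV_ident, of "f x" UNIV]
      has_field_derivative_cosh[OF DERIV_ident, of "f x" UNIV]
    by (simp_all add: has_field_derivative_def)
  from this[THEN has_derivative_compose[OF assms]]
  show "((\<lambda>y. sinh (f y)) has_derivative (\<lambda>v. cosh (f x) * f' v)) (at x)"
    and "((\<lambda>y. cosh (f y)) has_derivative (\<lambda>v. sinh (f x) * f' v)) (at x)" .
qed

text \<open>The structure equations of the moving frame; the first one computes the shape operator
  once the unit normal is a \<open>frame_normal\<close>.\<close>

lemma has_derivative_frame:
  fixes f g :: "'a::real_normed_vector \<Rightarrow> real"
  assumes "(f has_derivative f') (at x)" "(g has_derivative g') (at x)"
  shows "((\<lambda>y. frame_normal (f y) (g y)) has_derivative
      (\<lambda>v. f' v *\<^sub>R frame_first (f x) (g x) + (cosh (f x) * g' v) *\<^sub>R frame_second (g x))) (at x)"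
    and "((\<lambda>y. frame_first (f y) (g y)) has_derivative
      (\<lambda>v. f' v *\<^sub>R frame_normal (f x) (g x) + (sinh (f x) * g' v) *\<^sub>R frame_second (g x))) (at x)"
    and "((\<lambda>y. frame_second (g y)) has_derivative (\<lambda>v. g' v *\<^sub>R frame_axial (g x))) (at x)"
    and "((\<lambda>y. frame_axial (g y)) has_derivative (\<lambda>v. g' v *\<^sub>R frame_second (g x))) (at x)"
proof -
  note f = has_derivative_sinh_cosh[OF assms(1)] and g = has_derivative_sinh_cosh[OF assms(2)]
  note d = frame_normal_def frame_first_def frame_second_def frame_axial_def
  show "((\<lambda>y. frame_normal (f y) (g y)) has_derivative
      (\<lambda>v. f' v *\<^sub>R frame_first (f x) (g x) + (cosh (f x) * g' v) *\<^sub>R frame_second (g x))) (at x)"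
    unfolding frame_normal_def
    by (rule has_derivative_eq_rhs[OF has_derivative_vector_3[OF f(1) has_derivative_mult[OF f(2) g(1)]
          has_derivative_mult[OF f(2) g(2)]]])
      (auto simp: d vec_eq_iff forall_3 algebra_simps)
  show "((\<lambda>y. frame_first (f y) (g y)) has_derivative
      (\<lambda>v. f' v *\<^sub>R frame_normal (f x) (g x) + (sinh (f x) * g' v) *\<^sub>R frame_second (g x))) (at x)"
    unfolding frame_first_def
    by (rule has_derivative_eq_rhs[OF has_derivative_vector_3[OF f(2) has_derivative_mult[OF f(1) g(1)]
          has_derivative_mult[OF f(1) g(2)]]])
      (auto simp: d vec_eq_iff forall_3 algebra_simps)
  show "((\<lambda>y. frame_second (g y)) has_derivative (\<lambda>v. g' v *\<^sub>R frame_axial (g x))) (at x)"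
    unfolding frame_second_def
    by (rule has_derivative_eq_rhs[OF has_derivative_vector_3[OF has_derivative_const g(2,1)]])
      (auto simp: d vec_eq_iff forall_3 algebra_simps)
  show "((\<lambda>y. frame_axial (g y)) has_derivative (\<lambda>v. g' v *\<^sub>R frame_second (g x))) (at x)"
    unfolding frame_axial_def
    by (rule has_derivative_eq_rhs[OF has_derivative_vector_3[OF has_derivative_const g]])
      (auto simp: d vec_eq_iff forall_3 algebra_simps)
qed

lemma smooth_on_frame_second:
  fixes g :: "'a::real_normed_vector \<Rightarrow> real"
  assumes "open S" "smooth_on S g"
  shows "smooth_on S (\<lambda>y. frame_second (g y))"
  unfolding frame_second_def
  by (intro smooth_on_vector_3 smooth_on_sinh smooth_on_cosh smooth_on_const assms)

lemma smooth_on_frame_first: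
  fixes f g :: "'a::real_normed_vector \<Rightarrow> real"
  assumes "open S" "smooth_on S f" "smooth_on S g"
  shows "smooth_on S (\<lambda>y. frame_first (f y) (g y))"
  unfolding frame_first_def
  by (intro smooth_on_vector_3 smooth_on_mult smooth_on_sinh smooth_on_cosh smooth_on_const assms)

text \<open>The first two components determine both angles through arsinh, which is smooth on the
  whole line. Positivity of the third component selects the root cosh a cosh b.\<close>

lemma unit_timelike_frame:
  assumes "mink z z = -1" "z $ 3 > 0"
  defines "a \<equiv> arsinh (z $ 1)"
  shows "z = frame_normal a (arsinh (z $ 2 / cosh a))"
proof -
  let ?b = "arsinh (z $ 2 / cosh a)"
  have 1: "sinh a = z $ 1" by (simp add: a_def)
  have 2: "cosh a * sinh ?b = z $ 2" by simp
  have "(cosh a * cosh ?b)\<^sup>2 = (cosh a * sinh ?b)\<^sup>2 + (cosh a)\<^sup>2"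
    by (simp only: power_mult_distrib cosh_square_eq[of ?b] distrib_left mult_1_right)
  also have "\<dots> = (z $ 2)\<^sup>2 + ((z $ 1)\<^sup>2 + 1)"
    by (simp only: 2 cosh_square_eq[of a] 1)
  also have "\<dots> = (z $ 3)\<^sup>2"
    using assms(1) by (simp add: mink_def power2_eq_square)
  finally have "cosh a * cosh ?b = z $ 3"
    by (rule power2_eq_imp_eq) (use assms(2) in simp_all)
  then show ?thesis unfolding frame_normal_def 1 2 by (simp add: vec_eq_iff forall_3)
qed

text \<open>Multiplying <z, z> by the square of the third component of \<open>n\<close> and
  inserting both relations gives z_1^2 + z_2^2 + (z_1 n_2 - z_2 n_1)^2, by Lagrange's
  identity.\<close>

lemma timelike_orthogonal_positive:
  assumes "mink n n = -1" "mink z n = 0" "z \<noteq> 0"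
  shows "mink z z > 0"
proof -
  have n3: "n$3 * n$3 = 1 + n$1 * n$1 + n$2 * n$2" using assms(1) by (simp add: mink_def)
  have zn: "z$3 * n$3 = z$1 * n$1 + z$2 * n$2" using assms(2) by (simp add: mink_def)
  have "mink z z * (n$3 * n$3) = (z$1 * z$1 + z$2 * z$2) * (n$3 * n$3) - (z$3 * n$3) * (z$3 * n$3)"
    by (simp add: mink_def algebra_simps)
  then have e: "mink z z * (n$3 * n$3) = (z$1 * z$1 + z$2 * z$2) + (z$1 * n$2 - z$2 * n$1)\<^sup>2"
    unfolding zn n3 by (simp add: algebra_simps power2_eq_square)
  have "z$1 * z$1 + z$2 * z$2 > 0"
  proof (rule ccontr)
    assume "\<not> ?thesis"
    then have 0: "z$1 = 0" "z$2 = 0"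
      by (auto simp: not_less sum_squares_le_zero_iff)
    have "n$3 * n$3 > 0" using n3 zero_le_square[of "n$1"] zero_le_square[of "n$2"] by linarith
    then have "n$3 \<noteq> 0" by auto
    then have "z$3 = 0" using zn 0 by simp
    then show False using 0 assms(3) by (simp add: vec_eq_iff forall_3)
  qed
  then have "mink z z * (n$3 * n$3) > 0" unfolding e by (simp add: add_pos_nonneg)
  then show ?thesis by (simp add: zero_less_mult_iff) 
qed

subsection \<open>Parametrized space-like surfaces\<close>

text \<open>\<open>X\<close> and \<open>n\<close> are arbitrary maps rather than
  \<open>x \<circ> \<phi>\<close> and \<open>N \<circ> \<phi>\<close>, so that the results also
  apply after a linear isometry and a change of sign of the normal. Positivity of the induced metric
  follows from the time-like normal.\<close>

locale spacelike_patch =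
  fixes D :: "(real \<times> real) set" and X n :: "real \<times> real \<Rightarrow> real^3"
  assumes open_D: "open D" and smooth_X: "smooth_on D X" and smooth_n: "smooth_on D n"
    and inj_DX: "u \<in> D \<Longrightarrow> inj (Dv X u)"
    and normal_unit: "u \<in> D \<Longrightarrow> mink (n u) (n u) = -1"
    and normal_orthogonal: "u \<in> D \<Longrightarrow> mink (n u) (Dv X u v) = 0"
begin

lemma DX: "u \<in> D \<Longrightarrow> (X has_derivative Dv X u) (at u)"
  by (rule smooth_on_has_derivative[OF smooth_X])

lemma Dn: "u \<in> D \<Longrightarrow> (n has_derivative Dv n u) (at u)"
  by (rule smooth_on_has_derivative[OF smooth_n])

lemma linear_DX: "u \<in> D \<Longrightarrow> linear (Dv X u)"
  using DX has_derivative_linear by blast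

lemma linear_Dn: "u \<in> D \<Longrightarrow> linear (Dv n u)"
  using Dn has_derivative_linear by blast

lemma DX_eq_0: "u \<in> D \<Longrightarrow> Dv X u v = 0 \<Longrightarrow> v = 0"
  using inj_DX linear_DX linear_injective_0 by blast

lemma Dn_tangent:
  assumes "u \<in> D"
  shows "mink (Dv n u v) (n u) = 0"
proof -
  have "((\<lambda>y. -1) has_derivative (\<lambda>v. mink (n u) (Dv n u v) + mink (Dv n u v) (n u))) (at u)"
    by (rule has_derivative_transform_within_open[OF has_derivative_mink[OF Dn[OF assms] Dn[OF assms]] open_D assms])
      (simp add: normal_unit)
  from fun_cong[OF has_derivative_unique[OF this has_derivative_const], of v]
  show ?thesis by (simp add: mink_commute[of "n u"])
qed

text \<open>Differentiating <n, dX(w)> = 0 in direction \<open>v\<close> expresses the second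
  fundamental form by second derivatives of \<open>X\<close>, which are symmetric.\<close>

lemma second_form_symmetric:
  assumes "u \<in> D"
  shows "mink (Dv n u v) (Dv X u w) = mink (Dv n u w) (Dv X u v)"
proof -
  have *: "mink (Dv n u v) (Dv X u w) = - mink (n u) (Dv (\<lambda>y. Dv X y w) u v)" for v w
  proof -
    have d: "((\<lambda>y. Dv X y w) has_derivative Dv (\<lambda>y. Dv X y w) u) (at u)"
      by (rule smooth_on_has_derivative[OF smooth_on_Dv[OF smooth_X] assms])
    have "((\<lambda>y. 0) has_derivative
        (\<lambda>v. mink (n u) (Dv (\<lambda>y. Dv X y w) u v) + mink (Dv n u v) (Dv X u w))) (at u)"
      by (rule has_derivative_transform_within_open[OF has_derivative_mink[OF Dn[OF assms] d] open_D assms])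
        (simp add: normal_orthogonal)
    from fun_cong[OF has_derivative_unique[OF this has_derivative_const], of v]
    show ?thesis by simp
  qed
  show ?thesis
    unfolding * using symmetric_second_derivative[OF open_D smooth_X assms] by simp
qed

lemma tangent_vectorE:
  assumes "u \<in> D" "mink z (n u) = 0"
  obtains v where "z = Dv X u v"
proof -
  \<comment> \<open>Changing the sign of the third component turns Minkowski orthogonality to
    \<open>n u\<close> into Euclidean orthogonality to \<open>m\<close>. The complement then has
    dimension 2, as does the tangent plane inside it.\<close>
  define m :: "real^3" where "m = vector [n u $ 1, n u $ 2, - n u $ 3]"
  have m: "mink z (n u) = m \<bullet> z" for z
    by (simp add: m_def mink_def inner_vec_def sum_3 mult.commute)
  have "m \<noteq> 0"
    using normal_unit[OF assms(1)] m[of "n u"] by auto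
  then have "dim {z. m \<bullet> z = 0} = 2" using dim_hyperplane[of m] by simp
  moreover have "dim (range (Dv X u)) = 2"
    using dim_image_eq[OF linear_DX[OF assms(1)], of UNIV] inj_DX[OF assms(1)] by simp
  moreover have "range (Dv X u) \<subseteq> {z. m \<bullet> z = 0}"
    using normal_orthogonal[OF assms(1)] by (simp add: image_subset_iff m[symmetric] mink_commute[of _ "n u"])
  ultimately have "range (Dv X u) = {z. m \<bullet> z = 0}"
    by (intro subspace_dim_equal linear_subspace_image linear_DX assms(1) subspace_hyperplane) auto
  then have "z \<in> range (Dv X u)" using assms(2) m[of z] by simp
  then show thesis by (rule rangeE) (rule that)
qed

lemma first_form_positive: "u \<in> D \<Longrightarrow> v \<noteq> 0 \<Longrightarrow> mink (Dv X u v) (Dv X u v) > 0"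
  using timelike_orthogonal_positive[OF normal_unit] normal_orthogonal DX_eq_0 by (metis mink_commute)

lemma tangent_eq_0:
  assumes "u \<in> D" "mink z (n u) = 0" "\<And>w. mink z (Dv X u w) = 0"
  shows "z = 0"
proof -
  obtain v where v: "z = Dv X u v" using tangent_vectorE[OF assms(1,2)] .
  have "v = 0" using first_form_positive[OF assms(1), of v] assms(3)[of v] v by (cases "v = 0") auto
  then show ?thesis using v linear_0[OF linear_DX[OF assms(1)]] by simp
qed

end

lemma linear_plane:
  fixes L :: "real \<times> real \<Rightarrow> 'b::real_vector"
  assumes "linear L"
  shows "L v = fst v *\<^sub>R L (1, 0) + snd v *\<^sub>R L (0, 1)"
proof -
  have "L v = L (fst v *\<^sub>R (1, 0) + snd v *\<^sub>R (0, 1))" by simp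
  then show ?thesis using assms by (simp only: linear_add linear_scale)
qed

lemma unit_normal_field_patch:
  assumes "unit_normal_field M x N" "surface_chart M x D \<phi>"
  shows "spacelike_patch D (x \<circ> \<phi>) (N \<circ> \<phi>)"
proof
  note c = surface_chartD[OF assms(2)]
  show "open D" "smooth_on D (x \<circ> \<phi>)" by (rule c)+
  show "smooth_on D (N \<circ> \<phi>)"
    using assms by (simp add: unit_normal_field_def smooth_map_on_surface_def)
  fix u assume u: "u \<in> D"
  show "inj (Dv (x \<circ> \<phi>) u)" using c(3) u .
  show "mink ((N \<circ> \<phi>) u) ((N \<circ> \<phi>) u) = -1"
    using assms(1) c(4)[OF u] by (simp add: unit_normal_field_def)
  show "mink ((N \<circ> \<phi>) u) (Dv (x \<circ> \<phi>) u v) = 0" for v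
    using assms(1) c(4)[OF u] tangent_plane_chart[OF assms(2) u] by (simp add: unit_normal_field_def)
qed

section \<open>Fundamental forms in coordinates, and flatness\<close>

context spacelike_patch
begin

lemma first_form_expand:
  assumes "u \<in> D"
  shows "mink (Dv X u v) (Dv X u w) =
      fst v * fst w * mink (Dv X u (1, 0)) (Dv X u (1, 0))
    + (fst v * snd w + snd v * fst w) * mink (Dv X u (1, 0)) (Dv X u (0, 1))
    + snd v * snd w * mink (Dv X u (0, 1)) (Dv X u (0, 1))"
  unfolding linear_plane[OF linear_DX[OF assms], of v] linear_plane[OF linear_DX[OF assms], of w]
    mink_simps mink_commute[of "Dv X u (0, 1)" "Dv X u (1, 0)"]
  by (simp add: algebra_simps)

lemma second_form_expand:
  assumes "u \<in> D"
  shows "mink (Dv n u v) (Dv X u w) =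
      fst v * fst w * mink (Dv n u (1, 0)) (Dv X u (1, 0))
    + (fst v * snd w + snd v * fst w) * mink (Dv n u (1, 0)) (Dv X u (0, 1))
    + snd v * snd w * mink (Dv n u (0, 1)) (Dv X u (0, 1))"
  unfolding linear_plane[OF linear_Dn[OF assms], of v] linear_plane[OF linear_DX[OF assms], of w]
    mink_simps second_form_symmetric[OF assms, of "(0, 1)" "(1, 0)"]
  by (simp add: algebra_simps)

text \<open>With a, b, c the entries of the Gram matrix, the coordinate vector (c, - b) represents a
  tangent vector orthogonal to the second coordinate vector; its square is c (a c - b^2).\<close>

lemma gram_positive:
  assumes "u \<in> D"
  shows "mink (Dv X u (1, 0)) (Dv X u (1, 0)) * mink (Dv X u (0, 1)) (Dv X u (0, 1))
    - (mink (Dv X u (1, 0)) (Dv X u (0, 1)))\<^sup>2 > 0"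
proof -
  let ?a = "mink (Dv X u (1, 0)) (Dv X u (1, 0))" and ?b = "mink (Dv X u (1, 0)) (Dv X u (0, 1))"
    and ?c = "mink (Dv X u (0, 1)) (Dv X u (0, 1))"
  have c: "?c > 0" using first_form_positive[OF assms, of "(0, 1)"] by (simp add: zero_prod_def)
  have "mink (Dv X u (?c, - ?b)) (Dv X u (?c, - ?b)) > 0"
    using first_form_positive[OF assms, of "(?c, - ?b)"] c by (simp add: zero_prod_def)
  then have "?c * (?a * ?c - ?b\<^sup>2) > 0"
    unfolding first_form_expand[OF assms, of "(?c, - ?b)"] by (simp add: algebra_simps power2_eq_square)
  then show ?thesis using c by (simp add: zero_less_mult_iff)
qed

text \<open>A derivative of \<open>n\<close> is tangent, so it vanishes exactly if its products with
  both coordinate vectors do. Hence the kernel is that of the symmetric matrix of the second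
  fundamental form.\<close>

lemma inj_Dn_iff:
  assumes "u \<in> D"
  shows "inj (Dv n u) \<longleftrightarrow> mink (Dv n u (1, 0)) (Dv X u (1, 0)) * mink (Dv n u (0, 1)) (Dv X u (0, 1))
    - (mink (Dv n u (1, 0)) (Dv X u (0, 1)))\<^sup>2 \<noteq> 0"
proof -
  let ?P = "mink (Dv n u (1, 0)) (Dv X u (1, 0))" and ?Q = "mink (Dv n u (1, 0)) (Dv X u (0, 1))"
    and ?R = "mink (Dv n u (0, 1)) (Dv X u (0, 1))"
  have ker: "Dv n u v = 0 \<longleftrightarrow> fst v * ?P + snd v * ?Q = 0 \<and> fst v * ?Q + snd v * ?R = 0" for v
  proof
    assume 0: "Dv n u v = 0"
    have "mink (Dv n u v) (Dv X u (1, 0)) = 0" "mink (Dv n u v) (Dv X u (0, 1)) = 0"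
      unfolding 0 mink_simps by simp_all
    then show "fst v * ?P + snd v * ?Q = 0 \<and> fst v * ?Q + snd v * ?R = 0"
      unfolding second_form_expand[OF assms, of v] by simp
  next
    assume 0: "fst v * ?P + snd v * ?Q = 0 \<and> fst v * ?Q + snd v * ?R = 0"
    have "mink (Dv n u v) (Dv X u w) = fst w * (fst v * ?P + snd v * ?Q) + snd w * (fst v * ?Q + snd v * ?R)" for w
      unfolding second_form_expand[OF assms, of v] by (simp add: algebra_simps)
    then show "Dv n u v = 0" using 0 tangent_eq_0[OF assms Dn_tangent[OF assms]] by simp
  qed
  have "inj (Dv n u) \<longleftrightarrow> (\<forall>v. Dv n u v = 0 \<longrightarrow> v = 0)"
    by (rule linear_injective_0[OF linear_Dn[OF assms]])
  also have "\<dots> \<longleftrightarrow> ?P * ?R - ?Q\<^sup>2 \<noteq> 0"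
  proof
    assume inj: "\<forall>v. Dv n u v = 0 \<longrightarrow> v = 0"
    show "?P * ?R - ?Q\<^sup>2 \<noteq> 0"
    proof
      assume 0: "?P * ?R - ?Q\<^sup>2 = 0"
      \<comment> \<open>Each vector annihilates one row of the matrix by construction and the other
        because the determinant is 0. If both were zero, the first row would vanish and (1, 0) would
        lie in the kernel.\<close>
      have "Dv n u (?Q, - ?P) = 0" "Dv n u (?R, - ?Q) = 0"
        unfolding ker using 0 by (simp_all add: power2_eq_square algebra_simps)
      then have "(?Q, - ?P) = 0" "(?R, - ?Q) = 0" using inj by blast+
      then have "Dv n u (1, 0) = 0" unfolding ker by (simp add: zero_prod_def)
      then have "(1::real, 0::real) = 0" using inj by blast
      then show False by (simp add: zero_prod_def)
    qed
  next
    assume d: "?P * ?R - ?Q\<^sup>2 \<noteq> 0"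
    show "\<forall>v. Dv n u v = 0 \<longrightarrow> v = 0"
    proof (intro allI impI)
      fix v assume "Dv n u v = 0"
      then have e: "fst v * ?P + snd v * ?Q = 0" "fst v * ?Q + snd v * ?R = 0" using ker by auto
      have "fst v * (?P * ?R - ?Q\<^sup>2) = ?R * (fst v * ?P + snd v * ?Q) - ?Q * (fst v * ?Q + snd v * ?R)"
        "snd v * (?P * ?R - ?Q\<^sup>2) = ?P * (fst v * ?Q + snd v * ?R) - ?Q * (fst v * ?P + snd v * ?Q)"
        by (simp_all add: algebra_simps power2_eq_square)
      then have "fst v * (?P * ?R - ?Q\<^sup>2) = 0" "snd v * (?P * ?R - ?Q\<^sup>2) = 0" unfolding e by simp_all
      then show "v = 0" using d by (simp add: prod_eq_iff)
    qed
  qed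
  finally show ?thesis .
qed

end

text \<open>For tangent vectors with coordinates \<open>v\<close> and \<open>w\<close>, both Gram
  expressions in the definition carry the factor (v_1 w_2 - v_2 w_1)^2. So the condition singles out
  K = - e / d, and K = 0 becomes degeneracy of the second fundamental form.\<close>

lemma gaussian_curvature_eq_0_iff:
  assumes N: "unit_normal_field M x N" and \<phi>: "surface_chart M x D \<phi>" and u: "u \<in> D"
  shows "gaussian_curvature M x N (\<phi> u) = 0 \<longleftrightarrow> \<not> inj (Dv (N \<circ> \<phi>) u)"
proof -
  interpret spacelike_patch D "x \<circ> \<phi>" "N \<circ> \<phi>"
    by (rule unit_normal_field_patch[OF N \<phi>])
  let ?X = "Dv (x \<circ> \<phi>) u" and ?n = "Dv (N \<circ> \<phi>) u"
  define e where "e = mink (?n (1, 0)) (?X (1, 0)) * mink (?n (0, 1)) (?X (0, 1)) - (mink (?n (1, 0)) (?X (0, 1)))\<^sup>2"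
  define d where "d = mink (?X (1, 0)) (?X (1, 0)) * mink (?X (0, 1)) (?X (0, 1)) - (mink (?X (1, 0)) (?X (0, 1)))\<^sup>2"
  have d: "d > 0" unfolding d_def by (rule gram_positive[OF u])
  have S: "shape_operator M x N (\<phi> u) (?X v) = - ?n v" for v
    using shape_operator_chart[OF _ \<phi> u] N by (simp add: unit_normal_field_def)
  have gram: "mink (?X v) (?X v) * mink (?X w) (?X w) - (mink (?X v) (?X w))\<^sup>2
      = (fst v * snd w - snd v * fst w)\<^sup>2 * d" for v w
    unfolding first_form_expand[OF u, of v v] first_form_expand[OF u, of w w] first_form_expand[OF u, of v w] d_def
    by (simp add: algebra_simps power2_eq_square)
  have ext: "mink (- ?n v) (?X v) * mink (- ?n w) (?X w) - (mink (- ?n v) (?X w))\<^sup>2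
      = (fst v * snd w - snd v * fst w)\<^sup>2 * e" for v w
    unfolding mink_simps second_form_expand[OF u, of v v] second_form_expand[OF u, of w w]
      second_form_expand[OF u, of v w] e_def
    by (simp add: algebra_simps power2_eq_square)
  have "(\<forall>X\<in>tangent_plane M x (\<phi> u). \<forall>Y\<in>tangent_plane M x (\<phi> u).
        mink (shape_operator M x N (\<phi> u) X) X * mink (shape_operator M x N (\<phi> u) Y) Y
          - (mink (shape_operator M x N (\<phi> u) X) Y)\<^sup>2
        = - K * (mink X X * mink Y Y - (mink X Y)\<^sup>2)) \<longleftrightarrow> K = - e / d" (is "?L K \<longleftrightarrow> _") for K
  proof -
    have "?L K \<longleftrightarrow> (\<forall>v w. (fst v * snd w - snd v * fst w)\<^sup>2 * e
        = - K * ((fst v * snd w - snd v * fst w)\<^sup>2 * d))"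
      by (simp only: tangent_plane_chart[OF \<phi> u] ball_simps ball_UNIV S ext gram)
    also have "\<dots> \<longleftrightarrow> e = - K * d"
    proof
      assume "\<forall>v w. (fst v * snd w - snd v * fst w)\<^sup>2 * e = - K * ((fst v * snd w - snd v * fst w)\<^sup>2 * d)"
      \<comment> \<open>For the coordinate basis the common factor is 1.\<close>
      from this[rule_format, of "(1, 0)" "(0, 1)"] show "e = - K * d" by simp
    qed (simp add: algebra_simps)
    also have "\<dots> \<longleftrightarrow> K = - e / d" using d by (auto simp: field_simps)
    finally show ?thesis .
  qed
  then have "gaussian_curvature M x N (\<phi> u) = - e / d"
    unfolding gaussian_curvature_def by simp
  then show ?thesis using inj_Dn_iff[OF u] d unfolding e_def[symmetric] by simp
qed

subsection \<open>Arc length along the principal direction\<close>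

lemma has_derivative_partial:
  fixes f :: "real \<times> real \<Rightarrow> 'b::real_normed_vector"
  assumes "(f has_derivative f') (at (a, b))"
  shows "((\<lambda>s. f (s, b)) has_vector_derivative f' (1, 0)) (at a)"
    and "((\<lambda>t. f (a, t)) has_vector_derivative f' (0, 1)) (at b)"
proof -
  have lin: "linear f'" using assms has_derivative_linear by blast
  have "((\<lambda>s. (s, b)) has_derivative (\<lambda>h. h *\<^sub>R (1, 0))) (at a)"
    and "((\<lambda>t. (a, t)) has_derivative (\<lambda>h. h *\<^sub>R (0, 1))) (at b)"
    by (auto intro!: derivative_eq_intros)
  from this[THEN has_derivative_compose] assms
  show "((\<lambda>s. f (s, b)) has_vector_derivative f' (1, 0)) (at a)"
    and "((\<lambda>t. f (a, t)) has_vector_derivative f' (0, 1)) (at b)"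
    unfolding has_vector_derivative_def linear_scale[OF lin, symmetric] by simp_all
qed

lemma open_interval_constant:
  fixes f :: "real \<Rightarrow> 'b::real_normed_vector"
  assumes "open_interval I" "\<And>t. t \<in> I \<Longrightarrow> (f has_vector_derivative 0) (at t)" "a \<in> I" "b \<in> I"
  shows "f a = f b"
proof (rule has_derivative_zero_unique_connected[of I f a b])
  show "open I" "connected I"
    using assms(1) by (auto simp: open_interval_def is_interval_connected)
  show "(f has_derivative (\<lambda>x. 0)) (at t)" if "t \<in> I" for t
    using assms(2)[OF that] by (simp add: has_vector_derivative_def)
qed (use assms in auto)

lemma local_antiderivative:
  fixes g :: "real \<Rightarrow> real"
  assumes "open I" "a \<in> I" "continuous_on I g"
  obtains J G where "open J" "a \<in> J" "J \<subseteq> I" "\<And>t. t \<in> J \<Longrightarrow> (G has_real_derivative g t) (at t)"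
proof -
  obtain e where e: "e > 0" "cball a e \<subseteq> I" using assms(1,2) open_contains_cball by blast
  have "continuous_on {a - e..a + e} g"
    using continuous_on_subset[OF assms(3) e(2)] by (simp add: cball_eq_atLeastAtMost)
  then obtain G where G: "\<And>t. t \<in> {a - e..a + e} \<Longrightarrow>
      (G has_vector_derivative g t) (at t within {a - e..a + e})"
    by (rule antiderivative_continuous) blast
  show thesis
  proof
    show "open (ball a e)" "a \<in> ball a e" "ball a e \<subseteq> I" using e by auto
    show "(G has_real_derivative g t) (at t)" if "t \<in> ball a e" for t
    proof -
      have t: "t \<in> {a - e<..<a + e}" using that by (auto simp: dist_real_def)
      have "(G has_vector_derivative g t) (at t within {a - e..a + e})"
        by (rule G) (use t in simp)
      then have "(G has_vector_derivative g t) (at t within {a - e<..<a + e})"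
        by (rule has_vector_derivative_within_subset) auto
      then show ?thesis
        using t by (simp only: at_within_open[OF t open_greaterThanLessThan] has_real_derivative_iff_has_vector_derivative)
    qed
  qed
qed

text \<open>If \<open>dh\<close> is a multiple of \<open>d\<theta> \<noteq> 0\<close>, then \<open>h\<close> is locally a function of \<open>\<theta>\<close>, so that
  \<open>r(\<theta>) dh\<close> is exact.\<close>

lemma exact_multiple:
  fixes h \<theta> :: "real \<times> real \<Rightarrow> real" and r :: "real \<Rightarrow> real"
  assumes D: "open D" "u0 \<in> D" and h: "smooth_on D h" and \<theta>: "smooth_on D \<theta>"
    and c: "\<And>u v. u \<in> D \<Longrightarrow> Dv h u v = c u * Dv \<theta> u v" and nz: "Dv \<theta> u0 \<noteq> (\<lambda>v. 0)"
    and r: "continuous_on UNIV r"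
  shows "\<exists>E s. open E \<and> u0 \<in> E \<and> E \<subseteq> D \<and>
    (\<forall>u\<in>E. (s has_derivative (\<lambda>v. r (\<theta> u) * Dv h u v)) (at u))"
proof -
  have d\<theta>: "(\<theta> has_derivative Dv \<theta> u) (at u)" if "u \<in> D" for u
    using smooth_on_has_derivative[OF \<theta> that] .
  have lin: "linear (Dv \<theta> u0)" using d\<theta>[OF D(2)] has_derivative_linear by blast
  have plane: "Dv \<theta> u0 v = fst v * Dv \<theta> u0 (1, 0) + snd v * Dv \<theta> u0 (0, 1)" for v
    using linear_plane[OF lin, of v] by simp
  \<comment> \<open>One of the two coordinate functions has a differential independent of d\<theta>
    at \<open>u0\<close>, so that (\<theta>, q) are local coordinates.\<close>
  have "\<exists>q :: real \<times> real \<Rightarrow> real. bounded_linear q \<and> (\<forall>v. Dv \<theta> u0 v = 0 \<and> q v = 0 \<longrightarrow> v = 0)"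
  proof (cases "Dv \<theta> u0 (1, 0) = 0")
    case True
    have "Dv \<theta> u0 (0, 1) \<noteq> 0"
    proof
      assume 0: "Dv \<theta> u0 (0, 1) = 0"
      have "Dv \<theta> u0 v = 0" for v unfolding plane[of v] 0 True by simp
      then have "Dv \<theta> u0 = (\<lambda>v. 0)" by (rule ext)
      then show False using nz by contradiction
    qed
    then have "v = 0" if "Dv \<theta> u0 v = 0 \<and> fst v = 0" for v
      using that plane[of v] True by (auto simp: prod_eq_iff)
    then show ?thesis using bounded_linear_fst by blast
  next
    case False
    then have "v = 0" if "Dv \<theta> u0 v = 0 \<and> snd v = 0" for v
      using that plane[of v] by (auto simp: prod_eq_iff)
    then show ?thesis using bounded_linear_snd by blast
  qed
  then obtain q :: "real \<times> real \<Rightarrow> real" where q: "bounded_linear q"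
    "\<And>v. Dv \<theta> u0 v = 0 \<Longrightarrow> q v = 0 \<Longrightarrow> v = 0" by blast
  let ?\<Phi> = "\<lambda>u. (\<theta> u, q u)"
  have s\<Phi>: "smooth_on D ?\<Phi>"
    by (intro smooth_on_Pair D(1) \<theta> smooth_on_bounded_linear q(1))
  have D\<Phi>: "Dv ?\<Phi> u0 = (\<lambda>v. (Dv \<theta> u0 v, q v))"
    using frechet_derivative_at[OF has_derivative_Pair[OF d\<theta>[OF D(2)] bounded_linear_imp_has_derivative[OF q(1)]]]
    by simp
  have "v = 0" if "Dv ?\<Phi> u0 v = 0" for v
    by (rule q(2)) (use that in \<open>simp_all add: D\<Phi> zero_prod_def\<close>)
  then have "inj (Dv ?\<Phi> u0)"
    using linear_injective_0[OF has_derivative_linear[OF smooth_on_has_derivative[OF s\<Phi> D(2)]]] by blast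
  from local_inverse[OF D(1) s\<Phi> D(2) this]
  obtain I J \<psi> where IJ: "open_interval I" "open_interval J" "?\<Phi> u0 \<in> I \<times> J"
    and \<psi>: "smooth_on (I \<times> J) \<psi>" "\<psi> ` (I \<times> J) \<subseteq> D" "open (\<psi> ` (I \<times> J))"
      "\<And>z. z \<in> I \<times> J \<Longrightarrow> ?\<Phi> (\<psi> z) = z" "\<psi> (?\<Phi> u0) = u0"
    by blast
  have oIJ: "open I" "open J" "open (I \<times> J)" using IJ by (auto simp: open_interval_def open_Times)
  have hz: "((\<lambda>z. h (\<psi> z)) has_derivative (\<lambda>v. Dv h (\<psi> z) (Dv \<psi> z v))) (at z)" if "z \<in> I \<times> J" for z
    using has_derivative_compose[OF smooth_on_has_derivative[OF \<psi>(1) that] smooth_on_has_derivative[OF h]]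
      \<psi>(2) that by blast
  have \<theta>z: "Dv \<theta> (\<psi> z) (Dv \<psi> z v) = fst v" if "z \<in> I \<times> J" for z v
  proof -
    have "((\<lambda>z. \<theta> (\<psi> z)) has_derivative (\<lambda>v. Dv \<theta> (\<psi> z) (Dv \<psi> z v))) (at z)"
      using has_derivative_compose[OF smooth_on_has_derivative[OF \<psi>(1) that] d\<theta>] \<psi>(2) that by blast
    moreover have "((\<lambda>z. \<theta> (\<psi> z)) has_derivative fst) (at z)"
      by (rule has_derivative_transform_within_open[OF bounded_linear_imp_has_derivative[OF bounded_linear_fst] oIJ(3) that])
        (use \<psi>(4) in \<open>auto simp: prod_eq_iff\<close>)
    ultimately have "(\<lambda>v. Dv \<theta> (\<psi> z) (Dv \<psi> z v)) = fst" by (rule has_derivative_unique)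
    from fun_cong[OF this, of v] show ?thesis .
  qed
  define b0 where "b0 = q u0"
  have b0: "b0 \<in> J" "\<theta> u0 \<in> I" using IJ(3) by (auto simp: b0_def)
  \<comment> \<open>In the coordinates (\<theta>, q) the relation dh = c d\<theta> says that the
    q-derivative of \<open>h\<close> is 0.\<close>
  have hb: "h (\<psi> (a, b)) = h (\<psi> (a, b0))" if "a \<in> I" "b \<in> J" for a b
  proof (rule open_interval_constant[OF IJ(2) _ that(2) b0(1)])
    fix t assume "t \<in> J"
    then have z: "(a, t) \<in> I \<times> J" using that by simp
    have "Dv h (\<psi> (a, t)) (Dv \<psi> (a, t) (0, 1)) = 0"
      using c[of "\<psi> (a, t)"] \<theta>z[OF z] \<psi>(2) z by (auto simp: image_subset_iff)
    then show "((\<lambda>t. h (\<psi> (a, t))) has_vector_derivative 0) (at t)"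
      using has_derivative_partial(2)[OF hz[OF z]] by simp
  qed
  let ?H' = "\<lambda>a. Dv h (\<psi> (a, b0)) (Dv \<psi> (a, b0) (1, 0))"
  have H: "((\<lambda>a. h (\<psi> (a, b0))) has_real_derivative ?H' a) (at a)" if "a \<in> I" for a
    using has_derivative_partial(1)[OF hz] that b0 by (simp add: has_real_derivative_iff_has_vector_derivative)
  have "smooth_on (I \<times> J) (\<lambda>z. h (\<psi> z))"
    by (rule smooth_on_compose[OF oIJ(3) D(1) \<psi>(2) h \<psi>(1)])
  from smooth_on_continuous[OF smooth_on_Dv[OF this, of "(1, 0)"]]
  have "continuous_on (I \<times> J) (\<lambda>z. Dv h (\<psi> z) (Dv \<psi> z (1, 0)))"
    by (rule continuous_on_eq) (simp add: frechet_derivative_at[OF hz, symmetric])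
  then have "continuous_on I ?H'"
    by (rule continuous_on_compose2) (use b0 in \<open>auto intro!: continuous_intros\<close>)
  then have "continuous_on I (\<lambda>a. r a * ?H' a)"
    using continuous_on_subset[OF r] by (intro continuous_on_mult) auto
  from local_antiderivative[OF oIJ(1) b0(2) this]
  obtain K \<sigma> where K: "open K" "\<theta> u0 \<in> K" "K \<subseteq> I"
    and \<sigma>: "\<And>a. a \<in> K \<Longrightarrow> (\<sigma> has_real_derivative r a * ?H' a) (at a)" by blast
  \<comment> \<open>The potential will be \<open>\<sigma>\<close> composed with
    \<open>\<theta>\<close>, so \<open>\<theta>\<close> has to stay in the interval where the
    antiderivative exists.\<close>
  define E where "E = \<theta> -` K \<inter> \<psi> ` (I \<times> J)"
  have \<theta>I: "u = \<psi> (\<theta> u, q u) \<and> \<theta> u \<in> I \<and> q u \<in> J" if "u \<in> \<psi> ` (I \<times> J)" for u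
    using that \<psi>(4) by (auto simp: prod_eq_iff)
  have hb': "h (\<psi> (\<theta> y, b0)) = h y" if "y \<in> \<psi> ` (I \<times> J)" for y
    using \<theta>I[OF that] hb[of "\<theta> y" "q y"] by (simp only:)
  show ?thesis
  proof (intro exI[of _ E] exI[of _ "\<lambda>y. \<sigma> (\<theta> y)"] conjI ballI)
    have "continuous_on (\<psi> ` (I \<times> J)) \<theta>"
      using continuous_on_subset[OF smooth_on_continuous[OF \<theta>] \<psi>(2)] .
    then show "open E" unfolding E_def
      using continuous_on_open_vimage[OF \<psi>(3)] K(1) by blast
    have "u0 \<in> \<psi> ` (I \<times> J)" using IJ(3) \<psi>(5) by (intro image_eqI[of _ _ "?\<Phi> u0"]) auto
    then show "u0 \<in> E" using K(2) by (simp add: E_def)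
    show ED: "E \<subseteq> D" using \<psi>(2) by (auto simp: E_def)
    fix u assume u: "u \<in> E"
    have uD: "u \<in> D" and uI: "u \<in> \<psi> ` (I \<times> J)" and uK: "\<theta> u \<in> K" using u ED by (auto simp: E_def)
    have "((\<lambda>y. h (\<psi> (\<theta> y, b0))) has_derivative (\<lambda>v. ?H' (\<theta> u) * Dv \<theta> u v)) (at u)"
      using has_derivative_compose[OF d\<theta>[OF uD] H[unfolded has_field_derivative_def]] \<theta>I[OF uI] by simp
    then have "(h has_derivative (\<lambda>v. ?H' (\<theta> u) * Dv \<theta> u v)) (at u)"
      by (rule has_derivative_transform_within_open[OF _ \<psi>(3) uI]) (use hb' in simp)
    from frechet_derivative_at[OF this]
    have eq: "(\<lambda>v. r (\<theta> u) * Dv h u v) = (\<lambda>v. (r (\<theta> u) * ?H' (\<theta> u)) * Dv \<theta> u v)"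
      by (simp add: fun_eq_iff mult.assoc)
    show "((\<lambda>y. \<sigma> (\<theta> y)) has_derivative (\<lambda>v. r (\<theta> u) * Dv h u v)) (at u)"
      unfolding eq using has_derivative_compose[OF d\<theta>[OF uD] \<sigma>[OF uK, unfolded has_field_derivative_def]] .
  qed
qed

section \<open>Integration on a coordinate rectangle\<close>

lemma frechet_derivative_at_eq: "(f has_derivative f') (at x) \<Longrightarrow> Dv f x = f'"
  by (rule frechet_derivative_at[symmetric])

lemma has_vector_derivative_vec_nth:
  "(f has_vector_derivative f') F \<Longrightarrow> ((\<lambda>x. f x $ i) has_vector_derivative (f' $ i)) F"
  for f :: "real \<Rightarrow> real^3"
  by (rule bounded_linear.has_vector_derivative[OF bounded_linear_vec_nth])

lemma has_vector_derivative_mink_left: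
  "(f has_vector_derivative f') F \<Longrightarrow> ((\<lambda>x. mink (f x) z) has_vector_derivative mink f' z) F"
  by (rule bounded_linear.has_vector_derivative[OF bounded_bilinear.bounded_linear_left[OF bounded_bilinear_mink]])

lemma smooth_on_slice:
  fixes f :: "real \<times> real \<Rightarrow> 'b::real_normed_vector"
  assumes "open I" "open J" "smooth_on (I \<times> J) f"
  shows "b \<in> J \<Longrightarrow> smooth_on I (\<lambda>s. f (s, b))" "a \<in> I \<Longrightarrow> smooth_on J (\<lambda>t. f (a, t))"
proof -
  have IJ: "open (I \<times> J)" using assms by (simp add: open_Times)
  show "smooth_on I (\<lambda>s. f (s, b))" if "b \<in> J"
    by (rule smooth_on_compose[OF assms(1) IJ _ assms(3) smooth_on_Pair[OF assms(1) smooth_on_id smooth_on_const]])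
      (use that assms(1) in auto)
  show "smooth_on J (\<lambda>t. f (a, t))" if "a \<in> I"
    by (rule smooth_on_compose[OF assms(2) IJ _ assms(3) smooth_on_Pair[OF assms(2) smooth_on_const smooth_on_id]])
      (use that assms(2) in auto)
qed

text \<open>The situation in coordinates (s, t) adapted to the frame: \<open>\<theta>\<close>
  depends on s only, and the coordinate derivatives of \<open>Y\<close> are the first frame vector
  and a multiple of the second. Form (1) arises for \<open>\<tau>\<close> = t, form (2) for constant
  \<open>\<tau>\<close>. The point (s0, t0) is the base point of the integrations.\<close>

locale principal_rectangle =
  fixes I J :: "real set" and Y :: "real \<times> real \<Rightarrow> real^3" and \<theta> \<tau> :: "real \<times> real \<Rightarrow> real"
    and s0 t0 :: real
  assumes I: "open_interval I" and J: "open_interval J" and s0: "s0 \<in> I" and t0: "t0 \<in> J"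
    and smooth_Y: "smooth_on (I \<times> J) Y" and smooth_\<theta>: "smooth_on (I \<times> J) \<theta>"
    and Y_s: "z \<in> I \<times> J \<Longrightarrow> Dv Y z (1, 0) = frame_first (\<theta> z) (\<tau> z)"
    and Y_t: "z \<in> I \<times> J \<Longrightarrow> \<exists>b. Dv Y z (0, 1) = b *\<^sub>R frame_second (\<tau> z)"
    and \<theta>_s: "z \<in> I \<times> J \<Longrightarrow> Dv \<theta> z (1, 0) \<noteq> 0"
    and \<theta>_t: "z \<in> I \<times> J \<Longrightarrow> Dv \<theta> z (0, 1) = 0"
begin

lemma open_IJ: "open I" "open J"
  using I J by (auto simp: open_interval_def)

lemma partial_Y:
  assumes "s \<in> I" "t \<in> J"
  shows "((\<lambda>s. Y (s, t)) has_vector_derivative frame_first (\<theta> (s, t)) (\<tau> (s, t))) (at s)"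
    and "((\<lambda>t. Y (s, t)) has_vector_derivative Dv Y (s, t) (0, 1)) (at t)"
    and "Dv Y (s, t) (0, 1) = mink (Dv Y (s, t) (0, 1)) (frame_second (\<tau> (s, t))) *\<^sub>R frame_second (\<tau> (s, t))"
proof -
  have z: "(s, t) \<in> I \<times> J" using assms by simp
  note d = has_derivative_partial[OF smooth_on_has_derivative[OF smooth_Y z]]
  show "((\<lambda>s. Y (s, t)) has_vector_derivative frame_first (\<theta> (s, t)) (\<tau> (s, t))) (at s)"
    using d(1) Y_s[OF z] by simp
  show "((\<lambda>t. Y (s, t)) has_vector_derivative Dv Y (s, t) (0, 1)) (at t)" by (rule d(2))
  obtain b where b: "Dv Y (s, t) (0, 1) = b *\<^sub>R frame_second (\<tau> (s, t))" using Y_t[OF z] by blast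
  show "Dv Y (s, t) (0, 1) = mink (Dv Y (s, t) (0, 1)) (frame_second (\<tau> (s, t))) *\<^sub>R frame_second (\<tau> (s, t))"
    unfolding b mink_simps mink_frame by simp
qed

lemma profile_constant:
  assumes "s \<in> I" "t \<in> J"
  shows "\<theta> (s, t) = \<theta> (s, t0)"
proof (rule open_interval_constant[OF J _ assms(2) t0])
  fix t assume "t \<in> J"
  then have z: "(s, t) \<in> I \<times> J" using assms by simp
  show "((\<lambda>t. \<theta> (s, t)) has_vector_derivative 0) (at t)"
    using has_derivative_partial(2)[OF smooth_on_has_derivative[OF smooth_\<theta> z]] \<theta>_t[OF z] by simp
qed

lemma smooth_profile: "smooth_on I (\<lambda>s. \<theta> (s, t0))"
  by (rule smooth_on_slice(1)[OF open_IJ smooth_\<theta> t0])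

lemma deriv_profile:
  assumes "s \<in> I"
  shows "deriv (\<lambda>s. \<theta> (s, t0)) s \<noteq> 0"
proof -
  have z: "(s, t0) \<in> I \<times> J" using assms t0 by simp
  have "((\<lambda>s. \<theta> (s, t0)) has_real_derivative Dv \<theta> (s, t0) (1, 0)) (at s)"
    using has_derivative_partial(1)[OF smooth_on_has_derivative[OF smooth_\<theta> z]]
    by (simp add: has_real_derivative_iff_has_vector_derivative)
  then show ?thesis using \<theta>_s[OF z] by (simp add: DERIV_imp_deriv)
qed

lemma first_component:
  assumes "s \<in> I" "t \<in> J"
  shows "Y (s, t) $ 1 = Y (s, t0) $ 1"
proof (rule open_interval_constant[OF J _ assms(2) t0])
  fix t assume "t \<in> J"
  note d = partial_Y[OF assms(1) this]
  have "Dv Y (s, t) (0, 1) $ 1 = 0"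
    by (subst d(3)) (simp add: frame_second_def)
  then show "((\<lambda>t. Y (s, t) $ 1) has_vector_derivative 0) (at t)"
    using has_vector_derivative_vec_nth[OF d(2), of 1] by simp
qed

lemma antiderivative_first: "antiderivative_on I (\<lambda>s. cosh (\<theta> (s, t0))) (\<lambda>s. Y (s, t0) $ 1)"
  unfolding antiderivative_on_def has_real_derivative_iff_has_vector_derivative
  using has_vector_derivative_vec_nth[OF partial_Y(1)[OF _ t0], of _ 1] by (simp add: frame_first_def)

text \<open>The axial vector is time-like, so the axial coefficient of Y is - <Y, axial>; its
  s-derivative is - <e_1, axial> = sinh \<theta> while \<open>\<tau>\<close> keeps its value at the
  base point.\<close>

lemma antiderivative_axial:
  "antiderivative_on I (\<lambda>s. sinh (\<theta> (s, t0))) (\<lambda>s. - mink (Y (s, t0)) (frame_axial (\<tau> (s0, t0))))"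
  if "\<And>s. s \<in> I \<Longrightarrow> \<tau> (s, t0) = \<tau> (s0, t0)"
  unfolding antiderivative_on_def has_real_derivative_iff_has_vector_derivative
proof
  fix s assume s: "s \<in> I"
  show "((\<lambda>s. - mink (Y (s, t0)) (frame_axial (\<tau> (s0, t0)))) has_vector_derivative sinh (\<theta> (s, t0))) (at s)"
    using has_vector_derivative_minus[OF has_vector_derivative_mink_left[OF partial_Y(1)[OF s t0],
        of "frame_axial (\<tau> (s0, t0))"]] that[OF s] by (simp add: mink_frame)
qed

text \<open>For fixed t the s-derivative of Y - C axis1 - A axial(t) is e_1 - cosh \<theta> axis1 -
  sinh \<theta> axial(t) = 0. What remains is a curve \<open>\<gamma>\<close> in t whose velocity is
  a multiple of \<open>frame_second t\<close>.\<close>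

lemma type1_form:
  assumes \<tau>: "\<And>z. z \<in> I \<times> J \<Longrightarrow> \<tau> z = snd z"
  obtains \<Psi> C A \<gamma>2 \<gamma>3 where "smooth_on J \<Psi>"
    "antiderivative_on I (\<lambda>s. cosh (\<theta> (s, t0))) C" "antiderivative_on I (\<lambda>s. sinh (\<theta> (s, t0))) A"
    "antiderivative_on J (\<lambda>\<tau>. \<Psi> \<tau> * cosh \<tau>) \<gamma>2" "antiderivative_on J (\<lambda>\<tau>. \<Psi> \<tau> * sinh \<tau>) \<gamma>3"
    "\<forall>s\<in>I. \<forall>t\<in>J. Y (s, t) = C s *\<^sub>R axis1 + A s *\<^sub>R vector [0, sinh t, cosh t]
        + vector [0, \<gamma>2 t, \<gamma>3 t]"
proof -
  define C where "C s = Y (s, t0) $ 1" for s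
  define A where "A s = - mink (Y (s, t0)) (frame_axial t0)" for s
  define \<gamma> where "\<gamma> t = Y (s0, t) - C s0 *\<^sub>R axis1 - A s0 *\<^sub>R frame_axial t" for t
  \<comment> \<open>The subtracted \<open>A s0\<close> accounts for the derivative of A(s0)
    axial(t), which is A(s0) times \<open>frame_second t\<close>.\<close>
  define \<Psi> where "\<Psi> t = mink (Dv Y (s0, t) (0, 1)) (frame_second t) - A s0" for t
  have C: "antiderivative_on I (\<lambda>s. cosh (\<theta> (s, t0))) C"
    using antiderivative_first by (simp add: C_def[abs_def])
  have A: "antiderivative_on I (\<lambda>s. sinh (\<theta> (s, t0))) A"
    using antiderivative_axial \<tau> s0 t0 by (simp add: A_def[abs_def])
  have "smooth_on J (\<lambda>t. Dv Y (s0, t) (0, 1))"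
    by (rule smooth_on_slice(2)[OF open_IJ smooth_on_Dv[OF smooth_Y] s0])
  then have \<Psi>: "smooth_on J \<Psi>"
    unfolding \<Psi>_def[abs_def]
    by (intro smooth_on_diff smooth_on_mink smooth_on_const smooth_on_frame_second smooth_on_id open_IJ)
  have \<gamma>': "(\<gamma> has_vector_derivative \<Psi> t *\<^sub>R frame_second t) (at t)" if t: "t \<in> J" for t
  proof -
    have "((\<lambda>t. frame_axial t) has_vector_derivative frame_second t) (at t)"
      using has_derivative_frame(4)[OF has_derivative_ident has_derivative_ident, of t]
      by (simp add: has_vector_derivative_def)
    then have "((\<lambda>t. A s0 *\<^sub>R frame_axial t) has_vector_derivative A s0 *\<^sub>R frame_second t) (at t)"
      by (rule bounded_linear.has_vector_derivative[OF bounded_linear_scaleR_right])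
    from has_vector_derivative_diff[OF has_vector_derivative_diff[OF partial_Y(2)[OF s0 t]
          has_vector_derivative_const] this]
    have "(\<gamma> has_vector_derivative Dv Y (s0, t) (0, 1) - 0 - A s0 *\<^sub>R frame_second t) (at t)"
      unfolding \<gamma>_def[abs_def] .
    moreover have "Dv Y (s0, t) (0, 1) - 0 - A s0 *\<^sub>R frame_second t = \<Psi> t *\<^sub>R frame_second t"
      using partial_Y(3)[OF s0 t] \<tau>[of "(s0, t)"] s0 t by (simp add: \<Psi>_def algebra_simps)
    ultimately show ?thesis by simp
  qed
  have \<gamma>2: "antiderivative_on J (\<lambda>t. \<Psi> t * cosh t) (\<lambda>t. \<gamma> t $ 2)"
    and \<gamma>3: "antiderivative_on J (\<lambda>t. \<Psi> t * sinh t) (\<lambda>t. \<gamma> t $ 3)"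
    unfolding antiderivative_on_def has_real_derivative_iff_has_vector_derivative
    using has_vector_derivative_vec_nth[OF \<gamma>', of _ 2] has_vector_derivative_vec_nth[OF \<gamma>', of _ 3]
    by (simp_all add: frame_second_def)
  have form: "Y (s, t) = C s *\<^sub>R axis1 + A s *\<^sub>R vector [0, sinh t, cosh t] + vector [0, \<gamma> t $ 2, \<gamma> t $ 3]"
    if s: "s \<in> I" and t: "t \<in> J" for s t
  proof -
    have "Y (s, t) - C s *\<^sub>R axis1 - A s *\<^sub>R frame_axial t
        = Y (s0, t) - C s0 *\<^sub>R axis1 - A s0 *\<^sub>R frame_axial t"
    proof (rule open_interval_constant[OF I _ s s0])
      fix s assume s: "s \<in> I"
      have dC: "(C has_vector_derivative cosh (\<theta> (s, t0))) (at s)"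
        and dA: "(A has_vector_derivative sinh (\<theta> (s, t0))) (at s)"
        using C A s by (auto simp: antiderivative_on_def has_real_derivative_iff_has_vector_derivative)
      have "((\<lambda>s. Y (s, t) - C s *\<^sub>R axis1 - A s *\<^sub>R frame_axial t) has_vector_derivative
          frame_first (\<theta> (s, t)) (\<tau> (s, t)) - cosh (\<theta> (s, t0)) *\<^sub>R axis1 - sinh (\<theta> (s, t0)) *\<^sub>R frame_axial t) (at s)"
        by (intro has_vector_derivative_diff partial_Y(1)[OF s t]
            bounded_linear.has_vector_derivative[OF bounded_linear_scaleR_left] dC dA)
      moreover have "frame_first (\<theta> (s, t)) (\<tau> (s, t)) - cosh (\<theta> (s, t0)) *\<^sub>R axis1
          - sinh (\<theta> (s, t0)) *\<^sub>R frame_axial t = 0"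
        using \<tau>[of "(s, t)"] s t profile_constant[OF s t] by (simp add: frame_first_axial)
      ultimately show "((\<lambda>s. Y (s, t) - C s *\<^sub>R axis1 - A s *\<^sub>R frame_axial t) has_vector_derivative 0) (at s)"
        by simp
    qed
    then have e: "Y (s, t) = C s *\<^sub>R axis1 + A s *\<^sub>R frame_axial t + \<gamma> t"
      unfolding \<gamma>_def by (simp add: algebra_simps)
    have "\<gamma> t $ 1 = 0"
      using first_component[OF s0 t] by (simp add: \<gamma>_def C_def frame_axial_def)
    then have "\<gamma> t = vector [0, \<gamma> t $ 2, \<gamma> t $ 3]" by (simp add: vec_eq_iff forall_3)
    then show ?thesis using e by (simp add: frame_axial_def)
  qed
  show thesis by (rule that[OF \<Psi> C A \<gamma>2 \<gamma>3]) (blast intro: form)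
qed

text \<open>The frame directions are now fixed, so \<open>Y\<close> is expanded in
  \<open>axis1\<close>, axial and second vector. The first two coefficients do not depend on t, and
  the third equals t by the choice of the coordinate.\<close>

lemma type2_form:
  assumes \<tau>: "\<And>z. z \<in> I \<times> J \<Longrightarrow> \<tau> z = c"
    and second: "\<And>z. z \<in> I \<times> J \<Longrightarrow> mink (Y z) (frame_second c) = snd z"
  obtains C A where
    "antiderivative_on I (\<lambda>s. cosh (\<theta> (s, t0))) C" "antiderivative_on I (\<lambda>s. sinh (\<theta> (s, t0))) A"
    "\<forall>s\<in>I. \<forall>t\<in>J. Y (s, t) = C s *\<^sub>R axis1 + A s *\<^sub>R vector [0, sinh c, cosh c]
        + vector [0, t * cosh c, t * sinh c]"
proof -
  define A where "A s = - mink (Y (s, t0)) (frame_axial c)" for s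
  have A: "antiderivative_on I (\<lambda>s. sinh (\<theta> (s, t0))) A"
    using antiderivative_axial \<tau> s0 t0 by (simp add: A_def[abs_def])
  have form: "Y (s, t) = Y (s, t0) $ 1 *\<^sub>R axis1 + A s *\<^sub>R vector [0, sinh c, cosh c]
        + vector [0, t * cosh c, t * sinh c]" if s: "s \<in> I" and t: "t \<in> J" for s t
  proof -
    have "mink (Y (s, t)) (frame_axial c) = mink (Y (s, t0)) (frame_axial c)"
    proof (rule open_interval_constant[OF J _ t t0])
      fix t assume t: "t \<in> J"
      note d = partial_Y[OF s t]
      have c: "\<tau> (s, t) = c" using \<tau> s t by simp
      have "mink (Dv Y (s, t) (0, 1)) (frame_axial c) = 0"
        by (subst d(3), unfold c mink_simps mink_commute[of "frame_second c"] mink_frame) simp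
      then show "((\<lambda>t. mink (Y (s, t)) (frame_axial c)) has_vector_derivative 0) (at t)"
        using has_vector_derivative_mink_left[OF d(2), of "frame_axial c"] by simp
    qed
    moreover have "mink (Y (s, t)) (frame_second c) = t" using second s t by simp
    ultimately have "Y (s, t) = Y (s, t0) $ 1 *\<^sub>R axis1 + A s *\<^sub>R frame_axial c + t *\<^sub>R frame_second c"
      using axial_expansion[of "Y (s, t)" c] first_component[OF s t] by (simp add: A_def)
    moreover have "t *\<^sub>R frame_second c = vector [0, t * cosh c, t * sinh c]"
      by (simp add: vec_eq_iff forall_3 frame_second_def)
    ultimately show ?thesis by (simp add: frame_axial_def)
  qed
  show thesis by (rule that[OF antiderivative_first A]) (blast intro: form)
qed

end

subsection \<open>Patches with a canonical principal direction\<close>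

text \<open>Since <axis1, n> is the first component of \<open>n\<close>, the vector in
  \<open>principal\<close> is the tangential part of \<open>axis1\<close>. The minus sign comes from
  S = - dn, and \<open>future\<close> makes the hyperbolic angles available.\<close>

locale cpd_patch = spacelike_patch +
  fixes \<kappa> :: "real \<times> real \<Rightarrow> real"
  assumes \<kappa>: "u \<in> D \<Longrightarrow> \<kappa> u \<noteq> 0" and future: "u \<in> D \<Longrightarrow> n u $ 3 > 0"
    and principal: "u \<in> D \<Longrightarrow> Dv X u v = axis1 + (n u $ 1) *\<^sub>R n u \<Longrightarrow> Dv n u v = - \<kappa> u *\<^sub>R Dv X u v"
begin

definition angle :: "real \<times> real \<Rightarrow> real" where
  "angle u = arsinh (n u $ 1)"

definition turn :: "real \<times> real \<Rightarrow> real" where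
  "turn u = arsinh (n u $ 2 / cosh (angle u))"

text \<open>\<open>coframe1\<close> and \<open>coframe2\<close> are the forms \<alpha> and \<beta>
  of the overview.\<close>

definition coframe1 :: "real \<times> real \<Rightarrow> real \<times> real \<Rightarrow> real" where
  "coframe1 u v = mink (Dv X u v) (frame_first (angle u) (turn u))"

definition coframe2 :: "real \<times> real \<Rightarrow> real \<times> real \<Rightarrow> real" where
  "coframe2 u v = mink (Dv X u v) (frame_second (turn u))"

lemma normal_frame: "u \<in> D \<Longrightarrow> n u = frame_normal (angle u) (turn u)"
  unfolding turn_def angle_def by (rule unit_timelike_frame[OF normal_unit future])

lemma smooth_angle: "smooth_on D angle"
  unfolding angle_def[abs_def]
  by (intro smooth_on_arsinh open_D smooth_on_linear_compose[OF _ bounded_linear_vec_nth] smooth_n)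

lemma smooth_turn: "smooth_on D turn"
  unfolding turn_def[abs_def] divide_inverse
  by (intro smooth_on_arsinh smooth_on_mult smooth_on_inverse smooth_on_cosh smooth_angle open_D
      smooth_on_linear_compose[OF _ bounded_linear_vec_nth] smooth_n) simp

lemma smooth_coframe1: "smooth_on D (\<lambda>u. coframe1 u v)"
  unfolding coframe1_def
  by (intro smooth_on_mink smooth_on_Dv smooth_X smooth_on_frame_first smooth_angle smooth_turn open_D)

lemma DX_frame:
  assumes "u \<in> D"
  shows "Dv X u v = coframe1 u v *\<^sub>R frame_first (angle u) (turn u) + coframe2 u v *\<^sub>R frame_second (turn u)"
  using frame_expansion[of "Dv X u v" "angle u" "turn u"] normal_orthogonal[OF assms, of v]
  by (simp add: coframe1_def coframe2_def normal_frame[OF assms, symmetric] mink_commute[of _ "n u"])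

lemma coframe_eq_0: "u \<in> D \<Longrightarrow> coframe1 u v = 0 \<Longrightarrow> coframe2 u v = 0 \<Longrightarrow> v = 0"
  using DX_frame[of u v] DX_eq_0[of u v] by simp

lemma Dn_frame:
  assumes "u \<in> D"
  shows "Dv n u v = Dv angle u v *\<^sub>R frame_first (angle u) (turn u)
    + (cosh (angle u) * Dv turn u v) *\<^sub>R frame_second (turn u)"
proof -
  have "(n has_derivative (\<lambda>v. Dv angle u v *\<^sub>R frame_first (angle u) (turn u)
      + (cosh (angle u) * Dv turn u v) *\<^sub>R frame_second (turn u))) (at u)"
    by (rule has_derivative_transform_within_open[OF has_derivative_frame(1) open_D assms])
      (use smooth_on_has_derivative[OF smooth_angle assms] smooth_on_has_derivative[OF smooth_turn assms]
        normal_frame in auto)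
  from fun_cong[OF frechet_derivative_at_eq[OF this]] show ?thesis by simp
qed

lemma frame_vectors:
  assumes "u \<in> D"
  obtains v w where "Dv X u v = frame_first (angle u) (turn u)" "Dv X u w = frame_second (turn u)"
proof -
  have "mink (frame_first (angle u) (turn u)) (n u) = 0" "mink (frame_second (turn u)) (n u) = 0"
    using mink_frame(5,6) normal_frame[OF assms] mink_commute by metis+
  from this[THEN tangent_vectorE[OF assms]] show thesis using that by metis
qed

text \<open>By symmetry of the second fundamental form, d\<theta>(v) = <dn(v), e_1> = <dn(v_1),
  dX(v)> for the coordinate vector \<open>v1\<close> of e_1, and dn(v_1) = - \<kappa> e_1 because
  cosh \<theta> e_1 is the tangential part of \<open>axis1\<close>.\<close>

lemma Dv_angle:
  assumes "u \<in> D"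
  shows "Dv angle u v = - \<kappa> u * coframe1 u v"
proof -
  obtain v1 where v1: "Dv X u v1 = frame_first (angle u) (turn u)"
    using frame_vectors[OF assms] by blast
  have n1: "n u $ 1 = sinh (angle u)" by (simp add: angle_def)
  have "Dv X u (cosh (angle u) *\<^sub>R v1) = axis1 + (n u $ 1) *\<^sub>R n u"
    unfolding linear_scale[OF linear_DX[OF assms]] v1 axis1_frame[symmetric] n1 normal_frame[OF assms, symmetric] ..
  from principal[OF assms this]
  have "cosh (angle u) *\<^sub>R Dv n u v1 = cosh (angle u) *\<^sub>R (- \<kappa> u *\<^sub>R frame_first (angle u) (turn u))"
    unfolding linear_scale[OF linear_DX[OF assms]] linear_scale[OF linear_Dn[OF assms]] v1
    by (simp add: mult.commute)
  then have Dn1: "Dv n u v1 = - \<kappa> u *\<^sub>R frame_first (angle u) (turn u)"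
    by (metis cosh_real_nonzero scaleR_left_imp_eq)
  have "Dv angle u v = mink (Dv n u v) (Dv X u v1)"
    unfolding Dn_frame[OF assms] v1 mink_simps mink_commute[of "frame_second _"] mink_frame by simp
  also have "\<dots> = mink (Dv n u v1) (Dv X u v)"
    by (rule second_form_symmetric[OF assms])
  also have "\<dots> = - \<kappa> u * coframe1 u v"
    unfolding Dn1 mink_simps coframe1_def by (simp add: mink_commute)
  finally show ?thesis .
qed

text \<open>Let \<open>w\<close> be the coordinate vector of e_2. Then \<alpha>(w) = 0, hence
  d\<theta>(w) = 0 and dn(w) = cosh \<theta> \<mu> e_2; symmetry yields dt = \<mu> \<beta>. In the
  frame, dn is diagonal with entries - \<kappa> and cosh \<theta> \<mu>, and \<kappa> \<noteq> 0, so
  \<mu> alone decides injectivity.\<close>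

lemma Dv_turn:
  assumes "u \<in> D"
  obtains \<mu> where "\<And>v. Dv turn u v = \<mu> * coframe2 u v" "inj (Dv n u) \<longleftrightarrow> \<mu> \<noteq> 0"
proof -
  obtain w where w: "Dv X u w = frame_second (turn u)"
    using frame_vectors[OF assms] by blast
  have c1: "coframe1 u w = 0"
    unfolding coframe1_def w by (subst mink_commute) (rule mink_frame)
  define \<mu> where "\<mu> = Dv turn u w"
  have turn: "Dv turn u v = \<mu> * coframe2 u v" for v
  proof -
    have "cosh (angle u) * Dv turn u v = mink (Dv n u v) (Dv X u w)"
      unfolding Dn_frame[OF assms] w mink_simps mink_frame by simp
    also have "\<dots> = mink (Dv n u w) (Dv X u v)"
      by (rule second_form_symmetric[OF assms])
    also have "\<dots> = cosh (angle u) * \<mu> * coframe2 u v"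
      unfolding Dn_frame[OF assms, of w] Dv_angle[OF assms] c1 mink_simps coframe2_def \<mu>_def
      by (simp add: mink_commute)
    finally show ?thesis using cosh_real_nonzero[of "angle u"] by simp
  qed
  have "inj (Dv n u) \<longleftrightarrow> \<mu> \<noteq> 0"
  proof
    assume inj: "inj (Dv n u)"
    show "\<mu> \<noteq> 0"
    proof
      assume "\<mu> = 0"
      then have "Dv n u w = 0" using Dn_frame[OF assms, of w] Dv_angle[OF assms, of w] c1 by (simp add: \<mu>_def)
      then have "w = 0" using linear_injective_0[OF linear_Dn[OF assms]] inj by blast
      then have "frame_second (turn u) = 0" using w linear_0[OF linear_DX[OF assms]] by simp
      then show False using mink_frame(3)[of "turn u"] by (simp add: mink_simps)
    qed
  next
    assume \<mu>: "\<mu> \<noteq> 0"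
    show "inj (Dv n u)"
      unfolding linear_injective_0[OF linear_Dn[OF assms]]
    proof (intro allI impI)
      fix v assume 0: "Dv n u v = 0"
      have "Dv angle u v = mink (Dv n u v) (frame_first (angle u) (turn u))"
        unfolding Dn_frame[OF assms] mink_simps mink_commute[of "frame_second _"] mink_frame by simp
      then have "coframe1 u v = 0" using 0 Dv_angle[OF assms, of v] \<kappa>[OF assms] by (simp add: mink_simps)
      moreover have "cosh (angle u) * Dv turn u v = mink (Dv n u v) (frame_second (turn u))"
        unfolding Dn_frame[OF assms] mink_simps mink_frame by simp
      then have "coframe2 u v = 0" using 0 turn[of v] \<mu> by (simp add: mink_simps)
      ultimately show "v = 0" by (rule coframe_eq_0[OF assms])
    qed
  qed
  then show thesis using that turn by blast
qed

text \<open>With h = x_1, the relations dh = cosh \<theta> \<alpha> and d\<theta> = - \<kappa>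
  \<alpha> make dh a multiple of d\<theta>, so \<alpha> = dh / cosh \<theta> has a potential by
  \<open>exact_multiple\<close>. This potential is smooth because \<alpha> is.\<close>

lemma arc_length:
  assumes "u0 \<in> D"
  obtains E s where "open E" "u0 \<in> E" "E \<subseteq> D" "smooth_on E s" "\<And>u v. u \<in> E \<Longrightarrow> Dv s u v = coframe1 u v"
proof -
  let ?h = "\<lambda>u. X u $ 1"
  have Dh: "Dv ?h u v = cosh (angle u) * coframe1 u v" if "u \<in> D" for u v
  proof -
    have "Dv ?h u v = Dv X u v $ 1"
      by (rule Dv_linear_compose[OF bounded_linear_vec_nth smooth_on_differentiable[OF smooth_X that]])
    then show ?thesis
      by (simp add: DX_frame[OF that] frame_first_def frame_second_def)
  qed
  have c: "Dv ?h u v = (- cosh (angle u) / \<kappa> u) * Dv angle u v" if "u \<in> D" for u v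
    using \<kappa>[OF that] by (simp add: Dh[OF that] Dv_angle[OF that])
  have nz: "Dv angle u0 \<noteq> (\<lambda>v. 0)"
  proof
    assume 0: "Dv angle u0 = (\<lambda>v. 0)"
    obtain v where "Dv X u0 v = frame_first (angle u0) (turn u0)"
      using frame_vectors[OF assms] by blast
    then have "coframe1 u0 v = 1" by (simp add: coframe1_def mink_frame)
    then show False using fun_cong[OF 0, of v] Dv_angle[OF assms, of v] \<kappa>[OF assms] by simp
  qed
  have r: "continuous_on UNIV (\<lambda>a::real. inverse (cosh a))"
    by (intro continuous_on_inverse continuous_on_cosh continuous_on_id) simp
  obtain E s where E: "open E" "u0 \<in> E" "E \<subseteq> D"
    and s: "\<forall>u\<in>E. (s has_derivative (\<lambda>v. inverse (cosh (angle u)) * Dv ?h u v)) (at u)"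
    using exact_multiple[OF open_D assms smooth_on_linear_compose[OF open_D bounded_linear_vec_nth smooth_X]
        smooth_angle c nz r] by blast
  have s': "(s has_derivative coframe1 u) (at u)" if "u \<in> E" for u
  proof -
    have "(\<lambda>v. inverse (cosh (angle u)) * Dv ?h u v) = coframe1 u"
      using Dh[OF subsetD[OF E(3) that]] by (intro ext) simp
    then show ?thesis using bspec[OF s that] by (simp only:)
  qed
  have "smooth_on E s"
    by (rule smooth_onI[OF E(1) s' smooth_on_subset[OF smooth_coframe1 E(3)]])
  moreover have "Dv s u v = coframe1 u v" if "u \<in> E" for u v
    using frechet_derivative_at_eq[OF s'[OF that]] by simp
  ultimately show thesis using that E by blast
qed

text \<open>The second coordinate \<open>q\<close> is left open in order to serve both cases: the
  angle \<open>turn\<close> with m = \<mu> at non-flat points, and <X, e_2> with m = 1 on flat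
  pieces.\<close>

lemma principal_coordinates:
  assumes E: "open E" "u0 \<in> E" "E \<subseteq> D" and s: "smooth_on E s" "\<And>u v. u \<in> E \<Longrightarrow> Dv s u v = coframe1 u v"
    and q: "smooth_on E q" "\<And>u v. u \<in> E \<Longrightarrow> Dv q u v = m u * coframe2 u v" "m u0 \<noteq> 0"
  obtains I J \<psi> where "u0 \<in> \<psi> ` (I \<times> J)" "smooth_on (I \<times> J) \<psi>" "\<psi> ` (I \<times> J) \<subseteq> E" "open (\<psi> ` (I \<times> J))"
    "\<forall>z\<in>I \<times> J. (s (\<psi> z), q (\<psi> z)) = z"
    "principal_rectangle I J (\<lambda>z. X (\<psi> z)) (\<lambda>z. angle (\<psi> z)) (\<lambda>z. turn (\<psi> z)) (s u0) (q u0)"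
proof -
  let ?\<Phi> = "\<lambda>u. (s u, q u)"
  have s\<Phi>: "smooth_on E ?\<Phi>" by (rule smooth_on_Pair[OF E(1) s(1) q(1)])
  have D\<Phi>: "Dv ?\<Phi> u v = (coframe1 u v, m u * coframe2 u v)" if "u \<in> E" for u v
    using fun_cong[OF frechet_derivative_at_eq[OF has_derivative_Pair[OF
        smooth_on_has_derivative[OF s(1) that] smooth_on_has_derivative[OF q(1) that]]], of v]
    by (simp add: s(2)[OF that] q(2)[OF that])
  have "v = 0" if "Dv ?\<Phi> u0 v = 0" for v
    by (rule coframe_eq_0[of u0]) (use that E q(3) in \<open>auto simp: D\<Phi>[OF E(2)] zero_prod_def\<close>)
  then have "inj (Dv ?\<Phi> u0)"
    using linear_injective_0[OF has_derivative_linear[OF smooth_on_has_derivative[OF s\<Phi> E(2)]]] by blast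
  from local_inverse[OF E(1) s\<Phi> E(2) this]
  obtain I J \<psi> where IJ: "open_interval I" "open_interval J" "?\<Phi> u0 \<in> I \<times> J"
    and \<psi>: "smooth_on (I \<times> J) \<psi>" "\<psi> ` (I \<times> J) \<subseteq> E" "open (\<psi> ` (I \<times> J))"
      "\<And>z. z \<in> I \<times> J \<Longrightarrow> ?\<Phi> (\<psi> z) = z" "\<psi> (?\<Phi> u0) = u0"
    by blast
  have oIJ: "open (I \<times> J)" using IJ by (auto simp: open_interval_def open_Times)
  have in_E: "\<psi> z \<in> E" if "z \<in> I \<times> J" for z using that \<psi>(2) by blast
  have in_D: "\<psi> z \<in> D" if "z \<in> I \<times> J" for z using in_E[OF that] E(3) by blast
  have ch: "Dv (\<lambda>z. f (\<psi> z)) z v = Dv f (\<psi> z) (Dv \<psi> z v)" if "smooth_on D f" "z \<in> I \<times> J"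
    for f :: "real \<times> real \<Rightarrow> 'b::real_normed_vector" and z v
    using Dv_compose(1)[OF smooth_on_differentiable[OF \<psi>(1) that(2)] smooth_on_differentiable[OF that(1) in_D[OF that(2)]], of v]
    by (simp add: comp_def)
  have co: "coframe1 (\<psi> z) (Dv \<psi> z v) = fst v \<and> m (\<psi> z) * coframe2 (\<psi> z) (Dv \<psi> z v) = snd v"
    if z: "z \<in> I \<times> J" for z v
    using Dv_left_inverse[OF oIJ z \<psi>(4) smooth_on_differentiable[OF \<psi>(1) z]
        smooth_on_differentiable[OF s\<Phi> in_E[OF z]], of v]
    unfolding D\<Phi>[OF in_E[OF z]] by (simp add: prod_eq_iff)
  have sc: "smooth_on (I \<times> J) (\<lambda>z. f (\<psi> z))" if "smooth_on D f" for f :: "real \<times> real \<Rightarrow> 'b::real_normed_vector"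
    by (rule smooth_on_compose[OF oIJ open_D _ that \<psi>(1)]) (use in_D in blast)
  have rect: "principal_rectangle I J (\<lambda>z. X (\<psi> z)) (\<lambda>z. angle (\<psi> z)) (\<lambda>z. turn (\<psi> z)) (s u0) (q u0)"
  proof
    show "open_interval I" "open_interval J" "s u0 \<in> I" "q u0 \<in> J" using IJ by auto
    show "smooth_on (I \<times> J) (\<lambda>z. X (\<psi> z))" by (rule sc[OF smooth_X])
    show "smooth_on (I \<times> J) (\<lambda>z. angle (\<psi> z))" by (rule sc[OF smooth_angle])
    fix z assume z: "z \<in> I \<times> J"
    \<comment> \<open>\<open>m\<close> is assumed nonzero only at \<open>u0\<close>, without
      continuity. On the rectangle it cannot vanish because m \<beta> takes the value 1 on the
      second coordinate vector.\<close>
    have "m (\<psi> z) \<noteq> 0" using co[OF z, of "(0, 1)"] by auto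
    then have "coframe2 (\<psi> z) (Dv \<psi> z (1, 0)) = 0" using co[OF z, of "(1, 0)"] by simp
    then show "Dv (\<lambda>z. X (\<psi> z)) z (1, 0) = frame_first (angle (\<psi> z)) (turn (\<psi> z))"
      unfolding ch[OF smooth_X z] DX_frame[OF in_D[OF z]] using co[OF z, of "(1, 0)"] by simp
    show "\<exists>b. Dv (\<lambda>z. X (\<psi> z)) z (0, 1) = b *\<^sub>R frame_second (turn (\<psi> z))"
      unfolding ch[OF smooth_X z] DX_frame[OF in_D[OF z]] using co[OF z, of "(0, 1)"] by auto
    show "Dv (\<lambda>z. angle (\<psi> z)) z (1, 0) \<noteq> 0" "Dv (\<lambda>z. angle (\<psi> z)) z (0, 1) = 0"
      unfolding ch[OF smooth_angle z] Dv_angle[OF in_D[OF z]]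
      using co[OF z, of "(1, 0)"] co[OF z, of "(0, 1)"] \<kappa>[OF in_D[OF z]] by auto
  qed
  have "u0 \<in> \<psi> ` (I \<times> J)" using IJ(3) \<psi>(5) by (intro image_eqI[of _ _ "?\<Phi> u0"]) auto
  then show thesis by (rule that[OF _ \<psi>(1-3) ballI[OF \<psi>(4)] rect])
qed

end

subsection \<open>From a canonical principal direction to the normal forms\<close>

lemma mink_axis1: "mink axis1 z = z $ 1"
  by (simp add: mink_def)

lemma bounded_linear_scaled:
  fixes L :: "real^3 \<Rightarrow> real^3"
  shows "linear L \<Longrightarrow> bounded_linear (\<lambda>z. e *\<^sub>R L z)"
  using linear_conv_bounded_linear bounded_linear_const_scaleR by blast

text \<open>The sign \<open>e\<close> is there to make the transformed normal
  future-directed.\<close>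

lemma isometric_patch:
  fixes L :: "real^3 \<Rightarrow> real^3"
  assumes L: "linear L" "\<And>v w. mink (L v) (L w) = mink v w"
    and e: "e * e = 1" and N: "unit_normal_field M x N" and \<phi>: "surface_chart M x D \<phi>"
  shows "spacelike_patch D (\<lambda>u. L (x (\<phi> u))) (\<lambda>u. e *\<^sub>R L (N (\<phi> u)))"
    "\<And>u v. u \<in> D \<Longrightarrow> Dv (\<lambda>u. L (x (\<phi> u))) u v = L (Dv (x \<circ> \<phi>) u v)"
    "\<And>u v. u \<in> D \<Longrightarrow> Dv (\<lambda>u. e *\<^sub>R L (N (\<phi> u))) u v = e *\<^sub>R L (Dv (N \<circ> \<phi>) u v)"
proof -
  interpret P: spacelike_patch D "x \<circ> \<phi>" "N \<circ> \<phi>"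
    by (rule unit_normal_field_patch[OF N \<phi>])
  have bL: "bounded_linear L" using L(1) linear_conv_bounded_linear by blast
  have be: "bounded_linear (\<lambda>z. e *\<^sub>R L z)" by (rule bounded_linear_scaled[OF L(1)])
  show DX: "Dv (\<lambda>u. L (x (\<phi> u))) u v = L (Dv (x \<circ> \<phi>) u v)" if "u \<in> D" for u v
    using Dv_linear_compose[OF bL smooth_on_differentiable[OF P.smooth_X that]] by simp
  show Dn: "Dv (\<lambda>u. e *\<^sub>R L (N (\<phi> u))) u v = e *\<^sub>R L (Dv (N \<circ> \<phi>) u v)" if "u \<in> D" for u v
    using Dv_linear_compose[OF be smooth_on_differentiable[OF P.smooth_n that]] by simp
  have inj: "inj L" using mink_preserving_bij[OF L] by (simp add: bij_def)
  show "spacelike_patch D (\<lambda>u. L (x (\<phi> u))) (\<lambda>u. e *\<^sub>R L (N (\<phi> u)))"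
  proof
    show "open D" by (rule P.open_D)
    show "smooth_on D (\<lambda>u. L (x (\<phi> u)))"
      using smooth_on_linear_compose[OF P.open_D bL P.smooth_X] by simp
    show "smooth_on D (\<lambda>u. e *\<^sub>R L (N (\<phi> u)))"
      using smooth_on_linear_compose[OF P.open_D be P.smooth_n] by simp
    fix u assume u: "u \<in> D"
    have "Dv (\<lambda>u. L (x (\<phi> u))) u = L \<circ> Dv (x \<circ> \<phi>) u" using DX[OF u] by (intro ext) simp
    then show "inj (Dv (\<lambda>u. L (x (\<phi> u))) u)" using inj P.inj_DX[OF u] by (simp add: inj_compose)
    have "mink (e *\<^sub>R L (N (\<phi> u))) (e *\<^sub>R L (N (\<phi> u))) = (e * e) * mink (N (\<phi> u)) (N (\<phi> u))"
      by (simp add: mink_simps L(2))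
    then show "mink (e *\<^sub>R L (N (\<phi> u))) (e *\<^sub>R L (N (\<phi> u))) = -1"
      using e P.normal_unit[OF u] by simp
    show "mink (e *\<^sub>R L (N (\<phi> u))) (Dv (\<lambda>u. L (x (\<phi> u))) u v) = 0" for v
      using P.normal_orthogonal[OF u, of v] by (simp add: DX[OF u] mink_simps L(2))
  qed
qed

text \<open>The tangential part is quadratic in the normal, so the sign \<open>e\<close> cancels,
  and it is linear in the direction, which brings out the factor \<open>c\<close>.\<close>

lemma tangential_part_isometric:
  fixes L :: "real^3 \<Rightarrow> real^3"
  assumes L: "linear L" "\<And>v w. mink (L v) (L w) = mink v w"
    and e: "e * e = 1" and k: "L k = c *\<^sub>R axis1"
  shows "L (tangential_part N k p) = c *\<^sub>R (axis1 + ((e *\<^sub>R L (N p)) $ 1) *\<^sub>R (e *\<^sub>R L (N p)))"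
proof -
  have "mink k (N p) = c * L (N p) $ 1"
    using L(2)[of k "N p"] by (simp add: k mink_simps mink_axis1)
  then have "L (tangential_part N k p) = c *\<^sub>R axis1 + (c * L (N p) $ 1) *\<^sub>R L (N p)"
    unfolding tangential_part_def linear_add[OF L(1)] linear_scale[OF L(1)] k by simp
  also have "\<dots> = c *\<^sub>R (axis1 + (e * e * (L (N p) $ 1)) *\<^sub>R L (N p))"
    unfolding e by (simp add: algebra_simps)
  also have "\<dots> = c *\<^sub>R (axis1 + ((e *\<^sub>R L (N p)) $ 1) *\<^sub>R (e *\<^sub>R L (N p)))"
    by (simp add: mult.commute mult.left_commute)
  finally show ?thesis .
qed

text \<open>After the isometry \<open>L\<close> the chart near \<open>p\<close> becomes a
  \<open>cpd_patch\<close>. The coordinates (s, q) then exhibit form (1) or form (2), according to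
  whether K is nonzero at \<open>p\<close> or zero near \<open>p\<close>.\<close>

lemma cpd_normal_form:
  fixes x N :: "'a \<Rightarrow> real^3" and L :: "real^3 \<Rightarrow> real^3"
  assumes imm: "immersed_surface M x" and N: "unit_normal_field M x N"
    and cpd: "canonical_principal_direction M x N k k1"
    and L: "linear L" "\<And>v w. mink (L v) (L w) = mink v w" and c: "c \<noteq> 0" and k: "L k = c *\<^sub>R axis1"
    and p: "p \<in> topspace M" "k1 p \<noteq> 0" and flat: "flat_or_nonflat_at M x N p"
  shows "congruent_type1_at M x L p \<or> congruent_type2_at M x N L p"
proof -
  obtain D0 \<phi> u0 where \<phi>: "surface_chart M x D0 \<phi>" and u0: "u0 \<in> D0" "p = \<phi> u0"
    using imm p(1) unfolding immersed_surface_def by blast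
  have pN: "mink (L (N p)) (L (N p)) = -1" using N p(1) by (simp add: unit_normal_field_def L(2))
  then have "L (N p) $ 3 * L (N p) $ 3 = 1 + L (N p) $ 1 * L (N p) $ 1 + L (N p) $ 2 * L (N p) $ 2"
    by (simp add: mink_def)
  then have "L (N p) $ 3 * L (N p) $ 3 > 0"
    using zero_le_square[of "L (N p) $ 1"] zero_le_square[of "L (N p) $ 2"] by linarith
  then have N3: "L (N p) $ 3 \<noteq> 0" by auto
  \<comment> \<open>A time-like unit vector has nonzero third component, so this sign is 1 or
    -1.\<close>
  define e :: real where "e = sgn (L (N p) $ 3)"
  have e: "e * e = 1" and e_pos: "e * L (N p) $ 3 > 0"
    using N3 by (auto simp: e_def sgn_real_def)
  \<comment> \<open>In the non-flat case \<open>W\<close> may be the whole space; in the flat case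
    it is the flat neighbourhood.\<close>
  obtain W where W: "openin M W" "p \<in> W" "gaussian_curvature M x N p \<noteq> 0 \<or> flat_on M x N W"
    using flat p(1) unfolding flat_or_nonflat_at_def by (metis openin_topspace)
  define X where "X u = L (x (\<phi> u))" for u
  define n where "n u = e *\<^sub>R L (N (\<phi> u))" for u
  note iso = isometric_patch[OF L e N \<phi>, folded X_def[abs_def] n_def[abs_def]]
  interpret P0: spacelike_patch D0 X n by (rule iso(1))
  define D where "D = {u \<in> D0. k1 (\<phi> u) \<noteq> 0 \<and> 0 < n u $ 3 \<and> \<phi> u \<in> W}"
  have DD0: "D \<subseteq> D0" by (auto simp: D_def)
  have "open D"
  proof -
    have "smooth_on D0 (k1 \<circ> \<phi>)"
      using cpd \<phi> by (simp add: canonical_principal_direction_def smooth_map_on_surface_def)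
    then have "open ((k1 \<circ> \<phi>) -` (- {0}) \<inter> D0)"
      using continuous_on_open_vimage[OF P0.open_D] smooth_on_continuous by blast
    moreover have "continuous_on D0 (\<lambda>u. n u $ 3)"
      using smooth_on_continuous[OF P0.smooth_n] by (intro continuous_intros)
    then have "open ((\<lambda>u. n u $ 3) -` {0<..} \<inter> D0)"
      using continuous_on_open_vimage[OF P0.open_D] open_greaterThan by blast
    moreover have "open {u \<in> D0. \<phi> u \<in> W}" by (rule surface_chart_open_preimage[OF \<phi> W(1)])
    ultimately have "open (((k1 \<circ> \<phi>) -` (- {0}) \<inter> D0) \<inter> ((\<lambda>u. n u $ 3) -` {0<..} \<inter> D0) \<inter> {u \<in> D0. \<phi> u \<in> W})"
      by (simp only: open_Int)
    moreover have "((k1 \<circ> \<phi>) -` (- {0}) \<inter> D0) \<inter> ((\<lambda>u. n u $ 3) -` {0<..} \<inter> D0) \<inter> {u \<in> D0. \<phi> u \<in> W} = D"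
      by (auto simp: D_def)
    ultimately show ?thesis by simp
  qed
  have u0D: "u0 \<in> D" using u0 p(2) e_pos W(2) by (simp add: D_def n_def)
  \<comment> \<open>Reversing the normal reverses the principal curvature, whence the factor
    \<open>e\<close>.\<close>
  interpret cpd_patch D X n "\<lambda>u. e * k1 (\<phi> u)"
  proof
    show "open D" by fact
    show "smooth_on D X" "smooth_on D n"
      using P0.smooth_X P0.smooth_n DD0 smooth_on_subset by blast+
    fix u assume u: "u \<in> D"
    then have u': "u \<in> D0" using DD0 by blast
    show "inj (Dv X u)" "mink (n u) (n u) = -1" "\<And>v. mink (n u) (Dv X u v) = 0"
      using P0.inj_DX P0.normal_unit P0.normal_orthogonal u' by blast+
    show "e * k1 (\<phi> u) \<noteq> 0" "0 < n u $ 3" using u e by (auto simp: D_def)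
    fix v assume v: "Dv X u v = axis1 + n u $ 1 *\<^sub>R n u"
    let ?T = "tangential_part N k (\<phi> u)"
    have inj: "L a = L b \<longleftrightarrow> a = b" for a b
      using mink_preserving_bij[OF L] by (simp add: bij_def inj_eq)
    have "L ?T = c *\<^sub>R Dv X u v"
      unfolding v n_def by (rule tangential_part_isometric[OF L e k])
    also have "\<dots> = L (Dv (x \<circ> \<phi>) u (c *\<^sub>R v))"
      unfolding iso(2)[OF u'] linear_scale[OF surface_chartD(7)[OF \<phi> u']] linear_scale[OF L(1)] ..
    finally have T: "?T = Dv (x \<circ> \<phi>) u (c *\<^sub>R v)" using inj by blast
    have "shape_operator M x N (\<phi> u) ?T = k1 (\<phi> u) *\<^sub>R ?T"
      using cpd surface_chartD(4)[OF \<phi> u'] by (simp add: canonical_principal_direction_def)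
    moreover have "shape_operator M x N (\<phi> u) ?T = - Dv (N \<circ> \<phi>) u (c *\<^sub>R v)"
      unfolding T by (rule shape_operator_chart[OF _ \<phi> u']) (use N in \<open>simp add: unit_normal_field_def\<close>)
    ultimately have "- Dv (N \<circ> \<phi>) u (c *\<^sub>R v) = k1 (\<phi> u) *\<^sub>R Dv (x \<circ> \<phi>) u (c *\<^sub>R v)"
      by (simp only: T)
    moreover have "linear (Dv (N \<circ> \<phi>) u)"
      using spacelike_patch.linear_Dn[OF unit_normal_field_patch[OF N \<phi>] u'] .
    ultimately have "c *\<^sub>R Dv (N \<circ> \<phi>) u v = c *\<^sub>R (- k1 (\<phi> u) *\<^sub>R Dv (x \<circ> \<phi>) u v)"
      unfolding linear_scale[OF surface_chartD(7)[OF \<phi> u']]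
      by (simp add: linear_scale mult.commute minus_equation_iff[of "c *\<^sub>R _"])
    then have "Dv (N \<circ> \<phi>) u v = - k1 (\<phi> u) *\<^sub>R Dv (x \<circ> \<phi>) u v"
      by (rule scaleR_left_imp_eq[OF c])
    then show "Dv n u v = - (e * k1 (\<phi> u)) *\<^sub>R Dv X u v"
      unfolding iso(2,3)[OF u'] by (simp add: linear_scale[OF L(1)] linear_neg[OF L(1)])
  qed
  have inj_iff: "inj (Dv n u) \<longleftrightarrow> gaussian_curvature M x N (\<phi> u) \<noteq> 0" if "u \<in> D" for u
  proof -
    have u': "u \<in> D0" using that DD0 by blast
    have lin: "linear (Dv (N \<circ> \<phi>) u)"
      using spacelike_patch.linear_Dn[OF unit_normal_field_patch[OF N \<phi>] u'] .
    have "e *\<^sub>R L z = 0 \<longleftrightarrow> z = 0" for z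
      using e mink_preserving_bij[OF L] linear_injective_0[OF L(1)] linear_0[OF L(1)] by (auto simp: bij_def)
    then have "inj (Dv n u) \<longleftrightarrow> inj (Dv (N \<circ> \<phi>) u)"
      unfolding linear_injective_0[OF linear_Dn[OF that]] linear_injective_0[OF lin] iso(3)[OF u'] by simp
    then show ?thesis using gaussian_curvature_eq_0_iff[OF N \<phi> u'] by simp
  qed
  have "\<exists>\<mu>. (\<forall>v. Dv turn u v = \<mu> * coframe2 u v) \<and> (inj (Dv n u) \<longleftrightarrow> \<mu> \<noteq> 0)" if "u \<in> D" for u
    by (rule Dv_turn[OF that]) blast
  then obtain m where m: "\<And>u v. u \<in> D \<Longrightarrow> Dv turn u v = m u * coframe2 u v"
    "\<And>u. u \<in> D \<Longrightarrow> inj (Dv n u) \<longleftrightarrow> m u \<noteq> 0" by metis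
  obtain E s where E: "open E" "u0 \<in> E" "E \<subseteq> D" and s: "smooth_on E s"
    "\<And>u v. u \<in> E \<Longrightarrow> Dv s u v = coframe1 u v"
    using arc_length[OF u0D] by metis
  have L\<phi>: "surface_chart M (L \<circ> x) D0 \<phi>"
    by (rule surface_chart_affine[OF L(1) _ _ \<phi>, of L 0])
      (use mink_preserving_bij[OF L] in \<open>auto simp: bij_def\<close>)
  have chart: "surface_chart M (L \<circ> x) (I \<times> J) (\<phi> \<circ> \<psi>)"
    if "open_interval I" "open_interval J" "smooth_on (I \<times> J) \<psi>" "\<psi> ` (I \<times> J) \<subseteq> B" "open (\<psi> ` (I \<times> J))"
      "\<forall>z\<in>I \<times> J. (s (\<psi> z), q (\<psi> z)) = z" "open B" "B \<subseteq> E" "smooth_on B q"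
    for I J B and \<psi> :: "real \<times> real \<Rightarrow> real \<times> real" and q :: "real \<times> real \<Rightarrow> real"
  proof (rule surface_chart_compose[OF L\<phi> _ that(3,4,5) _ smooth_on_Pair[OF that(7) _ that(9)] bspec[OF that(6)]])
    show "open (I \<times> J)" using that(1,2) by (simp add: open_interval_def open_Times)
    show "B \<subseteq> D0" using that(8) E(3) DD0 by blast
    show "smooth_on B s" using s(1) that(8) smooth_on_subset by blast
  qed
  show ?thesis
  proof (cases "gaussian_curvature M x N p = 0")
    case False
    have q: "smooth_on E turn" "\<And>u v. u \<in> E \<Longrightarrow> Dv turn u v = m u * coframe2 u v" "m u0 \<noteq> 0"
      using smooth_on_subset[OF smooth_turn E(3)] m E(3) False inj_iff[OF u0D] m(2)[OF u0D] u0(2) by auto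
    obtain I J \<psi> where \<psi>: "u0 \<in> \<psi> ` (I \<times> J)" "smooth_on (I \<times> J) \<psi>" "\<psi> ` (I \<times> J) \<subseteq> E" "open (\<psi> ` (I \<times> J))"
      "\<forall>z\<in>I \<times> J. (s (\<psi> z), turn (\<psi> z)) = z"
      and rect: "principal_rectangle I J (\<lambda>z. X (\<psi> z)) (\<lambda>z. angle (\<psi> z)) (\<lambda>z. turn (\<psi> z)) (s u0) (turn u0)"
      by (rule principal_coordinates[OF E s q]) (assumption | rule that)+
    interpret R: principal_rectangle I J "\<lambda>z. X (\<psi> z)" "\<lambda>z. angle (\<psi> z)" "\<lambda>z. turn (\<psi> z)" "s u0" "turn u0"
      by (rule rect)
    have \<tau>: "turn (\<psi> z) = snd z" if "z \<in> I \<times> J" for z using bspec[OF \<psi>(5) that] by (metis snd_conv)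
    obtain \<Psi> C A \<gamma>2 \<gamma>3 where form: "smooth_on J \<Psi>"
      "antiderivative_on I (\<lambda>s. cosh (angle (\<psi> (s, turn u0)))) C" "antiderivative_on I (\<lambda>s. sinh (angle (\<psi> (s, turn u0)))) A"
      "antiderivative_on J (\<lambda>\<tau>. \<Psi> \<tau> * cosh \<tau>) \<gamma>2" "antiderivative_on J (\<lambda>\<tau>. \<Psi> \<tau> * sinh \<tau>) \<gamma>3"
      "\<forall>s\<in>I. \<forall>t\<in>J. X (\<psi> (s, t)) = C s *\<^sub>R axis1 + A s *\<^sub>R vector [0, sinh t, cosh t]
        + vector [0, \<gamma>2 t, \<gamma>3 t]"
      by (rule R.type1_form[OF \<tau>]) (assumption | rule that)+
    have "surface_chart M (L \<circ> x) (I \<times> J) (\<phi> \<circ> \<psi>)"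
      by (rule chart[OF R.I R.J \<psi>(2,3,4,5) E(1) order_refl q(1)])
    moreover have "p \<in> (\<phi> \<circ> \<psi>) ` (I \<times> J)" using \<psi>(1) u0(2) by (auto simp: image_comp[symmetric])
    moreover have "\<forall>s\<in>I. \<forall>t\<in>J. L (x ((\<phi> \<circ> \<psi>) (s, t))) = C s *\<^sub>R axis1 + A s *\<^sub>R vector [0, sinh t, cosh t]
        + vector [0, \<gamma>2 t, \<gamma>3 t]" using form(6) by (simp add: X_def)
    ultimately have "congruent_type1_at M x L p"
      unfolding congruent_type1_at_def using R.I R.J R.smooth_profile R.deriv_profile form(1-5) by blast
    then show ?thesis ..
  next
    case True
    then have flatW: "flat_on M x N W" using W(3) by blast
    have turn0: "Dv turn u v = 0" if "u \<in> D" for u v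
    proof -
      have "gaussian_curvature M x N (\<phi> u) = 0" using flatW that by (simp add: flat_on_def D_def)
      then show ?thesis using inj_iff[OF that] m(2)[OF that] m(1)[OF that] by simp
    qed
    \<comment> \<open>A ball is connected, so dt = 0 makes \<open>turn\<close> constant on
      it.\<close>
    obtain r where r: "r > 0" "ball u0 r \<subseteq> E" using E(1,2) open_contains_ball by blast
    let ?B = "ball u0 r"
    have BD: "u \<in> D" if "u \<in> ?B" for u using that r(2) E(3) by blast
    have const: "turn u = turn u0" if "u \<in> ?B" for u
    proof (rule has_derivative_zero_unique_connected[of ?B turn])
      show "(turn has_derivative (\<lambda>v. 0)) (at y)" if "y \<in> ?B" for y
        using smooth_on_has_derivative[OF smooth_turn BD[OF that]] turn0[OF BD[OF that]]
        by (metis ext)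
    qed (use that r(1) in auto)
    \<comment> \<open>Here \<open>turn\<close> cannot be a coordinate. As e_2 is a fixed vector on
      the ball, \<beta> is the differential of <X, e_2>, which takes its place.\<close>
    let ?q = "\<lambda>u. mink (X u) (frame_second (turn u0))"
    have B: "open ?B" "u0 \<in> ?B" "?B \<subseteq> D" using r(1) BD by auto
    have sB: "smooth_on ?B s" "\<And>u v. u \<in> ?B \<Longrightarrow> Dv s u v = coframe1 u v"
      using smooth_on_subset[OF s(1) r(2)] s(2) r(2) by auto
    have q1: "smooth_on ?B ?q"
      by (intro smooth_on_mink smooth_on_const open_ball smooth_on_subset[OF smooth_X B(3)])
    have q2: "Dv ?q u v = 1 * coframe2 u v" if "u \<in> ?B" for u v
    proof -
      have "Dv ?q u v = mink (Dv X u v) (frame_second (turn u0))"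
        by (rule Dv_linear_compose[OF bounded_bilinear.bounded_linear_left[OF bounded_bilinear_mink]
              smooth_on_differentiable[OF smooth_X BD[OF that]]])
      then show ?thesis by (simp add: coframe2_def const[OF that])
    qed
    obtain I J \<psi> where \<psi>: "u0 \<in> \<psi> ` (I \<times> J)" "smooth_on (I \<times> J) \<psi>" "\<psi> ` (I \<times> J) \<subseteq> ?B" "open (\<psi> ` (I \<times> J))"
      "\<forall>z\<in>I \<times> J. (s (\<psi> z), ?q (\<psi> z)) = z"
      and rect: "principal_rectangle I J (\<lambda>z. X (\<psi> z)) (\<lambda>z. angle (\<psi> z)) (\<lambda>z. turn (\<psi> z)) (s u0) (?q u0)"
      by (rule principal_coordinates[OF B sB q1 q2 one_neq_zero]) (assumption | rule that)+
    interpret R: principal_rectangle I J "\<lambda>z. X (\<psi> z)" "\<lambda>z. angle (\<psi> z)" "\<lambda>z. turn (\<psi> z)" "s u0" "?q u0"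
      by (rule rect)
    have \<psi>B: "\<psi> z \<in> ?B" if "z \<in> I \<times> J" for z using \<psi>(3) that by blast
    have \<tau>: "turn (\<psi> z) = turn u0" if "z \<in> I \<times> J" for z by (rule const[OF \<psi>B[OF that]])
    have second: "?q (\<psi> z) = snd z" if "z \<in> I \<times> J" for z using bspec[OF \<psi>(5) that] by (metis snd_conv)
    obtain C A where form: "antiderivative_on I (\<lambda>s. cosh (angle (\<psi> (s, ?q u0)))) C"
      "antiderivative_on I (\<lambda>s. sinh (angle (\<psi> (s, ?q u0)))) A"
      "\<forall>s\<in>I. \<forall>t\<in>J. X (\<psi> (s, t)) = C s *\<^sub>R axis1
        + A s *\<^sub>R vector [0, sinh (turn u0), cosh (turn u0)] + vector [0, t * cosh (turn u0), t * sinh (turn u0)]"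
      by (rule R.type2_form[OF \<tau> second]) (assumption | rule that)+
    have "surface_chart M (L \<circ> x) (I \<times> J) (\<phi> \<circ> \<psi>)"
      by (rule chart[OF R.I R.J \<psi>(2,3,4,5) B(1) r(2) q1])
    moreover have "p \<in> (\<phi> \<circ> \<psi>) ` (I \<times> J)" using \<psi>(1) u0(2) by (auto simp: image_comp[symmetric])
    moreover have "\<forall>s\<in>I. \<forall>t\<in>J. L (x ((\<phi> \<circ> \<psi>) (s, t))) = C s *\<^sub>R axis1
        + A s *\<^sub>R vector [0, sinh (turn u0), cosh (turn u0)] + vector [0, t * cosh (turn u0), t * sinh (turn u0)]"
      using form(3) by (simp add: X_def)
    moreover have "flat_on M x N ((\<phi> \<circ> \<psi>) ` (I \<times> J))"
      unfolding flat_on_def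
    proof
      fix y assume "y \<in> (\<phi> \<circ> \<psi>) ` (I \<times> J)"
      then obtain z where "z \<in> I \<times> J" "y = \<phi> (\<psi> z)" by auto
      then have "y \<in> W" using BD[OF \<psi>B] by (simp add: D_def)
      then show "gaussian_curvature M x N y = 0" using flatW by (simp add: flat_on_def)
    qed
    ultimately have "congruent_type2_at M x N L p"
      unfolding congruent_type2_at_def using R.I R.J R.smooth_profile R.deriv_profile form(1,2) by blast
    then show ?thesis ..
  qed
qed

subsection \<open>From the normal forms to a canonical principal direction\<close>

text \<open>Common description of both normal forms, with \<open>\<tau>\<close> equal to t or to a
  constant. The normal \<open>n\<close> is an arbitrary unit normal of the patch, with no preferred
  time orientation.\<close>

locale normal_form_patch = spacelike_patch +
  fixes \<theta> \<tau> :: "real \<times> real \<Rightarrow> real" and \<theta>' \<tau>' :: "real \<times> real \<Rightarrow> real \<times> real \<Rightarrow> real"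
  assumes \<theta>: "u \<in> D \<Longrightarrow> (\<theta> has_derivative \<theta>' u) (at u)" and \<tau>: "u \<in> D \<Longrightarrow> (\<tau> has_derivative \<tau>' u) (at u)"
    and X_s: "u \<in> D \<Longrightarrow> Dv X u (1, 0) = frame_first (\<theta> u) (\<tau> u)"
    and X_t: "u \<in> D \<Longrightarrow> \<exists>b. Dv X u (0, 1) = b *\<^sub>R frame_second (\<tau> u)"
    and \<theta>_s: "u \<in> D \<Longrightarrow> \<theta>' u (1, 0) \<noteq> 0" and \<theta>_t: "u \<in> D \<Longrightarrow> \<theta>' u (0, 1) = 0"
    and \<tau>_s: "u \<in> D \<Longrightarrow> \<tau>' u (1, 0) = 0"
begin

lemma normal_orthogonal_first: "u \<in> D \<Longrightarrow> mink (n u) (frame_first (\<theta> u) (\<tau> u)) = 0"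
  using normal_orthogonal[of u "(1, 0)"] by (simp add: X_s)

lemma normal_orthogonal_second:
  assumes "u \<in> D"
  shows "mink (n u) (frame_second (\<tau> u)) = 0"
proof -
  obtain b where b: "Dv X u (0, 1) = b *\<^sub>R frame_second (\<tau> u)" using X_t[OF assms] by blast
  have "b \<noteq> 0"
  proof
    assume "b = 0"
    then have "Dv X u (0, 1) = 0" using b by simp
    from DX_eq_0[OF assms this] show False by (simp add: zero_prod_def)
  qed
  then show ?thesis using normal_orthogonal[OF assms, of "(0, 1)"] b by (simp add: mink_simps)
qed

lemma normal_multiple:
  assumes "u \<in> D"
  obtains g where "n u = g *\<^sub>R frame_normal (\<theta> u) (\<tau> u)" "g * g = 1"
proof -
  let ?g = "- mink (n u) (frame_normal (\<theta> u) (\<tau> u))"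
  have e: "n u = ?g *\<^sub>R frame_normal (\<theta> u) (\<tau> u)"
    using frame_expansion[of "n u" "\<theta> u" "\<tau> u"] normal_orthogonal_first[OF assms]
      normal_orthogonal_second[OF assms] by simp
  then have "mink (n u) (n u) = ?g * ?g * -1"
    by (metis mink_frame(1) bounded_bilinear.scaleR_left[OF bounded_bilinear_mink]
        bounded_bilinear.scaleR_right[OF bounded_bilinear_mink] mult.assoc real_scaleR_def)
  then have "?g * ?g = 1" using normal_unit[OF assms] by simp
  then show thesis using that e by blast
qed

text \<open>The sign \<open>g\<close> belongs to the single point \<open>u\<close>, so the identity
  for \<open>n u\<close> cannot be differentiated. Instead <n, e_1> = <n, e_2> = 0 is
  differentiated, which moves the derivative onto the frame; the component along the normal is 0
  because \<open>n\<close> has constant square.\<close>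

lemma Dn_normal_form:
  assumes "u \<in> D" and g: "n u = g *\<^sub>R frame_normal (\<theta> u) (\<tau> u)"
  shows "Dv n u v = (g * \<theta>' u v) *\<^sub>R frame_first (\<theta> u) (\<tau> u)
    + (g * cosh (\<theta> u) * \<tau>' u v) *\<^sub>R frame_second (\<tau> u)"
proof -
  have orth: "mink (Dv n u v) (W u) = - mink (n u) (W' v)"
    if "(W has_derivative W') (at u)" "\<And>y. y \<in> D \<Longrightarrow> mink (n y) (W y) = 0" for W W'
  proof -
    have "((\<lambda>y. 0) has_derivative (\<lambda>v. mink (n u) (W' v) + mink (Dv n u v) (W u))) (at u)"
      by (rule has_derivative_transform_within_open[OF has_derivative_mink[OF Dn[OF assms(1)] that(1)] open_D assms(1)])
        (simp add: that(2))
    from fun_cong[OF has_derivative_unique[OF this has_derivative_const], of v]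
    show ?thesis by simp
  qed
  note d = has_derivative_frame[OF \<theta>[OF assms(1)] \<tau>[OF assms(1)]]
  have 1: "mink (Dv n u v) (frame_first (\<theta> u) (\<tau> u)) = g * \<theta>' u v"
    by (subst orth[OF d(2)], erule normal_orthogonal_first) (simp add: g mink_simps mink_frame)
  have 2: "mink (Dv n u v) (frame_second (\<tau> u)) = g * cosh (\<theta> u) * \<tau>' u v"
    by (subst orth[OF d(3)], erule normal_orthogonal_second) (simp add: g mink_simps mink_frame)
  have g0: "g \<noteq> 0" using g normal_unit[OF assms(1)] by (auto simp: mink_simps)
  have 3: "mink (Dv n u v) (frame_normal (\<theta> u) (\<tau> u)) = 0"
    using Dn_tangent[OF assms(1), of v] g0 unfolding g mink_simps by simp
  show ?thesis
    using frame_expansion[of "Dv n u v" "\<theta> u" "\<tau> u"] unfolding 1 2 3 by simp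
qed

text \<open>The tangential part of \<open>axis1\<close> is cosh \<theta> e_1 = cosh \<theta> dX(1,
  0), and dn(1, 0) = g \<theta>_s e_1. So the principal curvature is - g \<theta>_s, nonzero since
  \<theta>_s \<noteq> 0.\<close>

lemma principal_direction:
  assumes "u \<in> D"
  obtains \<kappa> where "\<kappa> \<noteq> 0"
    "\<And>v. Dv X u v = axis1 + (n u $ 1) *\<^sub>R n u \<Longrightarrow> Dv n u v = - \<kappa> *\<^sub>R Dv X u v"
proof -
  obtain g where g: "n u = g *\<^sub>R frame_normal (\<theta> u) (\<tau> u)" "g * g = 1"
    using normal_multiple[OF assms] by blast
  have "g \<noteq> 0" using g(2) by auto
  show thesis
  proof
    show "- (g * \<theta>' u (1, 0)) \<noteq> 0" using \<open>g \<noteq> 0\<close> \<theta>_s[OF assms] by simp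
    fix v assume v: "Dv X u v = axis1 + (n u $ 1) *\<^sub>R n u"
    have "(n u $ 1) *\<^sub>R n u = (g * g * sinh (\<theta> u)) *\<^sub>R frame_normal (\<theta> u) (\<tau> u)"
      unfolding g(1) by (simp add: frame_normal_def mult.commute mult.left_commute)
    then have "Dv X u v = cosh (\<theta> u) *\<^sub>R frame_first (\<theta> u) (\<tau> u)"
      unfolding v g(2) by (simp add: axis1_frame)
    also have "\<dots> = Dv X u (cosh (\<theta> u) *\<^sub>R (1, 0))"
      unfolding linear_scale[OF linear_DX[OF assms]] X_s[OF assms] ..
    finally have v': "v = cosh (\<theta> u) *\<^sub>R (1, 0)" using inj_DX[OF assms] by (simp only: inj_eq)
    show "Dv n u v = - (- (g * \<theta>' u (1, 0))) *\<^sub>R Dv X u v"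
      unfolding v' linear_scale[OF linear_Dn[OF assms]] linear_scale[OF linear_DX[OF assms]]
      unfolding X_s[OF assms] Dn_normal_form[OF assms g(1)] \<tau>_s[OF assms]
      by (simp add: mult.commute)
  qed
qed

text \<open>In the frame, dn(v) has components g d\<theta>(v) and g cosh \<theta> d\<tau>(v), where
  \<theta> depends on s and \<tau> on t. For form (1), \<tau> = t, this shows K \<noteq> 0.\<close>

lemma inj_Dn_normal_form:
  assumes "u \<in> D" "\<tau>' u (0, 1) \<noteq> 0"
  shows "inj (Dv n u)"
  unfolding linear_injective_0[OF linear_Dn[OF assms(1)]]
proof (intro allI impI)
  fix v assume 0: "Dv n u v = 0"
  obtain g where g: "n u = g *\<^sub>R frame_normal (\<theta> u) (\<tau> u)" "g * g = 1"
    using normal_multiple[OF assms(1)] by blast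
  have g0: "g \<noteq> 0" using g(2) by auto
  have \<theta>v: "\<theta>' u v = fst v * \<theta>' u (1, 0)"
    using linear_plane[OF has_derivative_linear[OF \<theta>[OF assms(1)]], of v] \<theta>_t[OF assms(1)] by simp
  have \<tau>v: "\<tau>' u v = snd v * \<tau>' u (0, 1)"
    using linear_plane[OF has_derivative_linear[OF \<tau>[OF assms(1)]], of v] \<tau>_s[OF assms(1)] by simp
  have "mink (Dv n u v) (frame_first (\<theta> u) (\<tau> u)) = g * \<theta>' u v"
    "mink (Dv n u v) (frame_second (\<tau> u)) = g * cosh (\<theta> u) * \<tau>' u v"
    unfolding Dn_normal_form[OF assms(1) g(1)] mink_simps mink_commute[of "frame_second _" "frame_first _ _"] mink_frame
    by simp_all
  then have "g * \<theta>' u v = 0" "g * cosh (\<theta> u) * \<tau>' u v = 0" unfolding 0 mink_simps by simp_all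
  then show "v = 0" using g0 \<theta>_s[OF assms(1)] assms(2) by (simp add: \<theta>v \<tau>v prod_eq_iff)
qed

end

text \<open>One template for both forms: \<open>T\<close> is the identity or a constant, and
  \<open>G\<close> is the remaining curve in t, including any translation. The t-derivative of
  \<open>X\<close> is (A T' + \<beta>) times the second frame vector.\<close>

lemma normal_form_patchI:
  fixes X n :: "real \<times> real \<Rightarrow> real^3" and T T' :: "real \<Rightarrow> real" and C A \<theta> :: "real \<Rightarrow> real" and \<beta> :: "real \<Rightarrow> real"
  assumes P: "spacelike_patch (I \<times> J) X n" and \<theta>: "smooth_on I \<theta>" "\<forall>s\<in>I. deriv \<theta> s \<noteq> 0"
    and C: "antiderivative_on I (\<lambda>s. cosh (\<theta> s)) C" and A: "antiderivative_on I (\<lambda>s. sinh (\<theta> s)) A"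
    and T: "\<And>t. t \<in> J \<Longrightarrow> (T has_real_derivative T' t) (at t)"
    and G: "\<And>t. t \<in> J \<Longrightarrow> (G has_vector_derivative \<beta> t *\<^sub>R frame_second (T t)) (at t)"
    and IJ: "open I" "open J"
    and X: "\<And>s t. s \<in> I \<Longrightarrow> t \<in> J \<Longrightarrow> X (s, t) = C s *\<^sub>R axis1 + A s *\<^sub>R frame_axial (T t) + G t"
  shows "normal_form_patch (I \<times> J) X n (\<lambda>z. \<theta> (fst z)) (\<lambda>z. T (snd z))
    (\<lambda>u v. deriv \<theta> (fst u) * fst v) (\<lambda>u v. T' (snd u) * snd v)"
proof -
  interpret spacelike_patch "I \<times> J" X n by (rule P)
  show ?thesis
  proof
    fix u :: "real \<times> real" assume u: "u \<in> I \<times> J"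
    obtain s t where st: "u = (s, t)" "s \<in> I" "t \<in> J" using u by auto
    have d\<theta>: "(\<theta> has_real_derivative deriv \<theta> s) (at s)"
      using smooth_on_differentiable[OF \<theta>(1) st(2)] real_differentiableE DERIV_deriv_iff_real_differentiable by blast
    have fs: "(fst has_derivative fst) (at u)" "(snd has_derivative snd) (at u)"
      by (auto intro: bounded_linear_imp_has_derivative bounded_linear_fst bounded_linear_snd)
    show "((\<lambda>z. \<theta> (fst z)) has_derivative (\<lambda>v. deriv \<theta> (fst u) * fst v)) (at u)"
      using has_derivative_compose[OF fs(1), of \<theta>] d\<theta> by (simp add: st(1) has_field_derivative_def)
    show "((\<lambda>z. T (snd z)) has_derivative (\<lambda>v. T' (snd u) * snd v)) (at u)"
      using has_derivative_compose[OF fs(2), of T] T[OF st(3)] by (simp add: st(1) has_field_derivative_def)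
    show "deriv \<theta> (fst u) * fst (1, 0) \<noteq> 0" using \<theta>(2) st by simp
    show "deriv \<theta> (fst u) * fst (0, 1) = 0" "T' (snd u) * snd (1, 0) = 0" by simp_all
    note p = has_derivative_partial[OF DX[OF u, unfolded st(1)]]
    have dC: "(C has_vector_derivative cosh (\<theta> s)) (at s)" and dA: "(A has_vector_derivative sinh (\<theta> s)) (at s)"
      using C A st(2) by (auto simp: antiderivative_on_def has_real_derivative_iff_has_vector_derivative)
    have "((\<lambda>s. C s *\<^sub>R axis1 + A s *\<^sub>R frame_axial (T t) + G t) has_vector_derivative
        cosh (\<theta> s) *\<^sub>R axis1 + sinh (\<theta> s) *\<^sub>R frame_axial (T t) + 0) (at s)"
      by (intro has_vector_derivative_add has_vector_derivative_const dC dA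
          bounded_linear.has_vector_derivative[OF bounded_linear_scaleR_left])
    then have "((\<lambda>s. X (s, t)) has_vector_derivative frame_first (\<theta> s) (T t)) (at s)"
      unfolding frame_first_axial
      by (simp add: has_vector_derivative_transform_within_open[OF _ IJ(1) st(2)] X st(3))
    from vector_derivative_unique_at[OF p(1) this]
    show "Dv X u (1, 0) = frame_first (\<theta> (fst u)) (T (snd u))" by (simp add: st(1))
    have "((\<lambda>t. frame_axial (T t)) has_vector_derivative T' t *\<^sub>R frame_second (T t)) (at t)"
    proof -
      have dT: "(T has_derivative (\<lambda>h. T' t * h)) (at t)"
        using T[OF st(3)] by (simp add: has_field_derivative_def)
      from has_derivative_frame(4)[OF dT dT] show ?thesis
        by (simp add: has_vector_derivative_def mult.commute)
    qed
    from bounded_linear.has_vector_derivative[OF bounded_linear_scaleR_right[of "A s"] this]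
    have "((\<lambda>t. C s *\<^sub>R axis1 + A s *\<^sub>R frame_axial (T t) + G t) has_vector_derivative
        0 + A s *\<^sub>R (T' t *\<^sub>R frame_second (T t)) + \<beta> t *\<^sub>R frame_second (T t)) (at t)"
      by (intro has_vector_derivative_add has_vector_derivative_const G st(3))
    then have "((\<lambda>t. X (s, t)) has_vector_derivative (A s * T' t + \<beta> t) *\<^sub>R frame_second (T t)) (at t)"
      by (simp add: has_vector_derivative_transform_within_open[OF _ IJ(2) st(3)] X st(2) scaleR_add_left)
    from vector_derivative_unique_at[OF p(2) this]
    show "\<exists>b. Dv X u (0, 1) = b *\<^sub>R frame_second (T (snd u))" by (auto simp: st(1))
  qed
qed

lemma tangential_part_tangent:
  assumes "unit_normal_field M x N" "p \<in> topspace M"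
  shows "mink (tangential_part N k p) (N p) = 0"
    "mink (tangential_part N k p) (tangential_part N k p) = mink k k + (mink k (N p))\<^sup>2"
proof -
  have N: "mink (N p) (N p) = -1" using assms by (simp add: unit_normal_field_def)
  show "mink (tangential_part N k p) (N p) = 0"
    unfolding tangential_part_def mink_simps N by simp
  show "mink (tangential_part N k p) (tangential_part N k p) = mink k k + (mink k (N p))\<^sup>2"
    unfolding tangential_part_def mink_simps N mink_commute[of "N p" k] by (simp add: power2_eq_square algebra_simps)
qed

lemma (in normal_form_patch) shape_tangential_part:
  fixes L :: "real^3 \<Rightarrow> real^3"
  assumes L: "linear L" "\<And>v w. mink (L v) (L w) = mink v w" and N: "unit_normal_field M x N"
    and \<phi>: "surface_chart M x D \<phi>" and k: "L k = axis1" and u: "u \<in> D"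
    and X: "\<And>u v. u \<in> D \<Longrightarrow> Dv X u v = L (Dv (x \<circ> \<phi>) u v)"
    and n: "\<And>u. n u = L (N (\<phi> u))" "\<And>u v. u \<in> D \<Longrightarrow> Dv n u v = L (Dv (N \<circ> \<phi>) u v)"
  obtains \<kappa> where "\<kappa> \<noteq> 0"
    "shape_operator M x N (\<phi> u) (tangential_part N k (\<phi> u)) = \<kappa> *\<^sub>R tangential_part N k (\<phi> u)"
proof -
  interpret P: spacelike_patch D "x \<circ> \<phi>" "N \<circ> \<phi>" by (rule unit_normal_field_patch[OF N \<phi>])
  obtain \<kappa> where \<kappa>: "\<kappa> \<noteq> 0" "\<And>v. Dv X u v = axis1 + (n u $ 1) *\<^sub>R n u \<Longrightarrow> Dv n u v = - \<kappa> *\<^sub>R Dv X u v"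
    using principal_direction[OF u] by blast
  let ?T = "tangential_part N k (\<phi> u)"
  have "mink ?T ((N \<circ> \<phi>) u) = 0"
    using tangential_part_tangent(1)[OF N surface_chartD(4)[OF \<phi> u]] by simp
  from P.tangent_vectorE[OF u this] obtain v where v: "?T = Dv (x \<circ> \<phi>) u v" .
  have "L ?T = axis1 + (n u $ 1) *\<^sub>R n u"
    using tangential_part_isometric[OF L, of 1 k 1 N "\<phi> u"] k by (simp add: n(1))
  then have "Dv X u v = axis1 + (n u $ 1) *\<^sub>R n u" by (simp add: X[OF u] v[symmetric])
  from \<kappa>(2)[OF this] have "L (Dv (N \<circ> \<phi>) u v) = L (- \<kappa> *\<^sub>R Dv (x \<circ> \<phi>) u v)"
    unfolding X[OF u] n(2)[OF u] linear_scale[OF L(1)] .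
  then have "Dv (N \<circ> \<phi>) u v = - \<kappa> *\<^sub>R Dv (x \<circ> \<phi>) u v"
    using mink_preserving_bij[OF L] by (simp only: bij_def inj_eq)
  moreover have "shape_operator M x N (\<phi> u) ?T = - Dv (N \<circ> \<phi>) u v"
    unfolding v by (rule shape_operator_chart[OF _ \<phi> u]) (use N in \<open>simp add: unit_normal_field_def\<close>)
  ultimately have "shape_operator M x N (\<phi> u) ?T = \<kappa> *\<^sub>R ?T" using v by simp
  then show thesis using that \<kappa>(1) by blast
qed

text \<open>Each form is brought into the template with \<open>L\<close> in place of
  \<open>F\<close>. Form (1) has K \<noteq> 0 by injectivity of dN, and form (2) is flat by
  definition, so \<open>flat_or_nonflat_at\<close> holds in both cases.\<close>

lemma normal_form_cpd:
  fixes x N :: "'a \<Rightarrow> real^3" and L :: "real^3 \<Rightarrow> real^3"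
  assumes N: "unit_normal_field M x N"
    and L: "linear L" "\<And>v w. mink (L v) (L w) = mink v w" "\<And>q. F q = a + L q" and k: "L k = axis1"
    and p: "congruent_type1_at M x F p \<or> congruent_type2_at M x N F p"
  shows "p \<in> topspace M \<and> flat_or_nonflat_at M x N p \<and> (\<exists>\<kappa>. \<kappa> \<noteq> 0 \<and>
    shape_operator M x N p (tangential_part N k p) = \<kappa> *\<^sub>R tangential_part N k p)"
  using p
proof
  assume "congruent_type1_at M x F p"
  then obtain I J \<phi> \<theta> \<Psi> C A \<gamma>2 \<gamma>3 where IJ: "open_interval I" "open_interval J"
    and F\<phi>: "surface_chart M (F \<circ> x) (I \<times> J) \<phi>" and p: "p \<in> \<phi> ` (I \<times> J)"
    and \<theta>: "smooth_on I \<theta>" "\<forall>s\<in>I. deriv \<theta> s \<noteq> 0"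
    and C: "antiderivative_on I (\<lambda>\<tau>. cosh (\<theta> \<tau>)) C" and A: "antiderivative_on I (\<lambda>\<tau>. sinh (\<theta> \<tau>)) A"
    and \<gamma>2: "antiderivative_on J (\<lambda>\<tau>. \<Psi> \<tau> * cosh \<tau>) \<gamma>2"
    and \<gamma>3: "antiderivative_on J (\<lambda>\<tau>. \<Psi> \<tau> * sinh \<tau>) \<gamma>3"
    and form: "\<forall>s\<in>I. \<forall>t\<in>J. F (x (\<phi> (s, t))) = C s *\<^sub>R axis1 + A s *\<^sub>R vector [0, sinh t, cosh t]
           + vector [0, \<gamma>2 t, \<gamma>3 t]"
    unfolding congruent_type1_at_def by blast
  have oIJ: "open I" "open J" using IJ by (auto simp: open_interval_def)
  have \<phi>: "surface_chart M x (I \<times> J) \<phi>" using F\<phi> surface_chart_affine_iff[OF L] by blast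
  note iso = isometric_patch[OF L(1,2) _ N \<phi>, of 1, simplified]
  interpret normal_form_patch "I \<times> J" "\<lambda>u. L (x (\<phi> u))" "\<lambda>u. L (N (\<phi> u))" "\<lambda>z. \<theta> (fst z)" "\<lambda>z. snd z"
    "\<lambda>u v. deriv \<theta> (fst u) * fst v" "\<lambda>u v. 1 * snd v"
  proof (rule normal_form_patchI[OF iso(1) \<theta> C A _ _ oIJ])
    show "((\<lambda>t. t) has_real_derivative 1) (at t)" for t :: real by (rule DERIV_ident)
    \<comment> \<open>The translation \<open>a\<close> of the isometry is absorbed into the
      curve.\<close>
    show "((\<lambda>t. vector [0, \<gamma>2 t, \<gamma>3 t] - a) has_vector_derivative \<Psi> t *\<^sub>R frame_second t) (at t)" if "t \<in> J" for t
    proof -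
      have "(\<gamma>2 has_derivative (\<lambda>h. \<Psi> t * cosh t * h)) (at t)" "(\<gamma>3 has_derivative (\<lambda>h. \<Psi> t * sinh t * h)) (at t)"
        using \<gamma>2 \<gamma>3 that by (auto simp: antiderivative_on_def has_field_derivative_def)
      from has_derivative_vector_3[OF has_derivative_const this]
      have "((\<lambda>t. vector [0, \<gamma>2 t, \<gamma>3 t] :: real^3) has_vector_derivative \<Psi> t *\<^sub>R frame_second t) (at t)"
        unfolding has_vector_derivative_def
        by (rule has_derivative_eq_rhs) (auto simp: vec_eq_iff forall_3 frame_second_def)
      from has_vector_derivative_diff[OF this has_vector_derivative_const, of a] show ?thesis by simp
    qed
    show "L (x (\<phi> (s, t))) = C s *\<^sub>R axis1 + A s *\<^sub>R frame_axial t + (vector [0, \<gamma>2 t, \<gamma>3 t] - a)"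
      if "s \<in> I" "t \<in> J" for s t
    proof -
      have "a + L (x (\<phi> (s, t))) = C s *\<^sub>R axis1 + A s *\<^sub>R frame_axial t + vector [0, \<gamma>2 t, \<gamma>3 t]"
        using form that unfolding L(3) frame_axial_def by blast
      then show ?thesis by (simp add: algebra_simps)
    qed
  qed
  obtain u where u: "u \<in> I \<times> J" "p = \<phi> u" using p by blast
  have "inj (Dv (N \<circ> \<phi>) u)"
  proof -
    have "Dv (\<lambda>u. L (N (\<phi> u))) u = L \<circ> Dv (N \<circ> \<phi>) u" using iso(3)[OF u(1)] by (intro ext) simp
    moreover have "inj (Dv (\<lambda>u. L (N (\<phi> u))) u)" by (rule inj_Dn_normal_form[OF u(1)]) simp
    ultimately show ?thesis using inj_on_imageI2 by metis
  qed
  then have "flat_or_nonflat_at M x N p"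
    using gaussian_curvature_eq_0_iff[OF N \<phi> u(1)] u(2) by (simp add: flat_or_nonflat_at_def)
  moreover obtain \<kappa> where "\<kappa> \<noteq> 0"
    "shape_operator M x N (\<phi> u) (tangential_part N k (\<phi> u)) = \<kappa> *\<^sub>R tangential_part N k (\<phi> u)"
    by (rule shape_tangential_part[OF L(1,2) N \<phi> k u(1) iso(2) refl iso(3)])
  ultimately show ?thesis using u(2) surface_chartD(4)[OF \<phi> u(1)] by blast
next
  assume "congruent_type2_at M x N F p"
  then obtain I J \<phi> \<theta> t0 C A where IJ: "open_interval I" "open_interval J"
    and F\<phi>: "surface_chart M (F \<circ> x) (I \<times> J) \<phi>" and p: "p \<in> \<phi> ` (I \<times> J)"
    and flat: "flat_on M x N (\<phi> ` (I \<times> J))"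
    and \<theta>: "smooth_on I \<theta>" "\<forall>s\<in>I. deriv \<theta> s \<noteq> 0"
    and C: "antiderivative_on I (\<lambda>\<tau>. cosh (\<theta> \<tau>)) C" and A: "antiderivative_on I (\<lambda>\<tau>. sinh (\<theta> \<tau>)) A"
    and form: "\<forall>s\<in>I. \<forall>t\<in>J. F (x (\<phi> (s, t))) = C s *\<^sub>R axis1 + A s *\<^sub>R vector [0, sinh t0, cosh t0]
           + vector [0, t * cosh t0, t * sinh t0]"
    unfolding congruent_type2_at_def by blast
  have oIJ: "open I" "open J" using IJ by (auto simp: open_interval_def)
  have \<phi>: "surface_chart M x (I \<times> J) \<phi>" using F\<phi> surface_chart_affine_iff[OF L] by blast
  note iso = isometric_patch[OF L(1,2) _ N \<phi>, of 1, simplified]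
  interpret normal_form_patch "I \<times> J" "\<lambda>u. L (x (\<phi> u))" "\<lambda>u. L (N (\<phi> u))" "\<lambda>z. \<theta> (fst z)" "\<lambda>z. t0"
    "\<lambda>u v. deriv \<theta> (fst u) * fst v" "\<lambda>u v. 0 * snd v"
  proof (rule normal_form_patchI[OF iso(1) \<theta> C A _ _ oIJ])
    show "((\<lambda>t. t0) has_real_derivative 0) (at t)" for t :: real by (rule DERIV_const)
    show "((\<lambda>t. t *\<^sub>R frame_second t0 - a) has_vector_derivative 1 *\<^sub>R frame_second t0) (at t)" for t
    proof -
      have "((\<lambda>t. t *\<^sub>R frame_second t0) has_vector_derivative 1 *\<^sub>R frame_second t0) (at t)"
        by (rule bounded_linear.has_vector_derivative[OF bounded_linear_scaleR_left has_vector_derivative_id])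
      from has_vector_derivative_diff[OF this has_vector_derivative_const, of a] show ?thesis by simp
    qed
    show "L (x (\<phi> (s, t))) = C s *\<^sub>R axis1 + A s *\<^sub>R frame_axial t0 + (t *\<^sub>R frame_second t0 - a)"
      if "s \<in> I" "t \<in> J" for s t
    proof -
      have "t *\<^sub>R frame_second t0 = vector [0, t * cosh t0, t * sinh t0]"
        by (simp add: vec_eq_iff forall_3 frame_second_def)
      then have "a + L (x (\<phi> (s, t))) = C s *\<^sub>R axis1 + A s *\<^sub>R frame_axial t0 + t *\<^sub>R frame_second t0"
        using form that unfolding L(3) frame_axial_def by simp
      then show ?thesis by (simp add: algebra_simps)
    qed
  qed
  obtain u where u: "u \<in> I \<times> J" "p = \<phi> u" using p by blast
  have "openin M (\<phi> ` (I \<times> J))" using \<phi> by (simp add: surface_chart_def)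
  then have "flat_or_nonflat_at M x N p" using flat p by (auto simp: flat_or_nonflat_at_def)
  moreover obtain \<kappa> where "\<kappa> \<noteq> 0"
    "shape_operator M x N (\<phi> u) (tangential_part N k (\<phi> u)) = \<kappa> *\<^sub>R tangential_part N k (\<phi> u)"
    by (rule shape_tangential_part[OF L(1,2) N \<phi> k u(1) iso(2) refl iso(3)])
  ultimately show ?thesis using u(2) surface_chartD(4)[OF \<phi> u(1)] by blast
qed

section \<open>Smoothness of the shape operator, and density\<close>

lemma (in spacelike_patch) tangent_coordinates:
  assumes "u \<in> D" "mink z (n u) = 0"
  defines "a \<equiv> mink (Dv X u (1, 0)) (Dv X u (1, 0))" and "b \<equiv> mink (Dv X u (1, 0)) (Dv X u (0, 1))"
    and "c \<equiv> mink (Dv X u (0, 1)) (Dv X u (0, 1))"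
  shows "z = Dv X u (inverse (a * c - b\<^sup>2) * (c * mink z (Dv X u (1, 0)) - b * mink z (Dv X u (0, 1))),
      inverse (a * c - b\<^sup>2) * (a * mink z (Dv X u (0, 1)) - b * mink z (Dv X u (1, 0))))"
proof -
  obtain v where v: "z = Dv X u v" using tangent_vectorE[OF assms(1,2)] .
  have d: "a * c - b\<^sup>2 > 0" unfolding a_def b_def c_def by (rule gram_positive[OF assms(1)])
  have 1: "mink z (Dv X u (1, 0)) = fst v * a + snd v * b" "mink z (Dv X u (0, 1)) = fst v * b + snd v * c"
    unfolding v first_form_expand[OF assms(1), of v] a_def b_def c_def by simp_all
  \<comment> \<open>Cramer's rule for the Gram matrix, whose determinant is positive.\<close>
  have "c * mink z (Dv X u (1, 0)) - b * mink z (Dv X u (0, 1)) = (a * c - b\<^sup>2) * fst v"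
    "a * mink z (Dv X u (0, 1)) - b * mink z (Dv X u (1, 0)) = (a * c - b\<^sup>2) * snd v"
    unfolding 1 by (simp_all add: algebra_simps power2_eq_square)
  then show ?thesis using d v by (simp add: mult.assoc[symmetric])
qed

lemma smooth_tangential_part:
  assumes N: "unit_normal_field M x N" and \<phi>: "surface_chart M x D \<phi>"
  shows "smooth_on D (\<lambda>u. tangential_part N k (\<phi> u))"
proof -
  interpret spacelike_patch D "x \<circ> \<phi>" "N \<circ> \<phi>" by (rule unit_normal_field_patch[OF N \<phi>])
  have "smooth_on D (\<lambda>u. N (\<phi> u))" using smooth_n by (simp add: comp_def)
  then show ?thesis unfolding tangential_part_def
    by (intro smooth_on_add smooth_on_const smooth_on_scaleR smooth_on_mink open_D)
qed

text \<open>The coordinates \<open>r\<close> and \<open>q\<close> of the tangential part are smooth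
  by Cramer's rule, and the shape operator sends the corresponding tangent vector to the same
  combination of derivatives of \<open>N\<close>, with opposite sign.\<close>

lemma smooth_shape_tangential_part:
  assumes N: "unit_normal_field M x N" and \<phi>: "surface_chart M x D \<phi>"
  shows "smooth_on D (\<lambda>u. shape_operator M x N (\<phi> u) (tangential_part N k (\<phi> u)))"
proof -
  interpret spacelike_patch D "x \<circ> \<phi>" "N \<circ> \<phi>" by (rule unit_normal_field_patch[OF N \<phi>])
  let ?T = "\<lambda>u. tangential_part N k (\<phi> u)"
  let ?X1 = "\<lambda>u. Dv (x \<circ> \<phi>) u (1, 0)" and ?X2 = "\<lambda>u. Dv (x \<circ> \<phi>) u (0, 1)"
  define a where "a u = mink (?X1 u) (?X1 u)" for u
  define b where "b u = mink (?X1 u) (?X2 u)" for u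
  define c where "c u = mink (?X2 u) (?X2 u)" for u
  define r where "r u = inverse (a u * c u - b u * b u) * (c u * mink (?T u) (?X1 u) - b u * mink (?T u) (?X2 u))" for u
  define q where "q u = inverse (a u * c u - b u * b u) * (a u * mink (?T u) (?X2 u) - b u * mink (?T u) (?X1 u))" for u
  have sX: "smooth_on D ?X1" "smooth_on D ?X2" "smooth_on D (\<lambda>u. Dv (N \<circ> \<phi>) u (1, 0))" "smooth_on D (\<lambda>u. Dv (N \<circ> \<phi>) u (0, 1))"
    by (intro smooth_on_Dv smooth_X smooth_n)+
  have sT: "smooth_on D ?T" by (rule smooth_tangential_part[OF N \<phi>])
  have sabc: "smooth_on D a" "smooth_on D b" "smooth_on D c"
    unfolding a_def[abs_def] b_def[abs_def] c_def[abs_def] by (intro smooth_on_mink sX open_D)+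
  have nz: "a u * c u - b u * b u \<noteq> 0" if "u \<in> D" for u
    using gram_positive[OF that] by (simp add: a_def b_def c_def power2_eq_square)
  have sr: "smooth_on D r" "smooth_on D q"
    unfolding r_def[abs_def] q_def[abs_def]
    by (intro smooth_on_mult smooth_on_diff smooth_on_inverse smooth_on_mink sX sT sabc open_D nz; assumption)+
  have "- (r u *\<^sub>R Dv (N \<circ> \<phi>) u (1, 0) + q u *\<^sub>R Dv (N \<circ> \<phi>) u (0, 1)) = shape_operator M x N (\<phi> u) (?T u)"
    if u: "u \<in> D" for u
  proof -
    have T: "?T u = Dv (x \<circ> \<phi>) u (r u, q u)"
      using tangent_coordinates[OF u, of "?T u"] tangential_part_tangent(1)[OF N surface_chartD(4)[OF \<phi> u]]
      by (simp add: r_def q_def a_def b_def c_def power2_eq_square)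
    have "shape_operator M x N (\<phi> u) (?T u) = - Dv (N \<circ> \<phi>) u (r u, q u)"
      unfolding T by (rule shape_operator_chart[OF _ \<phi> u]) (use N in \<open>simp add: unit_normal_field_def\<close>)
    then show ?thesis using linear_plane[OF linear_Dn[OF u], of "(r u, q u)"] by simp
  qed
  then show ?thesis
    by (rule smooth_on_cong[OF open_D])
      (assumption | intro smooth_on_uminus smooth_on_add smooth_on_scaleR sr sX open_D)+
qed

text \<open>Within a chart the set where \<open>f\<close> is nonzero is open, and charts map it to
  an open set of the surface; were it nonempty, it would meet the dense set. Used to extend the
  eigenvalue equation.\<close>

lemma dense_in_surface_closed:
  assumes imm: "immersed_surface M x" and dense: "dense_in_surface M P"
    and P: "\<And>p. p \<in> topspace M \<Longrightarrow> P p \<Longrightarrow> f p = (0 :: real^3)"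
    and f: "\<And>D \<phi>. surface_chart M x D \<phi> \<Longrightarrow> continuous_on D (\<lambda>u. f (\<phi> u))"
    and p: "p \<in> topspace M"
  shows "f p = 0"
proof (rule ccontr)
  assume fp: "f p \<noteq> 0"
  obtain D \<phi> u where \<phi>: "surface_chart M x D \<phi>" "u \<in> D" "p = \<phi> u"
    using imm p unfolding immersed_surface_def by blast
  let ?U = "(\<lambda>u. f (\<phi> u)) -` (- {0}) \<inter> D"
  have "open ?U"
    using continuous_on_open_vimage[OF surface_chartD(1)[OF \<phi>(1)]] f[OF \<phi>(1)] by blast
  then have "openin M (\<phi> ` ?U)" by (rule surface_chart_open_image[OF \<phi>(1)]) simp
  moreover have "p \<in> \<phi> ` ?U" using \<phi> fp by auto
  moreover have "p \<in> M closure_of {p \<in> topspace M. P p}"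
    using dense p by (simp add: dense_in_surface_def)
  then have "\<forall>W. p \<in> W \<and> openin M W \<longrightarrow> (\<exists>y. y \<in> {p \<in> topspace M. P p} \<and> y \<in> W)"
    unfolding in_closure_of by (rule conjunct2)
  ultimately obtain y where y: "y \<in> {p \<in> topspace M. P p}" "y \<in> \<phi> ` ?U" by meson
  from y(2) obtain w where "y = \<phi> w" "w \<in> ?U" by (rule imageE)
  then show False using P[of y] y(1) by simp
qed

lemma normal_forms_imp_cpd:
  fixes x N :: "'a \<Rightarrow> real^3"
  assumes imm: "immersed_surface M x" and N: "unit_normal_field M x N" and F: "mink_isometry F"
    and dense: "dense_in_surface M (\<lambda>p. congruent_type1_at M x F p \<or> congruent_type2_at M x N F p)"
  obtains k k1 where "spacelike k" "canonical_principal_direction M x N k k1"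
    "\<And>p. congruent_type1_at M x F p \<or> congruent_type2_at M x N F p
      \<Longrightarrow> k1 p \<noteq> 0 \<and> flat_or_nonflat_at M x N p"
proof -
  obtain L where L: "linear L" "\<And>v w. mink (L v) (L w) = mink v w" "\<And>q. F q = F 0 + L q"
    using mink_isometry_affine[OF F] by blast
  \<comment> \<open>This direction depends on \<open>F\<close> alone, so it is the same for all
    points of the surface.\<close>
  obtain k where k: "L k = axis1"
    using mink_preserving_bij[OF L(1,2)] by (metis bij_pointE)
  have kk: "mink k k = 1" using L(2)[of k k] by (simp add: k mink_axis1)
  define T where "T p = tangential_part N k p" for p
  define S where "S p = shape_operator M x N p (T p)" for p
  define k1 where "k1 p = mink (S p) (T p) * inverse (mink (T p) (T p))" for p
  have TT: "mink (T p) (T p) > 0" if "p \<in> topspace M" for p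
    using tangential_part_tangent(2)[OF N that, of k] kk by (simp add: T_def add_pos_nonneg)
  have at: "p \<in> topspace M \<and> flat_or_nonflat_at M x N p \<and> k1 p \<noteq> 0 \<and> S p = k1 p *\<^sub>R T p"
    if type: "congruent_type1_at M x F p \<or> congruent_type2_at M x N F p" for p
  proof -
    obtain \<kappa> where *: "p \<in> topspace M" "flat_or_nonflat_at M x N p" "\<kappa> \<noteq> 0" "S p = \<kappa> *\<^sub>R T p"
      using normal_form_cpd[OF N L k type] unfolding S_def T_def by blast
    have "k1 p = \<kappa>" unfolding k1_def *(4) mink_simps using TT[OF *(1)] by simp
    then show ?thesis using * by simp
  qed
  have sT: "smooth_on D (\<lambda>u. T (\<phi> u))" and sS: "smooth_on D (\<lambda>u. S (\<phi> u))" and sk: "smooth_on D (\<lambda>u. k1 (\<phi> u))"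
    if \<phi>: "surface_chart M x D \<phi>" for D \<phi>
  proof -
    note D = surface_chartD(1)[OF \<phi>]
    show sT: "smooth_on D (\<lambda>u. T (\<phi> u))" unfolding T_def by (rule smooth_tangential_part[OF N \<phi>])
    show sS: "smooth_on D (\<lambda>u. S (\<phi> u))" unfolding S_def T_def by (rule smooth_shape_tangential_part[OF N \<phi>])
    have nz: "mink (T (\<phi> u)) (T (\<phi> u)) \<noteq> 0" if "u \<in> D" for u
      using TT[OF surface_chartD(4)[OF \<phi> that]] by simp
    show "smooth_on D (\<lambda>u. k1 (\<phi> u))" unfolding k1_def
      by (intro smooth_on_mult smooth_on_mink smooth_on_inverse sT sS D nz)
  qed
  have "S p - k1 p *\<^sub>R T p = 0" if "p \<in> topspace M" for p
  proof (rule dense_in_surface_closed[OF imm dense _ _ that])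
    show "S p - k1 p *\<^sub>R T p = 0" if "congruent_type1_at M x F p \<or> congruent_type2_at M x N F p" for p
      using at[OF that] by simp
    show "continuous_on D (\<lambda>u. S (\<phi> u) - k1 (\<phi> u) *\<^sub>R T (\<phi> u))" if "surface_chart M x D \<phi>" for D \<phi>
      by (intro continuous_on_diff continuous_on_scaleR smooth_on_continuous sT sS sk that)
  qed
  then have "canonical_principal_direction M x N k k1"
    unfolding canonical_principal_direction_def smooth_map_on_surface_def
    using sk by (auto simp: S_def T_def comp_def)
  moreover have "spacelike k" using kk by (simp add: spacelike_def)
  ultimately show thesis using that at by blast
qed

text \<open>The isometry is built from \<open>k\<close> alone; therefore it can be chosen before the
  point \<open>p\<close>.\<close>

lemma cpd_imp_normal_forms:
  fixes x N :: "'a \<Rightarrow> real^3"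
  assumes imm: "immersed_surface M x" and N: "unit_normal_field M x N"
    and k: "spacelike k" and cpd: "canonical_principal_direction M x N k k1"
  obtains F where "mink_isometry F"
    "\<And>p. p \<in> topspace M \<Longrightarrow> k1 p \<noteq> 0 \<Longrightarrow> flat_or_nonflat_at M x N p
      \<Longrightarrow> congruent_type1_at M x F p \<or> congruent_type2_at M x N F p"
proof -
  obtain F where F: "mink_isometry F" "linear F" "\<And>v w. mink (F v) (F w) = mink v w"
    "F k = sqrt (mink k k) *\<^sub>R axis1"
    by (rule spacelike_to_axis[OF k]) blast
  have c: "sqrt (mink k k) \<noteq> 0" using k by (simp add: spacelike_def)
  show thesis
    by (rule that[OF F(1)]) (rule cpd_normal_form[OF imm N cpd F(2,3) c F(4)])
qed

text \<open>In any open set take a point \<open>y\<close> with \<open>k1\<close> nonzero and shrink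
  to a neighbourhood where \<open>k1\<close> does not vanish. Either K = 0 throughout it, and
  \<open>y\<close> is a flat point of the required kind, or it contains a point with K \<noteq>
  0.\<close>

lemma dense_flat_or_nonflat:
  assumes imm: "immersed_surface M x" and k1: "smooth_map_on_surface M x (k1 :: 'a \<Rightarrow> real)"
    and dense: "dense_in_surface M (\<lambda>p. k1 p \<noteq> 0)"
  shows "dense_in_surface M (\<lambda>p. k1 p \<noteq> 0 \<and> flat_or_nonflat_at M x N p)"
proof -
  have "p \<in> M closure_of {p \<in> topspace M. k1 p \<noteq> 0 \<and> flat_or_nonflat_at M x N p}" if p: "p \<in> topspace M" for p
    unfolding in_closure_of
  proof (intro conjI p allI impI)
    fix W assume W: "p \<in> W \<and> openin M W"
    have "p \<in> M closure_of {p \<in> topspace M. k1 p \<noteq> 0}"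
      using dense p by (simp add: dense_in_surface_def)
    then obtain y where y: "y \<in> W" "y \<in> topspace M" "k1 y \<noteq> 0"
      using W unfolding in_closure_of by blast
    obtain D \<phi> u where \<phi>: "surface_chart M x D \<phi>" "u \<in> D" "y = \<phi> u"
      using imm y(2) unfolding immersed_surface_def by blast
    let ?U = "(k1 \<circ> \<phi>) -` (- {0}) \<inter> D"
    have "smooth_on D (k1 \<circ> \<phi>)"
      using k1 \<phi>(1) by (simp add: smooth_map_on_surface_def)
    then have "continuous_on D (k1 \<circ> \<phi>)" by (rule smooth_on_continuous)
    then have "open ?U"
      using continuous_on_open_vimage[OF surface_chartD(1)[OF \<phi>(1)]] by blast
    then have V: "openin M (W \<inter> \<phi> ` ?U)"
      using W by (intro openin_Int surface_chart_open_image[OF \<phi>(1)]) auto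
    have yV: "y \<in> W \<inter> \<phi> ` ?U" using y \<phi> by auto
    have V1: "z \<in> W \<and> z \<in> topspace M \<and> k1 z \<noteq> 0" if "z \<in> W \<inter> \<phi> ` ?U" for z
      using that openin_subset[OF V] by auto
    show "\<exists>y. y \<in> {p \<in> topspace M. k1 p \<noteq> 0 \<and> flat_or_nonflat_at M x N p} \<and> y \<in> W"
    proof (cases "flat_on M x N (W \<inter> \<phi> ` ?U)")
      case True
      then have "flat_or_nonflat_at M x N y" using V yV unfolding flat_or_nonflat_at_def by blast
      then show ?thesis using y by blast
    next
      case False
      then obtain z where "z \<in> W \<inter> \<phi> ` ?U" "gaussian_curvature M x N z \<noteq> 0"
        unfolding flat_on_def by blast
      then show ?thesis using V1[of z] unfolding flat_or_nonflat_at_def by blast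
    qed
  qed
  then show ?thesis
    unfolding dense_in_surface_def by (intro equalityI closure_of_subset_topspace subsetI)
qed

lemma dense_in_surface_mono:
  assumes "dense_in_surface M P" "\<And>p. p \<in> topspace M \<Longrightarrow> P p \<Longrightarrow> Q p"
  shows "dense_in_surface M Q"
proof -
  have "{p \<in> topspace M. P p} \<subseteq> {p \<in> topspace M. Q p}" using assms(2) by blast
  from closure_of_mono[OF this, of M] show ?thesis
    using assms(1) closure_of_subset_topspace[of M] unfolding dense_in_surface_def by blast
qed

theorem theorem3p4:
  fixes M :: "'a topology" and x N :: "'a \<Rightarrow> real^3"
  assumes "spacelike_surface M x" and "unit_normal_field M x N"
  shows
    "((\<forall>p\<in>topspace M. flat_or_nonflat_at M x N p) \<and>
      (\<exists>k k1. spacelike k \<and> canonical_principal_direction M x N k k1 \<and>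
              (\<forall>p\<in>topspace M. k1 p \<noteq> 0))
      \<longleftrightarrow>
      (\<exists>F. mink_isometry F \<and>
           (\<forall>p\<in>topspace M. congruent_type1_at M x F p \<or> congruent_type2_at M x N F p)))
     \<and>
     ((\<exists>k k1. spacelike k \<and> canonical_principal_direction M x N k k1 \<and>
              dense_in_surface M (\<lambda>p. k1 p \<noteq> 0))
      \<longleftrightarrow>
      (\<exists>F. mink_isometry F \<and>
           dense_in_surface M (\<lambda>p. congruent_type1_at M x F p \<or> congruent_type2_at M x N F p)))"
proof -
  have imm: "immersed_surface M x" using assms(1) by (simp add: spacelike_surface_def)
  note N = assms(2)
  let ?type = "\<lambda>F p. congruent_type1_at M x F p \<or> congruent_type2_at M x N F p"
  have "\<exists>F. mink_isometry F \<and> (\<forall>p\<in>topspace M. ?type F p)"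
    if fn: "\<forall>p\<in>topspace M. flat_or_nonflat_at M x N p" and k: "spacelike k"
      "canonical_principal_direction M x N k k1" and k1: "\<forall>p\<in>topspace M. k1 p \<noteq> 0" for k k1
    by (rule cpd_imp_normal_forms[OF imm N k]) (use fn k1 in blast)
  moreover have "(\<forall>p\<in>topspace M. flat_or_nonflat_at M x N p) \<and>
      (\<exists>k k1. spacelike k \<and> canonical_principal_direction M x N k k1 \<and> (\<forall>p\<in>topspace M. k1 p \<noteq> 0))"
    if F: "mink_isometry F" and type: "\<forall>p\<in>topspace M. ?type F p" for F
  proof -
    \<comment> \<open>A form at every point is in particular a form on a dense set, so the global
      direction and \<open>k1\<close> come from the dense version; nonvanishing of \<open>k1\<close>
      is then available at every point.\<close>
    have "{p \<in> topspace M. ?type F p} = topspace M" using type by blast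
    then have "dense_in_surface M (?type F)" by (simp add: dense_in_surface_def)
    then show ?thesis
      by (rule normal_forms_imp_cpd[OF imm N F]) (use type in blast)
  qed
  moreover have "\<exists>F. mink_isometry F \<and> dense_in_surface M (?type F)"
    if k: "spacelike k" "canonical_principal_direction M x N k k1"
      and k1: "dense_in_surface M (\<lambda>p. k1 p \<noteq> 0)" for k k1
  proof -
    have "smooth_map_on_surface M x k1" using k(2) by (simp add: canonical_principal_direction_def)
    note dense = dense_flat_or_nonflat[OF imm this k1, of N]
    obtain F where F: "mink_isometry F" "\<forall>p\<in>topspace M. k1 p \<noteq> 0 \<and> flat_or_nonflat_at M x N p \<longrightarrow> ?type F p"
      by (rule cpd_imp_normal_forms[OF imm N k]) blast
    have "dense_in_surface M (?type F)"
      by (rule dense_in_surface_mono[OF dense]) (use F(2) in blast)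
    then show ?thesis using F(1) by blast
  qed
  moreover have "\<exists>k k1. spacelike k \<and> canonical_principal_direction M x N k k1 \<and> dense_in_surface M (\<lambda>p. k1 p \<noteq> 0)"
    if F: "mink_isometry F" "dense_in_surface M (?type F)" for F
  proof -
    obtain k k1 where k: "spacelike k" "canonical_principal_direction M x N k k1"
      and k1: "\<forall>p. ?type F p \<longrightarrow> k1 p \<noteq> 0 \<and> flat_or_nonflat_at M x N p"
      by (rule normal_forms_imp_cpd[OF imm N F]) blast
    have "dense_in_surface M (\<lambda>p. k1 p \<noteq> 0)"
      by (rule dense_in_surface_mono[OF F(2)]) (use k1 in blast)
    then show ?thesis using k by blast
  qed
  ultimately show ?thesis by blast
qed

end
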